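(* Let $X=(X_u,u\in\mathbb{T})$ be a bifurcating Markov chain on $(S,\mathscr{S})$ with initial distribution $\nu$ and probability kernel $\mathcal{P}$, let $\mathcal{Q}$ be the induced kernel, let $F\subset\mathcal{B}(S)$ satisfy the structural assumption, and suppose the second spectral gap assumption holds with $\alpha\in(1/\sqrt2,1)$. Let $\mathfrak{f}=(f_\ell,\ell\in\mathbb{N})$ be a sequence of elements of $\mathcal{B}(S^3)$ such that for all $\ell\in\mathbb{N}$, $\mathcal{P}f_\ell$ and $\mathcal{P}(f_\ell^2)$ are well defined, and such that $(\mathcal{P}f_\ell)_{\ell\in\mathbb{N}}$ and $(\mathcal{P}(f_\ell^2))_{\ell\in\mathbb{N}}$ are sequences of elements of $F$ which satisfy the uniform spectral bounds for some $g\in F$. Then $$(2\alpha^2)^{-n/2}N_{n,\emptyset}(\mathfrak{f})-\sum_{\ell\in\mathbb{N}}(2\alpha)^{-\ell}\sum_{j\in J}\theta_j^{n-\ell}M_{\infty,j}(\mathcal{P}f_\ell)\xrightarrow[n\to\infty]{}0\quad\text{in probability.}$$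
   Context: **Function spaces and kernels.** $(S,\mathscr{S})$ is a measurable space; $\mathcal{B}(E)$ (resp. $\mathcal{B}_b(E)$) is the set of real-valued (resp. bounded real-valued) measurable functions on a measurable space $E$; $\langle\lambda,f\rangle=\int f\,d\lambda$. For a probability kernel $Q$ on $S\times\mathscr{S}$, $(Qf)(x)=\int f(y)Q(x,dy)$; $Q^n$ is its $n$-th iterate, $Q^0$ the identity. For a probability kernel $\mathcal{P}$ on $S\times\mathscr{S}^{\otimes2}$, $f$ a function on $S^3$ and $h$ a function on $S^2$: $(\mathcal{P}f)(x)=\int f(x,y,z)\mathcal{P}(x,dy,dz)$, $(\mathcal{P}h)(x)=\int h(y,z)\mathcal{P}(x,dy,dz)$, whenever the integrals are well defined. Kernels extend linearly to complex-valued functions. **Tree.** $\mathbb{G}_0=\{\emptyset\}$, $\mathbb{G}_k=\{0,1\}^k$, $\mathbb{T}_k=\bigcup_{0\le r\le k}\mathbb{G}_r$, $\mathbb{T}=\bigcup_{r\ge 0}\mathbb{G}_r$; $u0,u1$ denote concatenation of $u\in\mathbb{T}$ with $0$, $1$; $|\mathbb{G}_n|=2^n$. **Bifurcating Markov chain (BMC).** $X=(X_u,u\in\mathbb{T})$ with values in $S$ is a BMC with initial distribution $\nu$ and kernel $\mathcal{P}$ (a probability kernel on $S\times\mathscr{S}^{\otimes 2}$) if $X_\emptyset$ has law $\nu$ and, for all families $(g_u)_{u\in\mathbb{T}}$ in $\mathcal{B}_b(S^3)$ and all $k\ge0$, $\mathbb{E}[\prod_{u\in\mathbb{G}_k}g_u(X_u,X_{u0},X_{u1})\mid\sigma(X_j;j\in\mathbb{T}_k)]=\prod_{u\in\mathbb{G}_k}\mathcal{P}g_u(X_u)$.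 The induced kernel is $\mathcal{Q}=\frac12(P_0+P_1)$ with $P_0(x,A)=\mathcal{P}(x,A\times S)$, $P_1(x,A)=\mathcal{P}(x,S\times A)$. Write $X_u^{\triangle}=(X_u,X_{u0},X_{u1})$. **Structural assumption on $F\subset\mathcal{B}(S)$.** Here $(f_0\otimes f_1)(x,y)=f_0(x)f_1(y)$. (i) $F$ is a vector subspace containing the constants; (ii) $f^2\in F$ for all $f\in F$; (iii) $F\subset L^1(\nu)$; (iv) for all $f_0,f_1\in F$, $f_0\otimes f_1\in L^1(\mathcal{P}(x,\cdot))$ for all $x\in S$, and $\mathcal{P}(f_0\otimes f_1)\in F$. **Second spectral gap assumption.** There are a probability measure $\mu$ on $(S,\mathscr{S})$ with $F\subset L^1(\mu)$, $\alpha\in(0,1)$, a finite non-empty index set $J$, distinct complex eigenvalues $\{\alpha_j,j\in J\}$ of the operator $\mathcal{Q}$ with $|\alpha_j|=\alpha$, non-zero complex projectors $\{\mathcal{R}_j,j\in J\}$ defined on $\mathbb{C}F$ (the $\mathbb{C}$-vector space spanned by $F$) with $\mathcal{R}_j\circ\mathcal{R}_{j'}=\mathcal{R}_{j'}\circ\mathcal{R}_j=0$ for $j\ne j'$, and a positive non-increasing sequence $(\beta_n,n\in\mathbb{N})$ bounded above by $1$ and converging to $0$, such that for all $f\in F$ there is $g\in F$ with, writing $\theta_j=\alpha_j/\alpha$, $\big|\mathcal{Q}^nf-\langle\mu,f\rangle-\alpha^n\sum_{j\in J}\theta_j^n\mathcal{R}_j(f)\big|\le\beta_n\alpha^ng$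 for all $n\in\mathbb{N}$. **Uniform spectral bounds.** A sequence $(h_\ell)_{\ell\in\mathbb{N}}$ in $F$ satisfies the uniform spectral bounds for $g\in F$ if, with $\tilde h_\ell=h_\ell-\langle\mu,h_\ell\rangle$ and $\hat h_\ell=\tilde h_\ell-\sum_{j\in J}\mathcal{R}_j(h_\ell)$, one has $|\mathcal{Q}^n(h_\ell)|\le g$, $|\mathcal{Q}^n(\tilde h_\ell)|\le\alpha^ng$ and $|\mathcal{Q}^n(\hat h_\ell)|\le\beta_n\alpha^ng$ for all $n,\ell\in\mathbb{N}$. **Notation.** For $f\in\mathcal{B}(S^3)$ and finite $A\subset\mathbb{T}$, $M_A(f)=\sum_{u\in A}f(X_u^\triangle)$, and $\tilde f=f-\langle\mu,\mathcal{P}f\rangle$. $N_{n,\emptyset}(\mathfrak{f})=|\mathbb{G}_n|^{-1/2}\sum_{\ell=0}^nM_{\mathbb{G}_{n-\ell}}(\tilde f_\ell)$. For $h\in F$ and $j\in J$, $M_{\infty,j}(h)$ denotes the limit, almost surely and in $L^2$, as $n\to\infty$ of the martingale $M_{n,j}(h)=(2\alpha_j)^{-n}\sum_{u\in\mathbb{G}_n}\mathcal{R}_j(h)(X_u)$ (with respect to the filtration $\sigma(X_u;u\in\mathbb{T}_n)$, $n\in\mathbb{N}$); this limit exists when $2\alpha^2>1$. *)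

theory Defs
  imports "HOL-Probability.Probability"
begin

text \<open>
  A measurable space is a measure \<open>S\<close> of which only \<open>space S\<close> and \<open>sets S\<close> are used. Functions on
  it are total HOL functions whose values outside \<open>space S\<close> carry no meaning: all pointwise
  conditions are restricted to \<open>space S\<close>.
\<close>

definition eq_on_space :: "'s measure \<Rightarrow> ('s \<Rightarrow> 'b) \<Rightarrow> ('s \<Rightarrow> 'b) \<Rightarrow> bool" where
  "eq_on_space S f g \<longleftrightarrow> (\<forall>x\<in>space S. f x = g x)"

subsection \<open>Kernels\<close>

text \<open>
  The \<open>n\<close>-th iterate of the operator of a kernel \<open>Q\<close> is \<open>kernel_op Q ^^ n\<close>. The codomain is
  polymorphic so that the same operator acts on real-valued and on complex-valued functions.
\<close>

definition kernel_op ::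
  "('a \<Rightarrow> 'b measure) \<Rightarrow> ('b \<Rightarrow> 'c::{banach, second_countable_topology}) \<Rightarrow> 'a \<Rightarrow> 'c" where
  "kernel_op K f x = (\<integral>y. f y \<partial>K x)"

text \<open>The action of a kernel from \<open>S\<close> to \<open>S\<^sup>2\<close> on functions on \<open>S\<^sup>3\<close>.\<close>

definition triple_op :: "('s \<Rightarrow> ('s \<times> 's) measure) \<Rightarrow> ('s \<times> 's \<times> 's \<Rightarrow> real) \<Rightarrow> 's \<Rightarrow> real" where
  "triple_op P f x = (\<integral>(y, z). f (x, y, z) \<partial>P x)"

definition triple_op_well_defined ::
  "'s measure \<Rightarrow> ('s \<Rightarrow> ('s \<times> 's) measure) \<Rightarrow> ('s \<times> 's \<times> 's \<Rightarrow> real) \<Rightarrow> bool" where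
  "triple_op_well_defined S P f \<longleftrightarrow> (\<forall>x\<in>space S. integrable (P x) (\<lambda>(y, z). f (x, y, z)))"

text \<open>The mean \<open>(P\<^sub>0 + P\<^sub>1) / 2\<close> of the two marginal kernels of \<open>P\<close>.\<close>

definition induced_kernel :: "'s measure \<Rightarrow> ('s \<Rightarrow> ('s \<times> 's) measure) \<Rightarrow> 's \<Rightarrow> 's measure" where
  "induced_kernel S P x = measure_of (space S) (sets S)
     (\<lambda>A. (emeasure (P x) (A \<times> space S) + emeasure (P x) (space S \<times> A)) / 2)"

subsection \<open>Bifurcating Markov chains\<close>

text \<open>
  A vertex of the binary tree is a list of booleans (\<open>False\<close> for 0, \<open>True\<close> for 1); the children of
  \<open>u\<close> are \<open>u @ [False]\<close> and \<open>u @ [True]\<close>.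
\<close>

definition gen :: "nat \<Rightarrow> bool list set" where
  "gen n = {u. length u = n}"

definition tree_upto :: "nat \<Rightarrow> bool list set" where
  "tree_upto n = {u. length u \<le> n}"

definition triangle :: "(bool list \<Rightarrow> 'w \<Rightarrow> 's) \<Rightarrow> bool list \<Rightarrow> 'w \<Rightarrow> 's \<times> 's \<times> 's" where
  "triangle X u \<omega> = (X u \<omega>, X (u @ [False]) \<omega>, X (u @ [True]) \<omega>)"

definition generated_sigma ::
  "'w measure \<Rightarrow> 's measure \<Rightarrow> (bool list \<Rightarrow> 'w \<Rightarrow> 's) \<Rightarrow> bool list set \<Rightarrow> 'w measure" where
  "generated_sigma M S X U = sigma (space M) {X u -` A \<inter> space M | u A. u \<in> U \<and> A \<in> sets S}"

definition bounded_measurable :: "'a measure \<Rightarrow> ('a \<Rightarrow> real) set" where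
  "bounded_measurable E = {f \<in> borel_measurable E. \<exists>C. \<forall>x\<in>space E. \<bar>f x\<bar> \<le> C}"

definition bifurcating_markov_chain ::
  "'w measure \<Rightarrow> 's measure \<Rightarrow> 's measure \<Rightarrow> ('s \<Rightarrow> ('s \<times> 's) measure)
    \<Rightarrow> (bool list \<Rightarrow> 'w \<Rightarrow> 's) \<Rightarrow> bool" where
  "bifurcating_markov_chain M S \<nu> P X \<longleftrightarrow>
     (\<forall>u. X u \<in> M \<rightarrow>\<^sub>M S) \<and>
     distr M S (X []) = \<nu> \<and>
     (\<forall>g. (\<forall>u. g u \<in> bounded_measurable (S \<Otimes>\<^sub>M S \<Otimes>\<^sub>M S)) \<longrightarrow>
       (\<forall>k. AE \<omega> in M.
         real_cond_exp M (generated_sigma M S X (tree_upto k))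
           (\<lambda>\<omega>. \<Prod>u\<in>gen k. g u (triangle X u \<omega>)) \<omega>
         = (\<Prod>u\<in>gen k. triple_op P (g u) (X u \<omega>))))"

subsection \<open>Assumptions on the function class\<close>

text \<open>
  \<open>F\<close> is required to be invariant under changes of its members outside \<open>space S\<close>; this encodes
  that it is a set of functions on \<open>space S\<close>.
\<close>

definition structural_assumption ::
  "'s measure \<Rightarrow> 's measure \<Rightarrow> ('s \<Rightarrow> ('s \<times> 's) measure) \<Rightarrow> ('s \<Rightarrow> real) set \<Rightarrow> bool" where
  "structural_assumption S \<nu> P F \<longleftrightarrow>
     F \<subseteq> borel_measurable S \<and>
     (\<forall>f\<in>F. \<forall>g. eq_on_space S f g \<longrightarrow> g \<in> F) \<and>
     (\<forall>c. (\<lambda>_. c) \<in> F) \<and>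
     (\<forall>f\<in>F. \<forall>g\<in>F. (\<lambda>x. f x + g x) \<in> F) \<and>
     (\<forall>c. \<forall>f\<in>F. (\<lambda>x. c * f x) \<in> F) \<and>
     (\<forall>f\<in>F. (\<lambda>x. (f x)\<^sup>2) \<in> F) \<and>
     (\<forall>f\<in>F. integrable \<nu> f) \<and>
     (\<forall>f0\<in>F. \<forall>f1\<in>F.
        (\<forall>x\<in>space S. integrable (P x) (\<lambda>(y, z). f0 y * f1 z)) \<and>
        kernel_op P (\<lambda>(y, z). f0 y * f1 z) \<in> F)"

definition complex_span :: "('s \<Rightarrow> real) set \<Rightarrow> ('s \<Rightarrow> complex) set" where
  "complex_span F =
     {(\<lambda>x. \<Sum>i<n. c i * complex_of_real (\<phi> i x)) | (n::nat) c \<phi>. \<forall>i<n. \<phi> i \<in> F}"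

definition complexify :: "('s \<Rightarrow> real) \<Rightarrow> 's \<Rightarrow> complex" where
  "complexify f x = complex_of_real (f x)"

text \<open>
  The second clause says that an operator on functions on \<open>space S\<close> does not see
  the values of its argument outside \<open>space S\<close>.
\<close>

definition complex_projector ::
  "'s measure \<Rightarrow> ('s \<Rightarrow> complex) set \<Rightarrow> (('s \<Rightarrow> complex) \<Rightarrow> 's \<Rightarrow> complex) \<Rightarrow> bool" where
  "complex_projector S V R \<longleftrightarrow>
     (\<forall>f\<in>V. R f \<in> V) \<and>
     (\<forall>f\<in>V. \<forall>g\<in>V. eq_on_space S f g \<longrightarrow> eq_on_space S (R f) (R g)) \<and>
     (\<forall>f\<in>V. \<forall>g\<in>V. eq_on_space S (R (\<lambda>x. f x + g x)) (\<lambda>x. R f x + R g x)) \<and>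
     (\<forall>c. \<forall>f\<in>V. eq_on_space S (R (\<lambda>x. c * f x)) (\<lambda>x. c * R f x)) \<and>
     (\<forall>f\<in>V. eq_on_space S (R (R f)) (R f))"

definition is_eigenvalue ::
  "'s measure \<Rightarrow> ('s \<Rightarrow> 's measure) \<Rightarrow> ('s \<Rightarrow> complex) set \<Rightarrow> complex \<Rightarrow> bool" where
  "is_eigenvalue S Q V a \<longleftrightarrow>
     (\<exists>f\<in>V. \<not> eq_on_space S f (\<lambda>_. 0) \<and> eq_on_space S (kernel_op Q f) (\<lambda>x. a * f x))"

text \<open>The eigenvalues are \<open>a j\<close>; \<open>a j / \<alpha>\<close> is their normalisation \<open>\<theta>\<^sub>j\<close> of modulus one.\<close>

definition second_spectral_gap ::
  "'s measure \<Rightarrow> ('s \<Rightarrow> 's measure) \<Rightarrow> ('s \<Rightarrow> real) set \<Rightarrow> 's measure \<Rightarrow> real \<Rightarrow> 'j set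
    \<Rightarrow> ('j \<Rightarrow> complex) \<Rightarrow> ('j \<Rightarrow> ('s \<Rightarrow> complex) \<Rightarrow> 's \<Rightarrow> complex) \<Rightarrow> (nat \<Rightarrow> real) \<Rightarrow> bool" where
  "second_spectral_gap S Q F \<mu> \<alpha> J a R \<beta> \<longleftrightarrow>
     prob_space \<mu> \<and> sets \<mu> = sets S \<and> (\<forall>f\<in>F. integrable \<mu> f) \<and>
     0 < \<alpha> \<and> \<alpha> < 1 \<and>
     finite J \<and> J \<noteq> {} \<and>
     inj_on a J \<and>
     (\<forall>j\<in>J. is_eigenvalue S Q (complex_span F) (a j) \<and> cmod (a j) = \<alpha>) \<and>
     (\<forall>j\<in>J. complex_projector S (complex_span F) (R j) \<and>
        (\<exists>f\<in>complex_span F. \<not> eq_on_space S (R j f) (\<lambda>_. 0))) \<and>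
     (\<forall>j\<in>J. \<forall>j'\<in>J. j \<noteq> j' \<longrightarrow>
        (\<forall>f\<in>complex_span F. eq_on_space S (R j (R j' f)) (\<lambda>_. 0))) \<and>
     (\<forall>n. 0 < \<beta> n \<and> \<beta> n \<le> 1) \<and> decseq \<beta> \<and> \<beta> \<longlonglongrightarrow> 0 \<and>
     (\<forall>f\<in>F. \<exists>g\<in>F. \<forall>n. \<forall>x\<in>space S.
        cmod (complex_of_real ((kernel_op Q ^^ n) f x) - complex_of_real (\<integral>y. f y \<partial>\<mu>)
              - complex_of_real \<alpha> ^ n
                * (\<Sum>j\<in>J. (a j / complex_of_real \<alpha>) ^ n * R j (complexify f) x))
        \<le> \<beta> n * \<alpha> ^ n * g x)"

definition mean_centered :: "'s measure \<Rightarrow> ('s \<Rightarrow> real) \<Rightarrow> 's \<Rightarrow> real" where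
  "mean_centered \<mu> h x = h x - (\<integral>y. h y \<partial>\<mu>)"

definition spectrally_centered ::
  "'s measure \<Rightarrow> 'j set \<Rightarrow> ('j \<Rightarrow> ('s \<Rightarrow> complex) \<Rightarrow> 's \<Rightarrow> complex) \<Rightarrow> ('s \<Rightarrow> real) \<Rightarrow> 's \<Rightarrow> complex"
  where
  "spectrally_centered \<mu> J R h x =
     complex_of_real (mean_centered \<mu> h x) - (\<Sum>j\<in>J. R j (complexify h) x)"

definition uniform_spectral_bounds ::
  "'s measure \<Rightarrow> ('s \<Rightarrow> 's measure) \<Rightarrow> ('s \<Rightarrow> real) set \<Rightarrow> 's measure \<Rightarrow> real \<Rightarrow> 'j set
    \<Rightarrow> ('j \<Rightarrow> ('s \<Rightarrow> complex) \<Rightarrow> 's \<Rightarrow> complex) \<Rightarrow> (nat \<Rightarrow> real)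
    \<Rightarrow> (nat \<Rightarrow> 's \<Rightarrow> real) \<Rightarrow> ('s \<Rightarrow> real) \<Rightarrow> bool" where
  "uniform_spectral_bounds S Q F \<mu> \<alpha> J R \<beta> h g \<longleftrightarrow>
     (\<forall>l. h l \<in> F) \<and> g \<in> F \<and>
     (\<forall>n l. \<forall>x\<in>space S.
        \<bar>(kernel_op Q ^^ n) (h l) x\<bar> \<le> g x \<and>
        \<bar>(kernel_op Q ^^ n) (mean_centered \<mu> (h l)) x\<bar> \<le> \<alpha> ^ n * g x \<and>
        cmod ((kernel_op Q ^^ n) (spectrally_centered \<mu> J R (h l)) x) \<le> \<beta> n * \<alpha> ^ n * g x)"

subsection \<open>The limiting quantities\<close>

definition tree_sum ::
  "(bool list \<Rightarrow> 'w \<Rightarrow> 's) \<Rightarrow> bool list set \<Rightarrow> ('s \<times> 's \<times> 's \<Rightarrow> real) \<Rightarrow> 'w \<Rightarrow> real" where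
  "tree_sum X A f \<omega> = (\<Sum>u\<in>A. f (triangle X u \<omega>))"

definition triple_centered ::
  "('s \<Rightarrow> ('s \<times> 's) measure) \<Rightarrow> 's measure \<Rightarrow> ('s \<times> 's \<times> 's \<Rightarrow> real) \<Rightarrow> 's \<times> 's \<times> 's \<Rightarrow> real" where
  "triple_centered P \<mu> f t = f t - (\<integral>x. triple_op P f x \<partial>\<mu>)"

definition N_root ::
  "('s \<Rightarrow> ('s \<times> 's) measure) \<Rightarrow> 's measure \<Rightarrow> (bool list \<Rightarrow> 'w \<Rightarrow> 's)
    \<Rightarrow> (nat \<Rightarrow> 's \<times> 's \<times> 's \<Rightarrow> real) \<Rightarrow> nat \<Rightarrow> 'w \<Rightarrow> real" where
  "N_root P \<mu> X f n \<omega> =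
     real (card (gen n)) powr (- 1 / 2)
     * (\<Sum>l\<le>n. tree_sum X (gen (n - l)) (triple_centered P \<mu> (f l)) \<omega>)"

definition eigen_martingale ::
  "(bool list \<Rightarrow> 'w \<Rightarrow> 's) \<Rightarrow> complex \<Rightarrow> (('s \<Rightarrow> complex) \<Rightarrow> 's \<Rightarrow> complex)
    \<Rightarrow> ('s \<Rightarrow> real) \<Rightarrow> nat \<Rightarrow> 'w \<Rightarrow> complex" where
  "eigen_martingale X a R h n \<omega> =
     (2 * a) powi (- int n) * (\<Sum>u\<in>gen n. R (complexify h) (X u \<omega>))"

definition as_L2_limit :: "'w measure \<Rightarrow> (nat \<Rightarrow> 'w \<Rightarrow> complex) \<Rightarrow> ('w \<Rightarrow> complex) \<Rightarrow> bool" where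
  "as_L2_limit M Z Y \<longleftrightarrow>
     Y \<in> borel_measurable M \<and>
     integrable M (\<lambda>\<omega>. (cmod (Y \<omega>))\<^sup>2) \<and>
     (AE \<omega> in M. (\<lambda>n. Z n \<omega>) \<longlonglongrightarrow> Y \<omega>) \<and>
     (\<lambda>n. \<integral>\<^sup>+\<omega>. ennreal ((cmod (Z n \<omega> - Y \<omega>))\<^sup>2) \<partial>M) \<longlonglongrightarrow> 0"

text \<open>
  The limit is unique up to almost sure equality; any version may be chosen. If no limit existed,
  the choice would be unconstrained, so a statement about it includes the existence of the limit.
\<close>

definition eigen_martingale_limit ::
  "'w measure \<Rightarrow> (bool list \<Rightarrow> 'w \<Rightarrow> 's) \<Rightarrow> complex \<Rightarrow> (('s \<Rightarrow> complex) \<Rightarrow> 's \<Rightarrow> complex)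
    \<Rightarrow> ('s \<Rightarrow> real) \<Rightarrow> 'w \<Rightarrow> complex" where
  "eigen_martingale_limit M X a R h = (SOME Y. as_L2_limit M (eigen_martingale X a R h) Y)"

definition tends_to_zero_in_probability :: "'w measure \<Rightarrow> (nat \<Rightarrow> 'w \<Rightarrow> complex) \<Rightarrow> bool" where
  "tends_to_zero_in_probability M Z \<longleftrightarrow>
     (\<forall>n. Z n \<in> borel_measurable M) \<and>
     (\<forall>\<epsilon>>0. (\<lambda>n. measure M {\<omega> \<in> space M. cmod (Z n \<omega>) > \<epsilon>}) \<longlonglongrightarrow> 0)"

end

theory Submission
  imports Defs
begin

text \<open>
  Write \<open>h\<^sub>l = P f\<^sub>l\<close> and let \<open>G\<^sub>m\<close> be the \<open>m\<close>-th generation. It suffices to approximate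
  \<open>(2\<alpha>)\<^sup>-\<^sup>m \<Sum>\<^bsub>u \<in> G\<^sub>m\<^esub> (f\<^sub>l (X\<^sub>u\<^sup>\<triangle>) - \<langle>\<mu>, h\<^sub>l\<rangle>)\<close> by \<open>\<Sum>\<^sub>j \<theta>\<^sub>j\<^sup>m M\<^sub>\<infinity>\<^sub>,\<^sub>j(h\<^sub>l)\<close> in \<open>L\<^sup>1\<close> with an error
  tending to 0 as \<open>m \<rightarrow> \<infinity>\<close>, uniformly in \<open>l\<close>: since \<open>2\<alpha> > 1\<close>, summing these errors against \<open>(2\<alpha>)\<^sup>-\<^sup>l\<close> gives
  a geometric convolution of a null sequence. The difference splits into three parts. The fluctuations
  \<open>f\<^sub>l (X\<^sub>u\<^sup>\<triangle>) - h\<^sub>l (X\<^sub>u)\<close> are orthogonal within a generation, so their sum has \<open>L\<^sup>2\<close> norm \<open>O(2\<^sup>m\<^sup>/\<^sup>2)\<close>,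
  which is small because \<open>\<surd>2 \<alpha> > 1\<close>. The spectrally centred part is iterated down the tree with the
  same orthogonality bound, and its decay \<open>\<beta>\<^sub>n \<alpha>\<^sup>n\<close> under \<open>Q\<^sup>n\<close> gives again a geometric
  convolution. Finally \<open>R\<^sub>j h\<^sub>l\<close> is an eigenfunction of \<open>Q\<close>, bounded by \<open>2 g\<close>, and the increments of its
  martingale decay geometrically in \<open>L\<^sup>2\<close>, so it converges without any martingale theorem.
\<close>

text \<open>Nothing in the spectral gap assumption says that \<open>R j h\<close> is an
  eigenfunction, and the uniform bounds control no single \<open>R j h\<close>, only the sum over
  \<open>J\<close>. Both facts are recovered by averaging against unimodular phases, which separates
  the distinct \<open>\<theta> j\<close>; the bound by \<open>2 g\<close> is what makes the
  martingale estimates uniform in \<open>l\<close>. A second obstacle is integrability: the Markov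
  property speaks of bounded functions, while \<open>f l\<close> and the members of \<open>F\<close>
  may be unbounded. Hence moments are kept as non-negative integrals bounded from above, and no
  conditional expectation of an unbounded variable is formed. The driving ratio is
  \<open>s = sqrt 2 / (2 * \<alpha>)\<close>: a generation sum fluctuates like
  \<open>sqrt 2 ^ m\<close> and is normalised by \<open>(2 * \<alpha>) ^ m\<close>, so the
  hypothesis on \<alpha> says exactly that \<open>s < 1\<close>. Finally, the limit series runs over
  all \<open>l\<close>, whereas \<open>N_root\<close> stops at \<open>l = n\<close>; the terms
  beyond \<open>n\<close> carry phases with negative exponents, but of modulus one, and their sum is
  of order \<open>1 / (2 * \<alpha>) ^ n\<close> in L^1.\<close>

section \<open>Sequences and convergence in mean\<close>

text \<open>Averaging \<open>\<theta>\<^sub>k\<^sup>-\<^sup>m\<close> times the sum over \<open>m < N\<close> isolates the \<open>k\<close>-th coefficient as \<open>N \<rightarrow> \<infinity>\<close>.\<close>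

lemma unimodular_coeff_bound:
  fixes \<theta> c :: "'j \<Rightarrow> complex"
  assumes "finite J" and inj: "inj_on \<theta> J" and one: "\<And>j. j \<in> J \<Longrightarrow> cmod (\<theta> j) = 1"
    and bound: "\<And>m. cmod (\<Sum>j\<in>J. \<theta> j ^ m * c j) \<le> C" and k: "k \<in> J"
  shows "cmod (c k) \<le> C"
proof -
  \<comment> \<open>For q = \<open>\<theta> j / \<theta> k\<close>, which differs from 1, every
    partial geometric sum is at most 2 / |1 - q|. So \<open>D\<close> does not depend on the number
    N of terms and disappears after division by N.\<close>
  define D where "D = (\<Sum>j\<in>J - {k}. cmod (c j) * (2 / cmod (1 - \<theta> j / \<theta> k)))"
  have k0: "\<theta> k \<noteq> 0" and invk: "cmod (inverse (\<theta> k)) = 1"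
    using one[OF k] by (auto simp: norm_inverse)
  have "real N * cmod (c k) \<le> real N * C + D" for N
  proof -
    have split: "(\<Sum>m<N. inverse (\<theta> k) ^ m * (\<Sum>j\<in>J. \<theta> j ^ m * c j))
        = of_nat N * c k + (\<Sum>j\<in>J - {k}. c j * (\<Sum>m<N. (\<theta> j / \<theta> k) ^ m))"
    proof -
      have "(\<Sum>m<N. inverse (\<theta> k) ^ m * (\<Sum>j\<in>J. \<theta> j ^ m * c j))
          = (\<Sum>j\<in>J. c j * (\<Sum>m<N. (\<theta> j / \<theta> k) ^ m))"
        unfolding sum_distrib_left
        by (subst sum.swap) (simp add: power_divide power_inverse field_simps)
      also have "\<dots> = c k * (\<Sum>m<N. (\<theta> k / \<theta> k) ^ m)
          + (\<Sum>j\<in>J - {k}. c j * (\<Sum>m<N. (\<theta> j / \<theta> k) ^ m))"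
        using assms(1) k by (simp add: sum.remove)
      finally show ?thesis using k0 by (simp add: mult.commute)
    qed
    have "cmod (\<Sum>j\<in>J - {k}. c j * (\<Sum>m<N. (\<theta> j / \<theta> k) ^ m)) \<le> D"
      unfolding D_def
    proof (rule sum_norm_le)
      fix j assume j: "j \<in> J - {k}"
      let ?q = "\<theta> j / \<theta> k"
      have q1: "?q \<noteq> 1" using inj j k k0 by (auto simp: inj_on_def)
      have "cmod (\<Sum>m<N. ?q ^ m) = cmod (1 - ?q ^ N) / cmod (1 - ?q)"
        using q1 by (simp only: sum_gp_strict if_False norm_divide)
      also have "cmod (1 - ?q ^ N) \<le> 2"
        using norm_triangle_ineq4[of 1 "?q ^ N"] one[of j] one[OF k] j
        by (simp add: norm_power norm_divide)
      finally show "cmod (c j * (\<Sum>m<N. ?q ^ m)) \<le> cmod (c j) * (2 / cmod (1 - ?q))"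
        unfolding norm_mult by (intro mult_left_mono) (auto simp: divide_right_mono)
    qed
    moreover have "cmod (\<Sum>m<N. inverse (\<theta> k) ^ m * (\<Sum>j\<in>J. \<theta> j ^ m * c j)) \<le> (\<Sum>m<N. C)"
      using bound invk by (intro sum_norm_le) (simp add: norm_mult norm_power)
    moreover have "real N * cmod (c k) = cmod (of_nat N * c k)"
      by (simp add: norm_mult)
    ultimately show ?thesis
      using norm_triangle_ineq4[of "of_nat N * c k + (\<Sum>j\<in>J - {k}. c j * (\<Sum>m<N. (\<theta> j / \<theta> k) ^ m))"
          "(\<Sum>j\<in>J - {k}. c j * (\<Sum>m<N. (\<theta> j / \<theta> k) ^ m))"] split
      by simp
  qed
  then have *: "real N * (cmod (c k) - C) \<le> D" for N
    by (simp add: algebra_simps)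
  show ?thesis
  proof (rule ccontr)
    assume "\<not> ?thesis"
    then have "0 < cmod (c k) - C" by simp
    from ex_less_of_nat_mult[OF this, of D] * show False
      by (metis linorder_not_le)
  qed
qed

text \<open>Starting the averaging at a late index \<open>m0\<close> multiplies each
  \<open>c j\<close> by \<open>\<theta> j ^ m0\<close>, which leaves its modulus unchanged, while
  the bound has become as small as desired.\<close>

lemma unimodular_coeff_zero:
  fixes \<theta> c :: "'j \<Rightarrow> complex"
  assumes J: "finite J" "inj_on \<theta> J" and one: "\<And>j. j \<in> J \<Longrightarrow> cmod (\<theta> j) = 1"
    and bound: "\<And>m. cmod (\<Sum>j\<in>J. \<theta> j ^ m * c j) \<le> b m" and b: "b \<longlonglongrightarrow> 0" and k: "k \<in> J"
  shows "c k = 0"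
proof -
  have "cmod (c k) \<le> 0 + e" if "e > 0" for e
  proof -
    from b \<open>e > 0\<close> obtain m0 where m0: "\<And>m. m \<ge> m0 \<Longrightarrow> b m < e"
      using order_tendstoD(2)[OF b, of e] by (auto simp: eventually_sequentially)
    have "cmod (\<theta> k ^ m0 * c k) \<le> e"
    proof (rule unimodular_coeff_bound[OF J one _ k])
      fix m
      show "cmod (\<Sum>j\<in>J. \<theta> j ^ m * (\<theta> j ^ m0 * c j)) \<le> e"
        using bound[of "m + m0"] m0[of "m + m0"] by (simp add: power_add mult.assoc)
    qed
    then show ?thesis using one[OF k] by (simp add: norm_mult norm_power)
  qed
  then have "cmod (c k) \<le> 0" by (rule field_le_epsilon)
  then show ?thesis by simp
qed

text \<open>Tannery's theorem: with the terms k > n padded by 0, each term tends to 0 for fixed k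
  and is dominated by the summable \<open>s ^ k * B\<close>.\<close>

lemma geometric_convolution_tendsto_zero:
  fixes b :: "nat \<Rightarrow> real"
  assumes s: "0 \<le> s" "s < 1" and b: "b \<longlonglongrightarrow> 0"
  shows "(\<lambda>n. \<Sum>k\<le>n. s ^ k * b (n - k)) \<longlonglongrightarrow> 0"
proof -
  obtain B where B: "\<And>n. \<bar>b n\<bar> \<le> B"
    using convergent_imp_Bseq[OF convergentI[OF b]] by (auto simp: Bseq_def)
  let ?f = "\<lambda>k n. if k \<le> n then s ^ k * b (n - k) else 0"
  have "(\<lambda>n. \<Sum>k. ?f k n) \<longlonglongrightarrow> (\<Sum>k. 0)"
  proof (rule tannerys_theorem[where M = "\<lambda>k. s ^ k * B", THEN conjunct2, THEN conjunct2])
    fix k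
    have "(\<lambda>n. s ^ k * b n) \<longlonglongrightarrow> s ^ k * 0" by (intro tendsto_intros b)
    then have "(\<lambda>n. ?f k (n + k)) \<longlonglongrightarrow> 0" by simp
    then show "(\<lambda>n. ?f k n) \<longlonglongrightarrow> 0" by (rule LIMSEQ_offset)
  next
    show "summable (\<lambda>k. s ^ k * B)" using s by (intro summable_mult2 summable_geometric) auto
    show "\<forall>\<^sub>F (k, n) in at_top \<times>\<^sub>F sequentially. norm (?f k n) \<le> s ^ k * B"
      using s B by (intro always_eventually)
        (auto simp: norm_mult abs_mult intro!: mult_left_mono mult_nonneg_nonneg order_trans[OF abs_ge_zero B])
  qed simp
  moreover have "(\<Sum>k. ?f k n) = (\<Sum>k\<le>n. s ^ k * b (n - k))" for n
    by (subst suminf_finite[of "{..n}"]) auto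
  ultimately show ?thesis by simp
qed

text \<open>Orthogonality yields second moments, but the errors are finally added in L^1; this is
  the passage between the two, in a form that presupposes no integrability.\<close>

lemma (in prob_space) nn_integral_norm_le_of_square:
  fixes W :: "'a \<Rightarrow> 'b::{banach, second_countable_topology}"
  assumes [measurable]: "W \<in> borel_measurable M"
    and le: "(\<integral>\<^sup>+\<omega>. ennreal ((norm (W \<omega>))\<^sup>2) \<partial>M) \<le> ennreal (C\<^sup>2)" and C: "0 < C"
  shows "(\<integral>\<^sup>+\<omega>. ennreal (norm (W \<omega>)) \<partial>M) \<le> ennreal C"
proof -
  \<comment> \<open>AM-GM: \<open>2 C |W| \<le> C\<^sup>2 + |W|\<^sup>2\<close>\<close>
  have "norm (W \<omega>) \<le> C / 2 + 1 / (2 * C) * (norm (W \<omega>))\<^sup>2" for \<omega>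
    using C sum_squares_ge_zero[of "C - norm (W \<omega>)" 0]
    by (simp add: field_simps power2_eq_square)
  then have "(\<integral>\<^sup>+\<omega>. ennreal (norm (W \<omega>)) \<partial>M)
      \<le> (\<integral>\<^sup>+\<omega>. ennreal (C / 2) + ennreal (1 / (2 * C)) * ennreal ((norm (W \<omega>))\<^sup>2) \<partial>M)"
    using C by (intro nn_integral_mono) (simp add: ennreal_mult''[symmetric] ennreal_plus[symmetric] del: ennreal_plus)
  also have "\<dots> = ennreal (C / 2) + ennreal (1 / (2 * C)) * (\<integral>\<^sup>+\<omega>. ennreal ((norm (W \<omega>))\<^sup>2) \<partial>M)"
    by (simp add: nn_integral_add nn_integral_cmult emeasure_space_1)
  also have "\<dots> \<le> ennreal (C / 2) + ennreal (1 / (2 * C)) * ennreal (C\<^sup>2)"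
    by (intro add_left_mono mult_left_mono le) auto
  also have "\<dots> = ennreal C"
    using C by (simp add: ennreal_mult''[symmetric] ennreal_plus[symmetric] power2_eq_square field_simps del: ennreal_plus)
  finally show ?thesis .
qed

text \<open>Fatou's lemma, in the form that removes truncations and lets one index of a Cauchy
  estimate go to infinity.\<close>

lemma nn_integral_le_of_AE_tendsto:
  fixes f :: "nat \<Rightarrow> 'a \<Rightarrow> ennreal"
  assumes [measurable]: "\<And>n. f n \<in> borel_measurable M"
    and lim: "AE x in M. (\<lambda>n. f n x) \<longlonglongrightarrow> g x" and le: "\<And>n. (\<integral>\<^sup>+x. f n x \<partial>M) \<le> C"
  shows "(\<integral>\<^sup>+x. g x \<partial>M) \<le> C"
proof -
  have "(\<integral>\<^sup>+x. g x \<partial>M) = (\<integral>\<^sup>+x. liminf (\<lambda>n. f n x) \<partial>M)"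
    by (rule nn_integral_cong_AE) (use lim in eventually_elim, simp add: lim_imp_Liminf)
  also have "\<dots> \<le> liminf (\<lambda>n. \<integral>\<^sup>+x. f n x \<partial>M)" by (rule nn_integral_liminf) simp
  also have "\<dots> \<le> C" by (rule Liminf_le) (simp_all add: le)
  finally show ?thesis .
qed

section \<open>Truncation and elementary measurability\<close>

definition clip :: "nat \<Rightarrow> real \<Rightarrow> real" where
  "clip n r = max (- real n) (min (real n) r)"

lemma abs_clip_le: "\<bar>clip n r\<bar> \<le> real n" "\<bar>clip n r\<bar> \<le> \<bar>r\<bar>" "clip n r \<le> real n"
  by (auto simp: clip_def)

lemma clip_tendsto: "(\<lambda>n. clip n r) \<longlonglongrightarrow> r"
proof (rule tendsto_eventually)
  obtain N where "\<bar>r\<bar> \<le> real N" using real_arch_simple by blast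
  then show "\<forall>\<^sub>F n in sequentially. clip n r = r"
    by (auto simp: clip_def eventually_sequentially intro!: exI[of _ N])
qed

lemma measurable_clip [measurable (raw)]:
  "f \<in> borel_measurable M \<Longrightarrow> (\<lambda>x. clip n (f x)) \<in> borel_measurable M"
  unfolding clip_def by simp

lemma bounded_measurableI:
  "f \<in> borel_measurable N \<Longrightarrow> (\<And>t. t \<in> space N \<Longrightarrow> \<bar>f t\<bar> \<le> C) \<Longrightarrow> f \<in> bounded_measurable N"
  by (auto simp: bounded_measurable_def)

lemma integrable_complexI:
  assumes "integrable N (\<lambda>x. Re (\<phi> x))" "integrable N (\<lambda>x. Im (\<phi> x))"
  shows "integrable N \<phi>"
proof -
  have "integrable N (\<lambda>x. complex_of_real (Re (\<phi> x)) + \<i> * complex_of_real (Im (\<phi> x)))"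
    using assms by (intro Bochner_Integration.integrable_add integrable_mult_right integrable_of_real)
  then show ?thesis by (simp add: complex_eq[symmetric])
qed

text \<open>The exponent \<open>4 * n\<close> leaves room for the weights: dividing the increments
  by \<open>t ^ n\<close> still leaves second moments of order \<open>t ^ (2 * n)\<close>, which are
  summable, and the weights themselves are square summable.\<close>

lemma
  fixes Z :: "nat \<Rightarrow> 'a \<Rightarrow> 'b::{banach, second_countable_topology}"
  assumes meas [measurable]: "\<And>n. Z n \<in> borel_measurable M"
    and t: "0 < t" "t < 1" and D: "0 \<le> D"
    and incr: "\<And>n. (\<integral>\<^sup>+\<omega>. ennreal ((norm (Z (Suc n) \<omega> - Z n \<omega>))\<^sup>2) \<partial>M) \<le> ennreal (D * t ^ (4 * n))"
  shows geometric_increments_AE_convergent: "AE \<omega> in M. convergent (\<lambda>n. Z n \<omega>)"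
    and geometric_increments_L2_bound: "(AE \<omega> in M. (\<lambda>n. Z n \<omega>) \<longlonglongrightarrow> Y \<omega>) \<Longrightarrow>
      (\<integral>\<^sup>+\<omega>. ennreal ((norm (Z n \<omega> - Y \<omega>))\<^sup>2) \<partial>M) \<le> ennreal (D * t ^ (4 * n) / (1 - t\<^sup>2)\<^sup>2)"
proof -
  \<comment> \<open>Cauchy-Schwarz with the weights \<open>t\<^sup>n\<close>, the square root of the decay of the increments.\<close>
  define \<Delta> where "\<Delta> n \<omega> = norm (Z (Suc n) \<omega> - Z n \<omega>)" for n \<omega>
  have [measurable]: "\<Delta> n \<in> borel_measurable M" for n unfolding \<Delta>_def[abs_def] by measurable
  have \<Delta>0: "0 \<le> \<Delta> n \<omega>" for n \<omega> by (simp add: \<Delta>_def)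
  have t2: "0 < t\<^sup>2" "t\<^sup>2 < 1" using t by (auto simp: power_less_one_iff)
  have t4: "t ^ (4 * n) = (t\<^sup>2) ^ n * (t\<^sup>2) ^ n" for n
    by (simp add: power_mult[symmetric] power_add[symmetric])
  have weighted: "(\<integral>\<^sup>+\<omega>. ennreal ((\<Delta> n \<omega> / t ^ n)\<^sup>2) \<partial>M) \<le> ennreal (D * (t\<^sup>2) ^ n)" for n
  proof -
    have "(\<integral>\<^sup>+\<omega>. ennreal ((\<Delta> n \<omega> / t ^ n)\<^sup>2) \<partial>M) = (\<integral>\<^sup>+\<omega>. ennreal (1 / (t\<^sup>2) ^ n) * ennreal ((\<Delta> n \<omega>)\<^sup>2) \<partial>M)"
      using t by (intro nn_integral_cong)
        (simp add: ennreal_mult''[symmetric] power_divide power_mult[symmetric] mult.commute)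
    also have "\<dots> = ennreal (1 / (t\<^sup>2) ^ n) * (\<integral>\<^sup>+\<omega>. ennreal ((\<Delta> n \<omega>)\<^sup>2) \<partial>M)"
      by (rule nn_integral_cmult) measurable
    also have "\<dots> \<le> ennreal (1 / (t\<^sup>2) ^ n) * ennreal (D * t ^ (4 * n))"
      using incr by (intro mult_left_mono) (auto simp: \<Delta>_def)
    also have "\<dots> = ennreal (1 / (t\<^sup>2) ^ n * (D * t ^ (4 * n)))"
      using t D by (intro ennreal_mult'[symmetric]) auto
    finally show ?thesis using t by (simp add: t4)
  qed
  show "AE \<omega> in M. convergent (\<lambda>n. Z n \<omega>)"
  proof -
    have "(\<integral>\<^sup>+\<omega>. (\<Sum>n. ennreal ((\<Delta> n \<omega> / t ^ n)\<^sup>2)) \<partial>M) = (\<Sum>n. \<integral>\<^sup>+\<omega>. ennreal ((\<Delta> n \<omega> / t ^ n)\<^sup>2) \<partial>M)"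
      by (rule nn_integral_suminf) measurable
    also have "\<dots> \<le> (\<Sum>n. ennreal (D * (t\<^sup>2) ^ n))"
      by (intro suminf_le weighted) auto
    also have "\<dots> = ennreal (\<Sum>n. D * (t\<^sup>2) ^ n)"
      using t2 D by (intro suminf_ennreal2 summable_mult summable_geometric) auto
    finally have "(\<integral>\<^sup>+\<omega>. (\<Sum>n. ennreal ((\<Delta> n \<omega> / t ^ n)\<^sup>2)) \<partial>M) \<noteq> \<infinity>"
      by (auto simp: top_unique)
    then have "AE \<omega> in M. (\<Sum>n. ennreal ((\<Delta> n \<omega> / t ^ n)\<^sup>2)) \<noteq> \<infinity>"
      by (intro nn_integral_noteq_infinite) measurable
    then show ?thesis
    proof eventually_elim
      case (elim \<omega>)
      then have "summable (\<lambda>n. (\<Delta> n \<omega> / t ^ n)\<^sup>2)" by (intro summable_suminf_not_top) auto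
      then have "summable (\<lambda>n. (\<Delta> n \<omega> / t ^ n)\<^sup>2 + (t\<^sup>2) ^ n)"
        using t2 by (intro summable_add summable_geometric) auto
      then have "summable (\<lambda>n. Z (Suc n) \<omega> - Z n \<omega>)"
      proof (rule summable_comparison_test')
        fix n
        \<comment> \<open>AM-GM turns summability of the weighted squares into absolute summability
          of the increments, with the weights squared as the second summand.\<close>
        have "0 \<le> (\<Delta> n \<omega> / t ^ n - t ^ n)\<^sup>2" by simp
        also have "\<dots> = (\<Delta> n \<omega> / t ^ n)\<^sup>2 + (t\<^sup>2) ^ n - 2 * \<Delta> n \<omega>"
          using t by (simp add: power2_diff power_mult[symmetric] mult.commute[of 2 n])
        finally show "norm (Z (Suc n) \<omega> - Z n \<omega>) \<le> (\<Delta> n \<omega> / t ^ n)\<^sup>2 + (t\<^sup>2) ^ n"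
          using \<Delta>0[of n \<omega>] unfolding \<Delta>_def[symmetric] by linarith
      qed
      then have "convergent (\<lambda>n. Z n \<omega> - Z 0 \<omega>)"
        by (simp add: summable_iff_convergent sum_lessThan_telescope[of "\<lambda>n. Z n \<omega>"])
      from convergent_add[OF this convergent_const[of "Z 0 \<omega>"]] show ?case by simp
    qed
  qed
  assume lim: "AE \<omega> in M. (\<lambda>n. Z n \<omega>) \<longlonglongrightarrow> Y \<omega>"
  show "(\<integral>\<^sup>+\<omega>. ennreal ((norm (Z n \<omega> - Y \<omega>))\<^sup>2) \<partial>M) \<le> ennreal (D * t ^ (4 * n) / (1 - t\<^sup>2)\<^sup>2)"
  \<comment> \<open>The distance to the limit is reached by Fatou from the distances to
    \<open>Z (p + n)\<close>, which are bounded uniformly in \<open>p\<close>.\<close>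
  proof (rule nn_integral_le_of_AE_tendsto[where f = "\<lambda>p \<omega>. ennreal ((norm (Z n \<omega> - Z (p + n) \<omega>))\<^sup>2)"])
    show "AE \<omega> in M. (\<lambda>p. ennreal ((norm (Z n \<omega> - Z (p + n) \<omega>))\<^sup>2)) \<longlonglongrightarrow> ennreal ((norm (Z n \<omega> - Y \<omega>))\<^sup>2)"
      using lim
    proof eventually_elim
      case (elim \<omega>)
      show ?case
        by (intro tendsto_ennrealI tendsto_intros LIMSEQ_ignore_initial_segment[OF elim])
    qed
    fix p
    \<comment> \<open>The full geometric tail of the squared weights. It enters twice, from the
      weight factor of Cauchy-Schwarz and from the sum of the weighted second moments; hence the
      square in the final denominator.\<close>
    let ?c = "(t\<^sup>2) ^ n / (1 - t\<^sup>2)"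
    have geo: "(\<Sum>i<p. (t\<^sup>2) ^ (n + i)) \<le> ?c"
    proof -
      have "(\<Sum>i<p. (t\<^sup>2) ^ (n + i)) = (t\<^sup>2) ^ n * (\<Sum>i<p. (t\<^sup>2) ^ i)"
        by (simp add: power_add sum_distrib_left)
      also have "(\<Sum>i<p. (t\<^sup>2) ^ i) \<le> 1 / (1 - t\<^sup>2)"
        using t2 by (simp add: sum_gp_strict divide_right_mono)
      finally show ?thesis using t2 by (simp add: mult_left_mono)
    qed
    have "(norm (Z n \<omega> - Z (p + n) \<omega>))\<^sup>2 \<le> ?c * (\<Sum>i<p. (\<Delta> (n + i) \<omega> / t ^ (n + i))\<^sup>2)" for \<omega>
    proof -
      have "norm (Z n \<omega> - Z (p + n) \<omega>) = norm (\<Sum>i<p. Z (n + Suc i) \<omega> - Z (n + i) \<omega>)"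
        using sum_lessThan_telescope[of "\<lambda>i. Z (n + i) \<omega>" p] by (simp add: norm_minus_commute add.commute)
      also have "\<dots> \<le> (\<Sum>i<p. t ^ (n + i) * (\<Delta> (n + i) \<omega> / t ^ (n + i)))"
        using t by (intro sum_norm_le) (simp add: \<Delta>_def)
      finally have "(norm (Z n \<omega> - Z (p + n) \<omega>))\<^sup>2 \<le> (\<Sum>i<p. t ^ (n + i) * (\<Delta> (n + i) \<omega> / t ^ (n + i)))\<^sup>2"
        by (rule power_mono) simp
      also have "\<dots> \<le> (\<Sum>i<p. (t ^ (n + i))\<^sup>2) * (\<Sum>i<p. (\<Delta> (n + i) \<omega> / t ^ (n + i))\<^sup>2)"
        by (rule Cauchy_Schwarz_ineq_sum)
      also have "(\<Sum>i<p. (t ^ (n + i))\<^sup>2) = (\<Sum>i<p. (t\<^sup>2) ^ (n + i))"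
        by (simp add: power_mult[symmetric] mult.commute)
      also have "\<dots> * (\<Sum>i<p. (\<Delta> (n + i) \<omega> / t ^ (n + i))\<^sup>2) \<le> ?c * (\<Sum>i<p. (\<Delta> (n + i) \<omega> / t ^ (n + i))\<^sup>2)"
        by (intro mult_right_mono geo sum_nonneg) simp
      finally show ?thesis .
    qed
    then have "(\<integral>\<^sup>+\<omega>. ennreal ((norm (Z n \<omega> - Z (p + n) \<omega>))\<^sup>2) \<partial>M)
      \<le> (\<integral>\<^sup>+\<omega>. ennreal ?c * (\<Sum>i<p. ennreal ((\<Delta> (n + i) \<omega> / t ^ (n + i))\<^sup>2)) \<partial>M)"
      using t2 by (intro nn_integral_mono) (simp add: sum_ennreal ennreal_mult'[symmetric] ennreal_leI)
    also have "\<dots> = ennreal ?c * (\<Sum>i<p. \<integral>\<^sup>+\<omega>. ennreal ((\<Delta> (n + i) \<omega> / t ^ (n + i))\<^sup>2) \<partial>M)"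
      by (subst nn_integral_cmult, measurable, subst nn_integral_sum) auto
    also have "\<dots> \<le> ennreal ?c * (\<Sum>i<p. ennreal (D * (t\<^sup>2) ^ (n + i)))"
      by (intro mult_left_mono sum_mono weighted) simp
    also have "\<dots> = ennreal (?c * (D * (\<Sum>i<p. (t\<^sup>2) ^ (n + i))))"
      using t2 D by (simp add: sum_ennreal ennreal_mult'[symmetric] sum_distrib_left)
    also have "\<dots> \<le> ennreal (?c * (D * ?c))"
      using geo t2 D by (intro ennreal_leI mult_left_mono) auto
    also have "?c * (D * ?c) = D * t ^ (4 * n) / (1 - t\<^sup>2)\<^sup>2"
      by (simp add: t4 power2_eq_square)
    finally show "(\<integral>\<^sup>+\<omega>. ennreal ((norm (Z n \<omega> - Z (p + n) \<omega>))\<^sup>2) \<partial>M) \<le> ennreal (D * t ^ (4 * n) / (1 - t\<^sup>2)\<^sup>2)" .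
  qed measurable
qed

section \<open>Sums, multiples and series in the L^1 seminorm\<close>

lemma nn_integral_norm_add_le:
  fixes f g :: "'a \<Rightarrow> 'b::{banach, second_countable_topology}"
  assumes [measurable]: "f \<in> borel_measurable M" "g \<in> borel_measurable M"
    and "(\<integral>\<^sup>+x. ennreal (norm (f x)) \<partial>M) \<le> ennreal a" "(\<integral>\<^sup>+x. ennreal (norm (g x)) \<partial>M) \<le> ennreal b"
    and "0 \<le> a" "0 \<le> b"
  shows "(\<integral>\<^sup>+x. ennreal (norm (f x + g x)) \<partial>M) \<le> ennreal (a + b)"
proof -
  have "(\<integral>\<^sup>+x. ennreal (norm (f x + g x)) \<partial>M) \<le> (\<integral>\<^sup>+x. ennreal (norm (f x)) + ennreal (norm (g x)) \<partial>M)"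
    by (intro nn_integral_mono) (simp add: norm_triangle_ineq ennreal_leI flip: ennreal_plus)
  also have "\<dots> = (\<integral>\<^sup>+x. ennreal (norm (f x)) \<partial>M) + (\<integral>\<^sup>+x. ennreal (norm (g x)) \<partial>M)"
    by (intro nn_integral_add) measurable
  also have "\<dots> \<le> ennreal (a + b)" using assms by (simp add: add_mono)
  finally show ?thesis .
qed

lemma nn_integral_norm_scale_le:
  fixes f :: "'a \<Rightarrow> 'b::{real_normed_div_algebra, banach, second_countable_topology}"
  assumes [measurable]: "f \<in> borel_measurable M"
    and "(\<integral>\<^sup>+x. ennreal (norm (f x)) \<partial>M) \<le> ennreal a"
  shows "(\<integral>\<^sup>+x. ennreal (norm (c * f x)) \<partial>M) \<le> ennreal (norm c * a)"
proof -
  have "(\<integral>\<^sup>+x. ennreal (norm (c * f x)) \<partial>M) = (\<integral>\<^sup>+x. ennreal (norm c) * ennreal (norm (f x)) \<partial>M)"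
    by (intro nn_integral_cong) (simp add: norm_mult ennreal_mult')
  also have "\<dots> = ennreal (norm c) * (\<integral>\<^sup>+x. ennreal (norm (f x)) \<partial>M)"
    by (intro nn_integral_cmult) measurable
  also have "\<dots> \<le> ennreal (norm c) * ennreal a" by (intro mult_left_mono assms zero_le)
  finally show ?thesis by (simp add: ennreal_mult')
qed

lemma nn_integral_norm_sum_le:
  fixes f :: "'i \<Rightarrow> 'a \<Rightarrow> 'b::{banach, second_countable_topology}"
  assumes "finite I" "\<And>i. i \<in> I \<Longrightarrow> f i \<in> borel_measurable M"
    and "\<And>i. i \<in> I \<Longrightarrow> (\<integral>\<^sup>+x. ennreal (norm (f i x)) \<partial>M) \<le> ennreal (a i)" "\<And>i. i \<in> I \<Longrightarrow> 0 \<le> a i"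
  shows "(\<integral>\<^sup>+x. ennreal (norm (\<Sum>i\<in>I. f i x)) \<partial>M) \<le> ennreal (\<Sum>i\<in>I. a i)"
  using assms
proof (induction I rule: finite_induct)
  case (insert i I)
  have "(\<integral>\<^sup>+x. ennreal (norm (f i x + (\<Sum>i\<in>I. f i x))) \<partial>M) \<le> ennreal (a i + (\<Sum>i\<in>I. a i))"
    using insert.prems by (intro nn_integral_norm_add_le insert.IH borel_measurable_sum sum_nonneg) auto
  then show ?case using insert.hyps by simp
qed simp

text \<open>By Tonelli the sum of the norms has finite mean, so it is finite almost everywhere.
  Absolute convergence is needed for the second claim because \<open>suminf\<close> has no meaning
  at points of divergence.\<close>

lemma
  fixes f :: "nat \<Rightarrow> 'a \<Rightarrow> 'b::{banach, second_countable_topology}"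
  assumes [measurable]: "\<And>i. f i \<in> borel_measurable M"
    and le: "\<And>i. (\<integral>\<^sup>+x. ennreal (norm (f i x)) \<partial>M) \<le> ennreal (a i)" and nonneg: "\<And>i. 0 \<le> a i"
    and a: "summable a"
  shows AE_summable_norm: "AE x in M. summable (\<lambda>i. norm (f i x))"
    and nn_integral_norm_suminf_le: "(\<integral>\<^sup>+x. ennreal (norm (\<Sum>i. f i x)) \<partial>M) \<le> ennreal (\<Sum>i. a i)"
proof -
  have "(\<integral>\<^sup>+x. (\<Sum>i. ennreal (norm (f i x))) \<partial>M) = (\<Sum>i. \<integral>\<^sup>+x. ennreal (norm (f i x)) \<partial>M)"
    by (rule nn_integral_suminf) measurable
  also have "\<dots> \<le> (\<Sum>i. ennreal (a i))" by (intro suminf_le le) auto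
  also have "\<dots> = ennreal (\<Sum>i. a i)" by (intro suminf_ennreal2 nonneg a)
  finally have total: "(\<integral>\<^sup>+x. (\<Sum>i. ennreal (norm (f i x))) \<partial>M) \<le> ennreal (\<Sum>i. a i)" .
  then have "(\<integral>\<^sup>+x. (\<Sum>i. ennreal (norm (f i x))) \<partial>M) \<noteq> \<infinity>"
    by (auto simp: top_unique)
  then have "AE x in M. (\<Sum>i. ennreal (norm (f i x))) \<noteq> \<infinity>"
    by (intro nn_integral_noteq_infinite) measurable
  then show *: "AE x in M. summable (\<lambda>i. norm (f i x))"
    by eventually_elim (auto intro: summable_suminf_not_top)
  have "(\<integral>\<^sup>+x. ennreal (norm (\<Sum>i. f i x)) \<partial>M) \<le> (\<integral>\<^sup>+x. (\<Sum>i. ennreal (norm (f i x))) \<partial>M)"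
  proof (rule nn_integral_mono_AE)
    show "AE x in M. ennreal (norm (\<Sum>i. f i x)) \<le> (\<Sum>i. ennreal (norm (f i x)))"
      using *
    proof eventually_elim
      case (elim x)
      then show ?case by (subst suminf_ennreal2) (auto intro!: ennreal_leI summable_norm)
    qed
  qed
  with total show "(\<integral>\<^sup>+x. ennreal (norm (\<Sum>i. f i x)) \<partial>M) \<le> ennreal (\<Sum>i. a i)"
    by (rule order_trans[rotated])
qed

text \<open>Markov's inequality.\<close>

lemma tends_to_zero_in_probabilityI:
  assumes "prob_space M" and meas: "\<And>n. Z n \<in> borel_measurable M"
    and le: "\<And>n. (\<integral>\<^sup>+\<omega>. ennreal (cmod (Z n \<omega>)) \<partial>M) \<le> ennreal (w n)"
    and nonneg: "\<And>n. 0 \<le> w n" and lim: "w \<longlonglongrightarrow> 0"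
  shows "tends_to_zero_in_probability M Z"
  unfolding tends_to_zero_in_probability_def
proof (intro conjI allI impI meas)
  interpret prob_space M by fact
  note meas [measurable]
  fix \<epsilon> :: real assume \<epsilon>: "0 < \<epsilon>"
  have bound: "measure M {\<omega> \<in> space M. cmod (Z n \<omega>) > \<epsilon>} \<le> w n / \<epsilon>" for n
  proof -
    have "emeasure M {\<omega> \<in> space M. cmod (Z n \<omega>) > \<epsilon>}
        \<le> emeasure M ({\<omega> \<in> space M. 1 \<le> ennreal (1 / \<epsilon>) * ennreal (cmod (Z n \<omega>))})"
      using \<epsilon> by (intro emeasure_mono subsetI)
        (auto simp: ennreal_mult'[symmetric] ennreal_1[symmetric] field_simps simp del: ennreal_1 intro!: ennreal_leI)
    also have "\<dots> \<le> ennreal (1 / \<epsilon>) * (\<integral>\<^sup>+\<omega>. ennreal (cmod (Z n \<omega>)) * indicator (space M) \<omega> \<partial>M)"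
      by (rule nn_integral_Markov_inequality) auto
    also have "(\<integral>\<^sup>+\<omega>. ennreal (cmod (Z n \<omega>)) * indicator (space M) \<omega> \<partial>M) = (\<integral>\<^sup>+\<omega>. ennreal (cmod (Z n \<omega>)) \<partial>M)"
      by (intro nn_integral_cong) simp
    also have "ennreal (1 / \<epsilon>) * \<dots> \<le> ennreal (1 / \<epsilon>) * ennreal (w n)"
      by (intro mult_left_mono le) simp
    also have "\<dots> = ennreal (w n / \<epsilon>)"
      using \<epsilon> by (simp add: ennreal_mult'[symmetric])
    finally show ?thesis
      using \<epsilon> nonneg by (simp add: emeasure_eq_measure)
  qed
  show "(\<lambda>n. measure M {\<omega> \<in> space M. cmod (Z n \<omega>) > \<epsilon>}) \<longlonglongrightarrow> 0"
  proof (rule tendsto_sandwich[where f = "\<lambda>_. 0" and h = "\<lambda>n. w n / \<epsilon>"])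
    show "(\<lambda>n. w n / \<epsilon>) \<longlonglongrightarrow> 0" using tendsto_divide[OF lim tendsto_const[of \<epsilon>]] \<epsilon> by simp
  qed (auto simp: bound)
qed

section \<open>Kernels and bifurcating Markov chains\<close>

lemma sum_gen_Suc:
  fixes \<phi> :: "bool list \<Rightarrow> 'b::comm_monoid_add"
  shows "(\<Sum>u\<in>gen (Suc m). \<phi> u) = (\<Sum>u\<in>gen m. \<phi> (u @ [False]) + \<phi> (u @ [True]))"
proof -
  have fin: "finite (gen m)"
    using finite_lists_length_eq[of "UNIV::bool set" m] by (simp add: gen_def)
  have "gen (Suc m) = (\<lambda>u. u @ [False]) ` gen m \<union> (\<lambda>u. u @ [True]) ` gen m"
  proof (intro equalityI subsetI)
    fix v :: "bool list" assume "v \<in> gen (Suc m)"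
    then have "v = butlast v @ [last v]" "butlast v \<in> gen m"
      by (auto simp: gen_def intro!: append_butlast_last_id[symmetric])
    then have "v \<in> (\<lambda>u. u @ [last v]) ` gen m" by (rule image_eqI)
    then show "v \<in> (\<lambda>u. u @ [False]) ` gen m \<union> (\<lambda>u. u @ [True]) ` gen m"
      by (cases "last v") simp_all
  qed (auto simp: gen_def)
  then have "(\<Sum>u\<in>gen (Suc m). \<phi> u)
      = (\<Sum>u\<in>(\<lambda>u. u @ [False]) ` gen m. \<phi> u) + (\<Sum>u\<in>(\<lambda>u. u @ [True]) ` gen m. \<phi> u)"
    using fin by (simp only:) (intro sum.union_disjoint, auto)
  then show ?thesis by (simp add: sum.reindex inj_on_def sum.distrib)
qed

lemma space_induced_kernel [simp]: "space (induced_kernel S P x) = space S"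
  by (simp add: induced_kernel_def space_measure_of sets.space_closed)

lemma sets_induced_kernel [simp, measurable_cong]: "sets (induced_kernel S P x) = sets S"
  by (simp add: induced_kernel_def sets.space_closed)

text \<open>The measure \<open>Q x\<close> lives on \<open>space S\<close> for every
  \<open>x\<close>, even one outside \<open>space S\<close>, so the results agree everywhere. This
  lets an identity known only on \<open>space S\<close> be used under a further application of
  \<open>kernel_op\<close>.\<close>

lemma kernel_op_induced_cong:
  assumes "eq_on_space S f g"
  shows "kernel_op (induced_kernel S P) f = kernel_op (induced_kernel S P) g"
  using assms unfolding kernel_op_def eq_on_space_def
  by (intro ext Bochner_Integration.integral_cong) auto

locale pair_kernel =
  fixes S :: "'s measure" and P :: "'s \<Rightarrow> ('s \<times> 's) measure"
  assumes measurable_P [measurable]: "P \<in> S \<rightarrow>\<^sub>M prob_algebra (S \<Otimes>\<^sub>M S)"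
begin

abbreviation Q where "Q \<equiv> induced_kernel S P"
abbreviation T where "T \<equiv> S \<Otimes>\<^sub>M S \<Otimes>\<^sub>M S"

lemma measurable_P_subprob [measurable]: "P \<in> S \<rightarrow>\<^sub>M subprob_algebra (S \<Otimes>\<^sub>M S)"
  by (rule measurable_prob_algebraD[OF measurable_P])

lemma sets_P: "x \<in> space S \<Longrightarrow> sets (P x) = sets (S \<Otimes>\<^sub>M S)"
  and prob_space_P: "x \<in> space S \<Longrightarrow> prob_space (P x)"
  using measurable_space[OF measurable_P, of x] by (simp_all add: space_prob_algebra)

lemma space_P: "x \<in> space S \<Longrightarrow> space (P x) = space S \<times> space S"
  using sets_eq_imp_space_eq[OF sets_P] by (simp add: space_pair_measure)

lemma measurable_child_choice:
  assumes N: "sets N = sets (S \<Otimes>\<^sub>M S)"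
  shows "(\<lambda>(b, p). if b then fst p else snd p) \<in> measure_pmf q \<Otimes>\<^sub>M N \<rightarrow>\<^sub>M S"
proof -
  note N [measurable_cong]
  have [measurable]: "fst \<in> measure_pmf q \<Otimes>\<^sub>M N \<rightarrow>\<^sub>M count_space UNIV"
    using measurable_fst[of "measure_pmf q" N]
    by (simp add: measurable_cong_sets[OF refl sets_measure_pmf_count_space])
  have [measurable]: "fst \<in> N \<rightarrow>\<^sub>M S" "snd \<in> N \<rightarrow>\<^sub>M S"
    by (simp_all add: measurable_cong_sets[OF N refl])
  have "(\<lambda>bp. fst (snd bp)) \<in> measure_pmf q \<Otimes>\<^sub>M N \<rightarrow>\<^sub>M S" "(\<lambda>bp. snd (snd bp)) \<in> measure_pmf q \<Otimes>\<^sub>M N \<rightarrow>\<^sub>M S"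
    by (rule measurable_compose[OF measurable_snd], measurable)+
  then show ?thesis
    unfolding case_prod_beta by (intro measurable_If) measurable
qed

text \<open>A draw from \<open>Q x\<close> is a fair coin toss choosing one of the two children drawn from \<open>P x\<close>.\<close>

lemma induced_kernel_eq_distr:
  assumes x: "x \<in> space S"
  shows "Q x = distr (measure_pmf (pmf_of_set (UNIV::bool set)) \<Otimes>\<^sub>M P x) S
    (\<lambda>(b, p). if b then fst p else snd p)" (is "_ = ?D")
proof -
  interpret Px: prob_space "P x" by (rule prob_space_P[OF x])
  note sets_P[OF x, measurable_cong]
  have meas [measurable]: "(\<lambda>(b, p). if b then fst p else snd p)
      \<in> measure_pmf (pmf_of_set (UNIV::bool set)) \<Otimes>\<^sub>M P x \<rightarrow>\<^sub>M S"
    by (rule measurable_child_choice[OF sets_P[OF x]])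
  have em: "emeasure ?D A = (emeasure (P x) (A \<times> space S) + emeasure (P x) (space S \<times> A)) / 2"
    if A: "A \<in> sets S" for A
  proof -
    have sub: "A \<subseteq> space S" using sets.sets_into_space[OF A] .
    let ?V = "(\<lambda>(b, p). if b then fst p else snd p) -` A
      \<inter> space (measure_pmf (pmf_of_set (UNIV::bool set)) \<Otimes>\<^sub>M P x)"
    have "emeasure ?D A = emeasure (measure_pmf (pmf_of_set UNIV) \<Otimes>\<^sub>M P x) ?V"
      by (intro emeasure_distr meas A)
    also have "\<dots> = (\<integral>\<^sup>+b. emeasure (P x) (Pair b -` ?V) \<partial>measure_pmf (pmf_of_set UNIV))"
      by (intro Px.emeasure_pair_measure_alt measurable_sets[OF meas A])
    also have "\<dots> = (emeasure (P x) (Pair True -` ?V) + emeasure (P x) (Pair False -` ?V)) / 2"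
      by (subst nn_integral_pmf_of_set) (auto simp: UNIV_bool add.commute)
    also have "Pair True -` ?V = A \<times> space S"
      using sub by (auto simp: space_pair_measure space_P[OF x])
    also have "Pair False -` ?V = space S \<times> A"
      using sub by (auto simp: space_pair_measure space_P[OF x])
    finally show ?thesis .
  qed
  \<comment> \<open>\<open>measure_of\<close> would return the zero measure if its set function were
    not countably additive; that property is inherited here from the push-forward measure.\<close>
  have "Q x = measure_of (space S) (sets S) (emeasure ?D)"
    unfolding induced_kernel_def
    by (rule measure_of_eq) (auto simp: sets.space_closed sets.sigma_sets_eq em)
  also have "\<dots> = ?D" using measure_of_of_measure[of ?D] by simp
  finally show ?thesis .
qed

lemma prob_space_Q: "x \<in> space S \<Longrightarrow> prob_space (Q x)"
proof -
  assume x: "x \<in> space S"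
  interpret Px: prob_space "P x" by (rule prob_space_P[OF x])
  interpret pair_prob_space "measure_pmf (pmf_of_set (UNIV::bool set))" "P x" ..
  note sets_P[OF x, measurable_cong]
  show ?thesis unfolding induced_kernel_eq_distr[OF x]
    by (intro P.prob_space_distr measurable_child_choice sets_P x)
qed

lemma
  fixes \<phi> :: "'s \<Rightarrow> 'b::{banach, second_countable_topology}"
  assumes x: "x \<in> space S"
    and fst: "integrable (P x) (\<lambda>(y, z). \<phi> y)" and snd: "integrable (P x) (\<lambda>(y, z). \<phi> z)"
    and meas [measurable]: "\<phi> \<in> borel_measurable S"
  shows integrable_induced_kernel: "integrable (Q x) \<phi>"
    and integral_induced_kernel: "kernel_op Q \<phi> x =
      (1 / 2) *\<^sub>R ((\<integral>(y, z). \<phi> y \<partial>P x) + (\<integral>(y, z). \<phi> z \<partial>P x))"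
proof -
  interpret Px: prob_space "P x" by (rule prob_space_P[OF x])
  interpret pair_prob_space "measure_pmf (pmf_of_set (UNIV::bool set))" "P x" ..
  note sets_P[OF x, measurable_cong]
  let ?B = "measure_pmf (pmf_of_set (UNIV::bool set))"
  let ?h = "\<lambda>(b, p). if b then fst p else snd p"
  have h [measurable]: "?h \<in> ?B \<Otimes>\<^sub>M P x \<rightarrow>\<^sub>M S"
    by (rule measurable_child_choice[OF sets_P[OF x]])
  have int: "integrable (P x) (\<lambda>p. \<phi> (?h (b, p)))" for b
    using fst snd by (cases b) (simp_all add: case_prod_beta')
  have int2: "integrable (?B \<Otimes>\<^sub>M P x) (\<lambda>bp. \<phi> (?h bp))"
    by (rule Fubini_integrable)
      (use int in \<open>auto intro!: integrable_measure_pmf_finite\<close>)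
  then show "integrable (Q x) \<phi>"
    unfolding induced_kernel_eq_distr[OF x] by (subst integrable_distr_eq) (auto simp: case_prod_beta)
  have "kernel_op Q \<phi> x = (\<integral>bp. \<phi> (?h bp) \<partial>(?B \<Otimes>\<^sub>M P x))"
    unfolding kernel_op_def induced_kernel_eq_distr[OF x] by (subst integral_distr) auto
  also have "\<dots> = (\<integral>b. (\<integral>p. \<phi> (?h (b, p)) \<partial>P x) \<partial>?B)"
    by (rule integral_fst'[OF int2, symmetric])
  also have "\<dots> = (1 / 2) *\<^sub>R ((\<integral>(y, z). \<phi> y \<partial>P x) + (\<integral>(y, z). \<phi> z \<partial>P x))"
    by (subst integral_measure_pmf[of UNIV]) (auto simp: UNIV_bool case_prod_beta' scaleR_add_right add.commute)
  finally show "kernel_op Q \<phi> x = (1 / 2) *\<^sub>R ((\<integral>(y, z). \<phi> y \<partial>P x) + (\<integral>(y, z). \<phi> z \<partial>P x))" .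
qed

lemma measurable_triple_op [measurable]:
  "f \<in> borel_measurable T \<Longrightarrow> triple_op P f \<in> borel_measurable S"
proof -
  assume f [measurable]: "f \<in> borel_measurable T"
  note measurable_distr2 [measurable]
  \<comment> \<open>The point \<open>x\<close> occurs both in the kernel and in the integrand.
    Pushing \<open>P x\<close> forward to triples moves it entirely into the kernel, where
    measurability of integrals against a kernel applies.\<close>
  have "(\<lambda>x. integral\<^sup>L (distr (P x) T (\<lambda>p. (x, p))) f) \<in> borel_measurable S"
    by measurable
  then show ?thesis
    by (rule measurable_cong[THEN iffD1, rotated])
      (use sets_P in \<open>simp add: integral_distr triple_op_def case_prod_beta'\<close>)
qed

lemma measurable_section [measurable (raw)]:
  assumes "x \<in> space S" "f \<in> borel_measurable T"
  shows "(\<lambda>(y, z). f (x, y, z)) \<in> borel_measurable (P x)"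
  unfolding measurable_cong_sets[OF sets_P[OF assms(1)] refl] case_prod_eta
  using assms by measurable

end

locale bmc = prob_space M + pair_kernel S P
  for M :: "'w measure" and S :: "'s measure" and P +
  fixes \<nu> :: "'s measure" and X :: "bool list \<Rightarrow> 'w \<Rightarrow> 's"
  assumes bmc: "bifurcating_markov_chain M S \<nu> P X"
begin

lemma measurable_X [measurable]: "X u \<in> M \<rightarrow>\<^sub>M S"
  and distr_root: "distr M S (X []) = \<nu>"
  using bmc by (simp_all add: bifurcating_markov_chain_def)

lemma measurable_triangle [measurable]: "triangle X u \<in> M \<rightarrow>\<^sub>M T"
  unfolding triangle_def[abs_def] by measurable

lemma X_space: "\<omega> \<in> space M \<Longrightarrow> X u \<omega> \<in> space S"
  using measurable_space[OF measurable_X] .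

lemma finite_gen [simp]: "finite (gen n)" and card_gen: "card (gen n) = 2 ^ n"
  using finite_lists_length_eq[of "UNIV::bool set" n] card_lists_length_eq[of "UNIV::bool set" n]
  by (simp_all add: gen_def card_UNIV_bool)

lemma triple_op_bound:
  assumes f [measurable]: "f \<in> borel_measurable T" and C: "\<And>t. t \<in> space T \<Longrightarrow> \<bar>f t\<bar> \<le> C" and x: "x \<in> space S"
  shows "\<bar>triple_op P f x\<bar> \<le> C" and "integrable (P x) (\<lambda>(y, z). f (x, y, z))"
proof -
  interpret Px: prob_space "P x" by (rule prob_space_P[OF x])
  have le: "AE p in P x. norm (case p of (y, z) \<Rightarrow> f (x, y, z)) \<le> C"
    using C x by (intro AE_I2) (auto simp: space_P[OF x] space_pair_measure)
  show int: "integrable (P x) (\<lambda>(y, z). f (x, y, z))"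
    by (rule Px.integrable_const_bound[OF le]) (use x in measurable)
  have "(\<integral>p. norm (case p of (y, z) \<Rightarrow> f (x, y, z)) \<partial>P x) \<le> C"
    by (rule Px.integral_le_const[OF integrable_norm[OF int] le])
  then show "\<bar>triple_op P f x\<bar> \<le> C"
    using integral_norm_bound[of "P x" "\<lambda>(y, z). f (x, y, z)"] by (simp add: triple_op_def)
qed

text \<open>Expectation of the Markov property. From here on only this integrated form is used, so
  conditional expectations do not reappear.\<close>

lemma expectation_prod_generation:
  assumes g: "\<And>u. g u \<in> bounded_measurable T"
  shows "expectation (\<lambda>\<omega>. \<Prod>u\<in>gen k. g u (triangle X u \<omega>))
    = expectation (\<lambda>\<omega>. \<Prod>u\<in>gen k. triple_op P (g u) (X u \<omega>))"
proof -
  have [measurable]: "g u \<in> borel_measurable T" for u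
    using g by (auto simp: bounded_measurable_def)
  have "\<exists>C. \<forall>u. \<forall>t\<in>space T. \<bar>g u t\<bar> \<le> C u"
    using g unfolding bounded_measurable_def mem_Collect_eq by metis
  then obtain C where C: "\<And>u t. t \<in> space T \<Longrightarrow> \<bar>g u t\<bar> \<le> C u" by blast
  let ?A = "{X u -` A \<inter> space M | u A. u \<in> tree_upto k \<and> A \<in> sets S}"
  let ?G = "generated_sigma M S X (tree_upto k)"
  have "subalgebra M ?G"
  proof -
    have "?A \<subseteq> sets M" by (auto intro: measurable_sets[OF measurable_X])
    then have "sigma_sets (space M) ?A \<subseteq> sets M" by (rule sets.sigma_sets_subset)
    moreover have "?A \<subseteq> Pow (space M)" by auto
    ultimately show ?thesis
      by (simp add: subalgebra_def generated_sigma_def space_measure_of sets_measure_of)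
  qed
  then interpret finite_measure_subalgebra M ?G by unfold_locales
  have int: "integrable M (\<lambda>\<omega>. \<Prod>u\<in>gen k. g u (triangle X u \<omega>))"
    by (rule integrable_const_bound[where B = "\<Prod>u\<in>gen k. C u"])
      (auto simp: abs_prod intro!: prod_mono C measurable_space[OF measurable_triangle])
  have "expectation (\<lambda>\<omega>. \<Prod>u\<in>gen k. g u (triangle X u \<omega>))
      = expectation (real_cond_exp M ?G (\<lambda>\<omega>. \<Prod>u\<in>gen k. g u (triangle X u \<omega>)))"
    by (rule real_cond_exp_int(2)[OF int, symmetric])
  also have "\<dots> = expectation (\<lambda>\<omega>. \<Prod>u\<in>gen k. triple_op P (g u) (X u \<omega>))"
    using bmc g by (intro integral_cong_AE)
      (auto simp: bifurcating_markov_chain_def borel_measurable_cond_exp2)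
  finally show ?thesis .
qed

lemma triple_op_one: "x \<in> space S \<Longrightarrow> triple_op P (\<lambda>_. 1) x = 1"
  using prob_space.prob_space[OF prob_space_P] by (simp add: triple_op_def case_prod_beta')

text \<open>The other vertices of the generation receive the constant 1, which
  \<open>triple_op P\<close> fixes.\<close>

lemma expectation_triangle:
  assumes g: "g \<in> bounded_measurable T"
  shows "expectation (\<lambda>\<omega>. g (triangle X u \<omega>)) = expectation (\<lambda>\<omega>. triple_op P g (X u \<omega>))"
proof -
  let ?g = "\<lambda>v. if v = u then g else (\<lambda>_. 1)"
  have u: "u \<in> gen (length u)" by (simp add: gen_def)
  have "(\<lambda>_. 1) \<in> bounded_measurable T" by (auto simp: bounded_measurable_def)
  then have "expectation (\<lambda>\<omega>. \<Prod>v\<in>gen (length u). ?g v (triangle X v \<omega>))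
    = expectation (\<lambda>\<omega>. \<Prod>v\<in>gen (length u). triple_op P (?g v) (X v \<omega>))"
    using g by (intro expectation_prod_generation) auto
  moreover have "(\<Prod>v\<in>gen (length u). ?g v (triangle X v \<omega>)) = g (triangle X u \<omega>)" for \<omega>
    using u by (subst prod.remove[OF _ u]) auto
  moreover have "(\<Prod>v\<in>gen (length u). triple_op P (?g v) (X v \<omega>)) = triple_op P g (X u \<omega>)"
    if "\<omega> \<in> space M" for \<omega>
    using u that by (subst prod.remove[OF _ u]) (auto simp: triple_op_one X_space)
  ultimately show ?thesis by (simp cong: Bochner_Integration.integral_cong)
qed

text \<open>Two vertices carry \<open>g\<close> and \<open>h\<close>, all others the constant 1. The
  factorisation expresses conditional independence within a generation, the source of the
  orthogonality.\<close>

lemma expectation_triangle_pair: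
  assumes g: "g \<in> bounded_measurable T" "h \<in> bounded_measurable T"
    and uv: "u \<noteq> v" "length v = length u"
  shows "expectation (\<lambda>\<omega>. g (triangle X u \<omega>) * h (triangle X v \<omega>))
    = expectation (\<lambda>\<omega>. triple_op P g (X u \<omega>) * triple_op P h (X v \<omega>))"
proof -
  let ?g = "\<lambda>w. if w = u then g else if w = v then h else (\<lambda>_. 1)"
  have u: "u \<in> gen (length u)" by (simp add: gen_def)
  have v: "v \<in> gen (length u) - {u}" using uv by (simp add: gen_def)
  have "(\<lambda>_. 1) \<in> bounded_measurable T" by (auto simp: bounded_measurable_def)
  then have "expectation (\<lambda>\<omega>. \<Prod>w\<in>gen (length u). ?g w (triangle X w \<omega>))
    = expectation (\<lambda>\<omega>. \<Prod>w\<in>gen (length u). triple_op P (?g w) (X w \<omega>))"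
    using g by (intro expectation_prod_generation) auto
  moreover have "(\<Prod>w\<in>gen (length u). ?g w (triangle X w \<omega>)) = g (triangle X u \<omega>) * h (triangle X v \<omega>)" for \<omega>
    using uv by (subst prod.remove[OF _ u], simp, subst prod.remove[OF _ v]) auto
  moreover have "(\<Prod>w\<in>gen (length u). triple_op P (?g w) (X w \<omega>)) = triple_op P g (X u \<omega>) * triple_op P h (X v \<omega>)"
    if "\<omega> \<in> space M" for \<omega>
    using uv that by (subst prod.remove[OF _ u], simp, subst prod.remove[OF _ v]) (auto simp: triple_op_one X_space)
  ultimately show ?thesis by (simp cong: Bochner_Integration.integral_cong)
qed

end

section \<open>Second moments of compensated sums over a generation\<close>

context bmc
begin

lemma integrable_bounded:
  fixes Y :: "'w \<Rightarrow> real"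
  assumes "Y \<in> borel_measurable M" "\<And>\<omega>. \<omega> \<in> space M \<Longrightarrow> \<bar>Y \<omega>\<bar> \<le> C"
  shows "integrable M Y"
  using assms by (intro integrable_const_bound[where B = C]) auto

lemma triangle_space: "\<omega> \<in> space M \<Longrightarrow> triangle X u \<omega> \<in> space T"
  by (rule measurable_space[OF measurable_triangle])

lemma triple_op_clip_tendsto:
  assumes f [measurable]: "f \<in> borel_measurable T"
    and int: "integrable (P x) (\<lambda>(y, z). f (x, y, z))" and x: "x \<in> space S"
  shows "(\<lambda>n. triple_op P (\<lambda>t. clip n (f t)) x) \<longlonglongrightarrow> triple_op P f x"
  unfolding triple_op_def
proof (rule integral_dominated_convergence[where w = "\<lambda>p. \<bar>case p of (y, z) \<Rightarrow> f (x, y, z)\<bar>"])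
  show "(\<lambda>(y, z). f (x, y, z)) \<in> borel_measurable (P x)"
    using int by (rule borel_measurable_integrable)
  show "(\<lambda>(y, z). clip n (f (x, y, z))) \<in> borel_measurable (P x)" for n
    using measurable_section[OF x, of "\<lambda>t. clip n (f t)"] by simp
  show "integrable (P x) (\<lambda>p. \<bar>case p of (y, z) \<Rightarrow> f (x, y, z)\<bar>)"
    using int by (rule integrable_abs)
qed (auto intro: clip_tendsto abs_clip_le)

lemma triple_op_mono:
  assumes "\<And>y z. y \<in> space S \<Longrightarrow> z \<in> space S \<Longrightarrow> f (x, y, z) \<le> g (x, y, z)"
    and "integrable (P x) (\<lambda>(y, z). f (x, y, z))" "integrable (P x) (\<lambda>(y, z). g (x, y, z))"
    and x: "x \<in> space S"
  shows "triple_op P f x \<le> triple_op P g x"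
  unfolding triple_op_def using assms by (intro integral_mono) (auto simp: space_P[OF x])

text \<open>For each truncation the Markov property gives equality, and the truncations of a
  non-negative function lie below it; Fatou on the left side then gives an inequality, in which the
  right side may be infinite.\<close>

lemma nn_integral_triangle_le:
  assumes f [measurable]: "f \<in> borel_measurable T" and nonneg: "\<And>t. t \<in> space T \<Longrightarrow> 0 \<le> f t"
    and int: "\<And>x. x \<in> space S \<Longrightarrow> integrable (P x) (\<lambda>(y, z). f (x, y, z))"
  shows "(\<integral>\<^sup>+\<omega>. ennreal (f (triangle X u \<omega>)) \<partial>M) \<le> (\<integral>\<^sup>+\<omega>. ennreal (triple_op P f (X u \<omega>)) \<partial>M)"
proof (rule nn_integral_le_of_AE_tendsto[where f = "\<lambda>n \<omega>. ennreal (clip n (f (triangle X u \<omega>)))"])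
  show "AE \<omega> in M. (\<lambda>n. ennreal (clip n (f (triangle X u \<omega>)))) \<longlonglongrightarrow> ennreal (f (triangle X u \<omega>))"
    by (intro AE_I2 tendsto_ennrealI clip_tendsto)
  fix n
  let ?f = "\<lambda>t. clip n (f t)"
  have b: "\<bar>triple_op P ?f x\<bar> \<le> real n" "integrable (P x) (\<lambda>(y, z). ?f (x, y, z))" if "x \<in> space S" for x
    using triple_op_bound[of ?f "real n" x] that by (simp_all add: abs_clip_le)
  have nn: "0 \<le> ?f t" if "t \<in> space T" for t using nonneg[OF that] by (simp add: clip_def)
  have Pnn: "0 \<le> triple_op P ?f x" if "x \<in> space S" for x
    unfolding triple_op_def
    by (intro integral_nonneg_AE AE_I2) (use nn that in \<open>auto simp: space_P space_pair_measure\<close>)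
  have "(\<integral>\<^sup>+\<omega>. ennreal (?f (triangle X u \<omega>)) \<partial>M) = ennreal (expectation (\<lambda>\<omega>. ?f (triangle X u \<omega>)))"
    by (intro nn_integral_eq_integral integrable_bounded[where C = n]) (auto simp: abs_clip_le nn triangle_space)
  also have "expectation (\<lambda>\<omega>. ?f (triangle X u \<omega>)) = expectation (\<lambda>\<omega>. triple_op P ?f (X u \<omega>))"
    by (intro expectation_triangle bounded_measurableI[where C = "real n"]) (auto simp: abs_clip_le)
  also have "ennreal \<dots> = (\<integral>\<^sup>+\<omega>. ennreal (triple_op P ?f (X u \<omega>)) \<partial>M)"
    by (intro nn_integral_eq_integral[symmetric] integrable_bounded[where C = n])
      (use b Pnn X_space in \<open>fastforce+\<close>)
  also have "\<dots> \<le> (\<integral>\<^sup>+\<omega>. ennreal (triple_op P f (X u \<omega>)) \<partial>M)"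
  proof (intro nn_integral_mono ennreal_leI triple_op_mono)
    fix \<omega> y z assume "\<omega> \<in> space M" "y \<in> space S" "z \<in> space S"
    then show "clip n (f (X u \<omega>, y, z)) \<le> f (X u \<omega>, y, z)"
      using nonneg[of "(X u \<omega>, y, z)"] by (auto simp: clip_def space_pair_measure X_space)
  qed (auto simp: X_space b int)
  finally show "(\<integral>\<^sup>+\<omega>. ennreal (?f (triangle X u \<omega>)) \<partial>M) \<le> (\<integral>\<^sup>+\<omega>. ennreal (triple_op P f (X u \<omega>)) \<partial>M)" .
qed simp

text \<open>The first component of a triangle is the parent's state, so this removes the conditional
  mean of the triangle given its parent.\<close>

abbreviation compensated :: "('s \<times> 's \<times> 's \<Rightarrow> real) \<Rightarrow> 's \<times> 's \<times> 's \<Rightarrow> real" where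
  "compensated f \<equiv> \<lambda>t. f t - triple_op P f (fst t)"

text \<open>
  The Markov property is only given for bounded functions; truncation and Fatou's lemma transfer the
  upper bounds, which are all that is needed.
\<close>

lemma second_moment_bounded:
  assumes f [measurable]: "f \<in> borel_measurable T" and C: "\<And>t. t \<in> space T \<Longrightarrow> \<bar>f t\<bar> \<le> C"
  shows "expectation (\<lambda>\<omega>. (\<Sum>u\<in>gen m. compensated f (triangle X u \<omega>))\<^sup>2)
    \<le> (\<Sum>u\<in>gen m. expectation (\<lambda>\<omega>. triple_op P (\<lambda>t. (f t)\<^sup>2) (X u \<omega>)))"
proof -
  let ?g = "compensated f"
  have Pf: "\<bar>triple_op P f x\<bar> \<le> C" "integrable (P x) (\<lambda>(y, z). f (x, y, z))" if "x \<in> space S" for x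
    by (rule triple_op_bound[OF f C that]; assumption)+
  have f2: "\<bar>(f t)\<^sup>2\<bar> \<le> C\<^sup>2" if "t \<in> space T" for t
    using C[OF that] by (auto intro: power2_le_iff_abs_le[THEN iffD2] order_trans[OF abs_ge_zero])
  have Pf2: "\<bar>triple_op P (\<lambda>t. (f t)\<^sup>2) x\<bar> \<le> C\<^sup>2" "integrable (P x) (\<lambda>(y, z). (f (x, y, z))\<^sup>2)"
    if "x \<in> space S" for x
    by (rule triple_op_bound[OF _ f2 that]; measurable)+
  have g [measurable]: "?g \<in> borel_measurable T" by measurable
  have gb: "\<bar>?g t\<bar> \<le> 2 * C" if "t \<in> space T" for t
    using C[OF that] Pf(1)[of "fst t"] that by (force simp: space_pair_measure)
  have g2: "\<bar>?g t * ?g s\<bar> \<le> (2 * C) * (2 * C)" if "t \<in> space T" "s \<in> space T" for s t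
    unfolding abs_mult using gb[OF that(1)] gb[OF that(2)] by (intro mult_mono) auto
  have Pg: "triple_op P ?g x = 0" if x: "x \<in> space S" for x
  proof -
    interpret Px: prob_space "P x" by (rule prob_space_P[OF x])
    have "triple_op P ?g x = (\<integral>p. (case p of (y, z) \<Rightarrow> f (x, y, z)) - triple_op P f x \<partial>P x)"
      unfolding triple_op_def[of P ?g] by (intro Bochner_Integration.integral_cong) auto
    also have "\<dots> = 0"
      by (subst Bochner_Integration.integral_diff[OF Pf(2)[OF x]]) (auto simp: triple_op_def Px.prob_space)
    finally show ?thesis .
  qed
  \<comment> \<open>A conditional variance is at most the conditional second moment: the left side
    equals the right side minus the square of \<open>triple_op P f x\<close>.\<close>
  have Pg2: "triple_op P (\<lambda>t. ?g t * ?g t) x \<le> triple_op P (\<lambda>t. (f t)\<^sup>2) x" if x: "x \<in> space S" for x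
  proof -
    interpret Px: prob_space "P x" by (rule prob_space_P[OF x])
    let ?c = "triple_op P f x"
    have "triple_op P (\<lambda>t. ?g t * ?g t) x = (\<integral>p. (case p of (y, z) \<Rightarrow> (f (x, y, z))\<^sup>2)
        - 2 * ?c * (case p of (y, z) \<Rightarrow> f (x, y, z)) + ?c\<^sup>2 \<partial>P x)"
      unfolding triple_op_def[of P "\<lambda>t. ?g t * ?g t"]
      by (intro Bochner_Integration.integral_cong) (auto simp: power2_eq_square algebra_simps)
    also have "\<dots> = triple_op P (\<lambda>t. (f t)\<^sup>2) x - 2 * ?c * ?c + ?c\<^sup>2"
      using Pf(2)[OF x] Pf2(2)[OF x] by (simp add: Px.prob_space triple_op_def case_prod_beta')
    finally show ?thesis by (simp add: power2_eq_square)
  qed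
  have int: "integrable M (\<lambda>\<omega>. ?g (triangle X u \<omega>) * ?g (triangle X v \<omega>))" for u v
    by (rule integrable_bounded[where C = "(2 * C) * (2 * C)"]) (measurable, intro g2 triangle_space)
  have gbm: "?g \<in> bounded_measurable T" "(\<lambda>t. ?g t * ?g t) \<in> bounded_measurable T"
    by (rule bounded_measurableI[OF g gb] bounded_measurableI[OF _ g2]; simp)+
  have "expectation (\<lambda>\<omega>. (\<Sum>u\<in>gen m. ?g (triangle X u \<omega>))\<^sup>2)
      = (\<Sum>u\<in>gen m. \<Sum>v\<in>gen m. expectation (\<lambda>\<omega>. ?g (triangle X u \<omega>) * ?g (triangle X v \<omega>)))"
    unfolding power2_eq_square sum_product using int by (simp add: Bochner_Integration.integral_sum)
  also have "\<dots> = (\<Sum>u\<in>gen m. expectation (\<lambda>\<omega>. ?g (triangle X u \<omega>) * ?g (triangle X u \<omega>)))"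
  proof (rule sum.cong[OF refl])
    fix u assume u: "u \<in> gen m"
    \<comment> \<open>For distinct vertices the expectation factors into two conditional means, both
      of which vanish by \<open>Pg\<close>.\<close>
    have "expectation (\<lambda>\<omega>. ?g (triangle X u \<omega>) * ?g (triangle X v \<omega>)) = 0" if "v \<in> gen m - {u}" for v
      using u that
      by (subst expectation_triangle_pair[OF gbm(1) gbm(1)])
        (auto simp: gen_def Pg X_space cong: Bochner_Integration.integral_cong)
    then show "(\<Sum>v\<in>gen m. expectation (\<lambda>\<omega>. ?g (triangle X u \<omega>) * ?g (triangle X v \<omega>)))
      = expectation (\<lambda>\<omega>. ?g (triangle X u \<omega>) * ?g (triangle X u \<omega>))"
      using u by (subst sum.remove[OF _ u]) auto
  qed
  also have "\<dots> = (\<Sum>u\<in>gen m. expectation (\<lambda>\<omega>. triple_op P (\<lambda>t. ?g t * ?g t) (X u \<omega>)))"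
    by (intro sum.cong refl expectation_triangle[OF gbm(2)])
  also have "\<dots> \<le> (\<Sum>u\<in>gen m. expectation (\<lambda>\<omega>. triple_op P (\<lambda>t. (f t)\<^sup>2) (X u \<omega>)))"
  proof (intro sum_mono integral_mono integrable_bounded)
    show "\<bar>triple_op P (\<lambda>t. ?g t * ?g t) (X u \<omega>)\<bar> \<le> (2 * C) * (2 * C)" if "\<omega> \<in> space M" for u \<omega>
      by (rule triple_op_bound(1)[OF _ g2 X_space[OF that]]) auto
    show "\<bar>triple_op P (\<lambda>t. (f t)\<^sup>2) (X u \<omega>)\<bar> \<le> C\<^sup>2" if "\<omega> \<in> space M" for u \<omega>
      by (rule Pf2(1)[OF X_space[OF that]])
  qed (use Pg2 X_space in auto)
  finally show ?thesis .
qed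

text \<open>The truncation is applied to \<open>f\<close> before compensating: clipping the
  compensated function itself would destroy its centring and with it the orthogonality. The
  compensators converge by dominated convergence.\<close>

lemma second_moment_le:
  assumes f [measurable]: "f \<in> borel_measurable T"
    and int: "\<And>x. x \<in> space S \<Longrightarrow> integrable (P x) (\<lambda>(y, z). f (x, y, z))"
    and int2: "\<And>x. x \<in> space S \<Longrightarrow> integrable (P x) (\<lambda>(y, z). (f (x, y, z))\<^sup>2)"
  shows "(\<integral>\<^sup>+\<omega>. ennreal ((\<Sum>u\<in>gen m. f (triangle X u \<omega>) - triple_op P f (X u \<omega>))\<^sup>2) \<partial>M)
    \<le> (\<Sum>u\<in>gen m. \<integral>\<^sup>+\<omega>. ennreal (triple_op P (\<lambda>t. (f t)\<^sup>2) (X u \<omega>)) \<partial>M)"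
proof -
  let ?f = "\<lambda>n t. clip n (f t)"
  let ?D = "\<lambda>n \<omega>. \<Sum>u\<in>gen m. compensated (?f n) (triangle X u \<omega>)"
  have fst: "fst (triangle X u \<omega>) = X u \<omega>" for u \<omega> by (simp add: triangle_def)
  have b: "\<bar>triple_op P (?f n) x\<bar> \<le> real n" if "x \<in> space S" for x n
    by (rule triple_op_bound(1)[OF _ _ that]) (simp_all add: abs_clip_le)
  have c2: "(?f n t)\<^sup>2 \<le> (real n)\<^sup>2" for n t
    using abs_clip_le(1)[of n "f t"] by (simp add: power2_le_iff_abs_le)
  have b2: "\<bar>triple_op P (\<lambda>t. (?f n t)\<^sup>2) x\<bar> \<le> (real n)\<^sup>2"
      "integrable (P x) (\<lambda>(y, z). (?f n (x, y, z))\<^sup>2)" if "x \<in> space S" for x n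
    using triple_op_bound[of "\<lambda>t. (?f n t)\<^sup>2" "(real n)\<^sup>2" x] that by (simp_all add: c2)
  have P2_nonneg: "0 \<le> triple_op P (\<lambda>t. (?f n t)\<^sup>2) x" for n x
    by (auto simp: triple_op_def intro!: integral_nonneg_AE)
  \<comment> \<open>A crude bound depending on the truncation level, there to make the truncated
    square integrable.\<close>
  have Db: "\<bar>(?D n \<omega>)\<^sup>2\<bar> \<le> (real (card (gen m)) * (2 * real n))\<^sup>2" if "\<omega> \<in> space M" for n \<omega>
  proof -
    have "\<bar>?D n \<omega>\<bar> \<le> (\<Sum>u\<in>gen m. 2 * real n)"
    proof (rule order_trans[OF sum_abs sum_mono])
      fix u
      show "\<bar>compensated (?f n) (triangle X u \<omega>)\<bar> \<le> 2 * real n"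
        using abs_clip_le(1)[of n "f (triangle X u \<omega>)"] b[OF X_space[OF that], of n u] unfolding fst by linarith
    qed
    then show ?thesis by (simp add: power2_le_iff_abs_le)
  qed
  have "(\<integral>\<^sup>+\<omega>. ennreal ((\<Sum>u\<in>gen m. compensated f (triangle X u \<omega>))\<^sup>2) \<partial>M)
    \<le> (\<Sum>u\<in>gen m. \<integral>\<^sup>+\<omega>. ennreal (triple_op P (\<lambda>t. (f t)\<^sup>2) (X u \<omega>)) \<partial>M)"
  proof (rule nn_integral_le_of_AE_tendsto[where f = "\<lambda>n \<omega>. ennreal ((?D n \<omega>)\<^sup>2)"])
    show "AE \<omega> in M. (\<lambda>n. ennreal ((?D n \<omega>)\<^sup>2))
      \<longlonglongrightarrow> ennreal ((\<Sum>u\<in>gen m. compensated f (triangle X u \<omega>))\<^sup>2)"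
      unfolding fst
      by (intro AE_I2 tendsto_ennrealI tendsto_power tendsto_sum tendsto_diff clip_tendsto
          triple_op_clip_tendsto f int X_space)
    fix n
    have "(\<integral>\<^sup>+\<omega>. ennreal ((?D n \<omega>)\<^sup>2) \<partial>M) = ennreal (expectation (\<lambda>\<omega>. (?D n \<omega>)\<^sup>2))"
      by (intro nn_integral_eq_integral integrable_bounded[OF _ Db]) auto
    also have "\<dots> \<le> ennreal (\<Sum>u\<in>gen m. expectation (\<lambda>\<omega>. triple_op P (\<lambda>t. (?f n t)\<^sup>2) (X u \<omega>)))"
      by (intro ennreal_leI second_moment_bounded[where C = "real n"]) (auto simp: abs_clip_le)
    also have "\<dots> = (\<Sum>u\<in>gen m. ennreal (expectation (\<lambda>\<omega>. triple_op P (\<lambda>t. (?f n t)\<^sup>2) (X u \<omega>))))"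
      by (intro sum_ennreal[symmetric] integral_nonneg_AE AE_I2 P2_nonneg)
    also have "\<dots> = (\<Sum>u\<in>gen m. \<integral>\<^sup>+\<omega>. ennreal (triple_op P (\<lambda>t. (?f n t)\<^sup>2) (X u \<omega>)) \<partial>M)"
      by (intro sum.cong refl nn_integral_eq_integral[symmetric] integrable_bounded[OF _ b2(1)[OF X_space]])
        (auto simp: P2_nonneg)
    also have "\<dots> \<le> (\<Sum>u\<in>gen m. \<integral>\<^sup>+\<omega>. ennreal (triple_op P (\<lambda>t. (f t)\<^sup>2) (X u \<omega>)) \<partial>M)"
    proof (intro sum_mono nn_integral_mono ennreal_leI triple_op_mono)
      show "(clip n r)\<^sup>2 \<le> r\<^sup>2" for r :: real
        by (rule abs_le_square_iff[THEN iffD1, OF abs_clip_le(2)])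
    qed (auto simp: X_space b2 int2)
    finally show "(\<integral>\<^sup>+\<omega>. ennreal ((?D n \<omega>)\<^sup>2) \<partial>M)
      \<le> (\<Sum>u\<in>gen m. \<integral>\<^sup>+\<omega>. ennreal (triple_op P (\<lambda>t. (f t)\<^sup>2) (X u \<omega>)) \<partial>M)" .
  qed measurable
  then show ?thesis unfolding fst .
qed

end

section \<open>Spectral expansion\<close>

locale function_class = pair_kernel S P
  for S :: "'s measure" and P +
  fixes \<nu> :: "'s measure" and F :: "('s \<Rightarrow> real) set"
  assumes struct: "structural_assumption S \<nu> P F"
begin

lemma F_measurable: "f \<in> F \<Longrightarrow> f \<in> borel_measurable S"
  and F_cong: "f \<in> F \<Longrightarrow> eq_on_space S f f' \<Longrightarrow> f' \<in> F"
  and F_const: "(\<lambda>_. c) \<in> F"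
  and F_add: "f \<in> F \<Longrightarrow> f' \<in> F \<Longrightarrow> (\<lambda>x. f x + f' x) \<in> F"
  and F_scale: "f \<in> F \<Longrightarrow> (\<lambda>x. c * f x) \<in> F"
  and F_square: "f \<in> F \<Longrightarrow> (\<lambda>x. (f x)\<^sup>2) \<in> F"
  and F_integrable_initial: "f \<in> F \<Longrightarrow> integrable \<nu> f"
  and F_integrable_tensor: "f \<in> F \<Longrightarrow> f' \<in> F \<Longrightarrow> x \<in> space S \<Longrightarrow> integrable (P x) (\<lambda>(y, z). f y * f' z)"
  and F_tensor: "f \<in> F \<Longrightarrow> f' \<in> F \<Longrightarrow> kernel_op P (\<lambda>(y, z). f y * f' z) \<in> F"
  using struct unfolding structural_assumption_def by blast+

lemma F_diff: "f \<in> F \<Longrightarrow> f' \<in> F \<Longrightarrow> (\<lambda>x. f x - f' x) \<in> F"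
  using F_add[OF _ F_scale[of f' "-1"], of f] by simp

lemma F_sum: "(\<And>i. i \<in> I \<Longrightarrow> f i \<in> F) \<Longrightarrow> (\<lambda>x. \<Sum>i\<in>I. f i x) \<in> F"
  by (induction I rule: infinite_finite_induct) (auto intro: F_const F_add)

lemma F_integrable_fst: "f \<in> F \<Longrightarrow> x \<in> space S \<Longrightarrow> integrable (P x) (\<lambda>(y, z). f y)"
  and F_integrable_snd: "f \<in> F \<Longrightarrow> x \<in> space S \<Longrightarrow> integrable (P x) (\<lambda>(y, z). f z)"
  using F_integrable_tensor[OF _ F_const[of 1], of f x] F_integrable_tensor[OF F_const[of 1], of f x] by simp_all

lemma F_integrable_Q: "f \<in> F \<Longrightarrow> x \<in> space S \<Longrightarrow> integrable (Q x) f"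
  by (intro integrable_induced_kernel F_integrable_fst F_integrable_snd F_measurable)

text \<open>Taking one tensor factor equal to 1 gives both marginals of \<open>P\<close> on
  \<open>f\<close>. The values outside \<open>space S\<close>, where the kernel is arbitrary, are
  adjusted by \<open>F_cong\<close>.\<close>

lemma F_Q: assumes f: "f \<in> F" shows "kernel_op Q f \<in> F"
proof (rule F_cong)
  show "(\<lambda>x. 1 / 2 * (kernel_op P (\<lambda>(y, z). f y * 1) x + kernel_op P (\<lambda>(y, z). 1 * f z) x)) \<in> F"
    by (intro F_scale F_add F_tensor f F_const)
  show "eq_on_space S (\<lambda>x. 1 / 2 * (kernel_op P (\<lambda>(y, z). f y * 1) x + kernel_op P (\<lambda>(y, z). 1 * f z) x)) (kernel_op Q f)"
    unfolding eq_on_space_def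
    by (auto simp: integral_induced_kernel F_integrable_fst F_integrable_snd F_measurable f)
      (simp add: kernel_op_def)
qed

lemma F_Q_funpow: "f \<in> F \<Longrightarrow> (kernel_op Q ^^ n) f \<in> F"
  by (induction n) (auto intro: F_Q)

lemma Q_funpow_nonneg:
  assumes "f \<in> F" "\<And>x. x \<in> space S \<Longrightarrow> 0 \<le> f x" "x \<in> space S"
  shows "0 \<le> (kernel_op Q ^^ n) f x"
  using assms(3)
proof (induction n arbitrary: x)
  case (Suc n)
  then show ?case by (auto simp: kernel_op_def intro!: integral_nonneg_AE AE_I2)
qed (use assms in simp)

lemma triple_op_children_sum:
  assumes f: "f \<in> F" and x: "x \<in> space S"
  shows "integrable (P x) (\<lambda>(y, z). f y + f z)"
    and "triple_op P (\<lambda>(x, y, z). f y + f z) x = 2 * kernel_op Q f x"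
proof -
  have i: "integrable (P x) (\<lambda>p. f (fst p))" "integrable (P x) (\<lambda>p. f (snd p))"
    using F_integrable_fst[OF f x] F_integrable_snd[OF f x] by (simp_all add: case_prod_beta')
  then show "integrable (P x) (\<lambda>(y, z). f y + f z)" by (simp add: case_prod_beta')
  show "triple_op P (\<lambda>(x, y, z). f y + f z) x = 2 * kernel_op Q f x"
    using i by (subst integral_induced_kernel[OF x F_integrable_fst[OF f x] F_integrable_snd[OF f x] F_measurable[OF f]])
      (simp add: triple_op_def case_prod_beta')
qed

text \<open>Closure under squares handles the two diagonal terms of the expanded square, the tensor
  assumption the mixed term.\<close>

lemma integrable_children_sum_square:
  assumes f: "f \<in> F" and x: "x \<in> space S"
  shows "integrable (P x) (\<lambda>(y, z). (f y + f z)\<^sup>2)"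
proof -
  have "integrable (P x) (\<lambda>p. (case p of (y, z) \<Rightarrow> (f y)\<^sup>2 + (f z)\<^sup>2) + 2 * (case p of (y, z) \<Rightarrow> f y * f z))"
    using F_integrable_tensor[OF f f x] triple_op_children_sum(1)[OF F_square[OF f] x] by auto
  moreover have "(\<lambda>p. (case p of (y, z) \<Rightarrow> (f y)\<^sup>2 + (f z)\<^sup>2) + 2 * (case p of (y, z) \<Rightarrow> f y * f z))
      = (\<lambda>(y, z). (f y + f z)\<^sup>2)"
    by (auto simp: power2_sum)
  ultimately show ?thesis by simp
qed

abbreviation V where "V \<equiv> complex_span F"

text \<open>As \<open>F\<close> is a real vector space, its complex span is F + iF. Membership,
  integrability and the action of \<open>Q\<close> can thus be treated through real and imaginary
  parts.\<close>

lemma V_iff: "\<phi> \<in> V \<longleftrightarrow> (\<lambda>x. Re (\<phi> x)) \<in> F \<and> (\<lambda>x. Im (\<phi> x)) \<in> F"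
proof
  assume "\<phi> \<in> V"
  then obtain n :: nat and c :: "nat \<Rightarrow> complex" and \<psi> where \<psi>: "\<forall>i<n. \<psi> i \<in> F"
    and \<phi>: "\<phi> = (\<lambda>x. \<Sum>i<n. c i * complex_of_real (\<psi> i x))"
    unfolding complex_span_def by blast
  have "(\<lambda>x. \<Sum>i<n. Re (c i) * \<psi> i x) \<in> F" "(\<lambda>x. \<Sum>i<n. Im (c i) * \<psi> i x) \<in> F"
    using \<psi> by (auto intro!: F_sum F_scale)
  then show "(\<lambda>x. Re (\<phi> x)) \<in> F \<and> (\<lambda>x. Im (\<phi> x)) \<in> F" by (simp add: \<phi> Re_sum Im_sum)
next
  assume *: "(\<lambda>x. Re (\<phi> x)) \<in> F \<and> (\<lambda>x. Im (\<phi> x)) \<in> F"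
  let ?\<psi> = "\<lambda>i::nat. if i = 0 then (\<lambda>x. Re (\<phi> x)) else (\<lambda>x. Im (\<phi> x))"
  let ?c = "\<lambda>i::nat. if i = 0 then 1 else \<i>"
  have "\<phi> = (\<lambda>x. \<Sum>i<2. ?c i * complex_of_real (?\<psi> i x))"
    by (auto simp: numeral_2_eq_2 complex_eq_iff)
  moreover have "\<forall>i<2. ?\<psi> i \<in> F" using * by simp
  ultimately show "\<phi> \<in> V" unfolding complex_span_def mem_Collect_eq
    by (intro exI[of _ 2] exI[of _ ?c] exI[of _ ?\<psi>] conjI)
qed

lemma V_measurable: "\<phi> \<in> V \<Longrightarrow> \<phi> \<in> borel_measurable S"
  using F_measurable unfolding V_iff borel_measurable_complex_iff by blast

lemma V_diff: "\<phi> \<in> V \<Longrightarrow> \<psi> \<in> V \<Longrightarrow> (\<lambda>x. \<phi> x - \<psi> x) \<in> V"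
  and V_scale: "\<phi> \<in> V \<Longrightarrow> (\<lambda>x. c * \<phi> x) \<in> V"
  by (simp_all add: V_iff F_add F_diff F_scale)

lemma V_of_real: "f \<in> F \<Longrightarrow> (\<lambda>x. complex_of_real (f x)) \<in> V"
  by (simp add: V_iff F_const)

lemma V_sum: "(\<And>i. i \<in> I \<Longrightarrow> \<phi> i \<in> V) \<Longrightarrow> (\<lambda>x. \<Sum>i\<in>I. \<phi> i x) \<in> V"
  by (auto simp: V_iff Re_sum Im_sum intro: F_sum)

lemma V_integrable_Q: "\<phi> \<in> V \<Longrightarrow> x \<in> space S \<Longrightarrow> integrable (Q x) \<phi>"
  by (intro integrable_complexI) (auto simp: V_iff F_integrable_Q)

lemma V_integrable_initial: "\<phi> \<in> V \<Longrightarrow> integrable \<nu> \<phi>"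
  by (intro integrable_complexI) (auto simp: V_iff F_integrable_initial)

lemma Re_Q: "\<phi> \<in> V \<Longrightarrow> x \<in> space S \<Longrightarrow> Re (kernel_op Q \<phi> x) = kernel_op Q (\<lambda>x. Re (\<phi> x)) x"
  and Im_Q: "\<phi> \<in> V \<Longrightarrow> x \<in> space S \<Longrightarrow> Im (kernel_op Q \<phi> x) = kernel_op Q (\<lambda>x. Im (\<phi> x)) x"
  unfolding kernel_op_def by (simp_all add: V_integrable_Q)

lemma V_Q: assumes "\<phi> \<in> V" shows "kernel_op Q \<phi> \<in> V"
proof -
  have "(\<lambda>x. Re (kernel_op Q \<phi> x)) \<in> F"
    by (rule F_cong[of "kernel_op Q (\<lambda>x. Re (\<phi> x))"])
      (use assms in \<open>auto simp: V_iff eq_on_space_def Re_Q intro!: F_Q\<close>)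
  moreover have "(\<lambda>x. Im (kernel_op Q \<phi> x)) \<in> F"
    by (rule F_cong[of "kernel_op Q (\<lambda>x. Im (\<phi> x))"])
      (use assms in \<open>auto simp: V_iff eq_on_space_def Im_Q intro!: F_Q\<close>)
  ultimately show ?thesis by (simp add: V_iff)
qed

lemma V_Q_funpow: "\<phi> \<in> V \<Longrightarrow> (kernel_op Q ^^ n) \<phi> \<in> V"
  by (induction n) (auto intro: V_Q)

lemma Q_diff: "\<phi> \<in> V \<Longrightarrow> \<psi> \<in> V \<Longrightarrow> x \<in> space S \<Longrightarrow>
    kernel_op Q (\<lambda>x. \<phi> x - \<psi> x) x = kernel_op Q \<phi> x - kernel_op Q \<psi> x"
  and Q_scale: "\<phi> \<in> V \<Longrightarrow> x \<in> space S \<Longrightarrow> kernel_op Q (\<lambda>x. c * \<phi> x) x = c * kernel_op Q \<phi> x"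
  unfolding kernel_op_def by (simp_all add: V_integrable_Q)

lemma Q_sum: "(\<And>i. i \<in> I \<Longrightarrow> \<phi> i \<in> V) \<Longrightarrow> x \<in> space S \<Longrightarrow>
    kernel_op Q (\<lambda>x. \<Sum>i\<in>I. \<phi> i x) x = (\<Sum>i\<in>I. kernel_op Q (\<phi> i) x)"
  unfolding kernel_op_def by (simp add: V_integrable_Q)

lemma Q_const: "x \<in> space S \<Longrightarrow> kernel_op Q (\<lambda>_. c::'b::{banach, second_countable_topology}) x = c"
  using prob_space.prob_space[OF prob_space_Q] by (simp add: kernel_op_def)

lemma Q_scale_real: "kernel_op Q (\<lambda>x. (c::real) * f x) x = c * kernel_op Q f x"
  by (simp add: kernel_op_def)

lemma Q_of_real: "kernel_op Q (\<lambda>x. complex_of_real (f x)) x = complex_of_real (kernel_op Q f x)"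
  by (simp add: kernel_op_def)

lemma Q_funpow_of_real:
  "(kernel_op Q ^^ n) (\<lambda>x. complex_of_real (f x)) = (\<lambda>x. complex_of_real ((kernel_op Q ^^ n) f x))"
  by (induction n) (auto simp: Q_of_real)

lemma Q_norm_le:
  assumes "\<phi> \<in> V" "f \<in> F" "\<And>y. y \<in> space S \<Longrightarrow> cmod (\<phi> y) \<le> f y" "x \<in> space S"
  shows "cmod (kernel_op Q \<phi> x) \<le> kernel_op Q f x"
proof -
  have "cmod (kernel_op Q \<phi> x) \<le> (\<integral>y. cmod (\<phi> y) \<partial>Q x)"
    unfolding kernel_op_def by (rule integral_norm_bound)
  also have "\<dots> \<le> kernel_op Q f x"
    unfolding kernel_op_def using assms
    by (intro integral_mono integrable_norm V_integrable_Q F_integrable_Q) auto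
  finally show ?thesis .
qed

lemma Q_funpow_diff:
  assumes "\<phi> \<in> V" "\<psi> \<in> V" "x \<in> space S"
  shows "(kernel_op Q ^^ n) (\<lambda>x. \<phi> x - \<psi> x) x = (kernel_op Q ^^ n) \<phi> x - (kernel_op Q ^^ n) \<psi> x"
  using assms(3)
proof (induction n arbitrary: x)
  case (Suc n)
  have "eq_on_space S ((kernel_op Q ^^ n) (\<lambda>x. \<phi> x - \<psi> x)) (\<lambda>x. (kernel_op Q ^^ n) \<phi> x - (kernel_op Q ^^ n) \<psi> x)"
    using Suc.IH by (simp add: eq_on_space_def)
  from kernel_op_induced_cong[OF this, of P] show ?case
    using assms Suc.prems by (simp add: Q_diff V_Q_funpow)
qed simp

end

locale spectral_class = function_class S P \<nu> F
  for S :: "'s measure" and P \<nu> F +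
  fixes \<mu> :: "'s measure" and \<alpha> :: real and J :: "'j set" and a :: "'j \<Rightarrow> complex"
    and R :: "'j \<Rightarrow> ('s \<Rightarrow> complex) \<Rightarrow> 's \<Rightarrow> complex" and \<beta> :: "nat \<Rightarrow> real"
  assumes gap: "second_spectral_gap S Q F \<mu> \<alpha> J a R \<beta>"
begin

definition \<theta> :: "'j \<Rightarrow> complex" where "\<theta> j = a j / complex_of_real \<alpha>"

abbreviation r :: "'j \<Rightarrow> ('s \<Rightarrow> real) \<Rightarrow> 's \<Rightarrow> complex" where
  "r j f \<equiv> R j (complexify f)"

lemma alpha_pos: "0 < \<alpha>" and alpha_less_1: "\<alpha> < 1"
  and finite_J: "finite J" and inj_a: "inj_on a J"
  and norm_a: "j \<in> J \<Longrightarrow> cmod (a j) = \<alpha>"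
  and beta_pos: "0 < \<beta> n" and beta_le_1: "\<beta> n \<le> 1" and decseq_beta: "decseq \<beta>" and beta_tendsto: "\<beta> \<longlonglongrightarrow> 0"
  and R_V: "j \<in> J \<Longrightarrow> \<phi> \<in> V \<Longrightarrow> R j \<phi> \<in> V"
  using gap unfolding second_spectral_gap_def complex_projector_def by simp_all

lemma r_V: "j \<in> J \<Longrightarrow> f \<in> F \<Longrightarrow> r j f \<in> V"
  using R_V V_of_real by (simp add: complexify_def[abs_def])

lemma a_eq: "a j = complex_of_real \<alpha> * \<theta> j"
  using alpha_pos by (simp add: \<theta>_def)

lemma norm_alpha_power_mult: "cmod (complex_of_real \<alpha> ^ n * z) = \<alpha> ^ n * cmod z"
  using alpha_pos by (simp add: norm_mult norm_power)

lemma norm_theta: "j \<in> J \<Longrightarrow> cmod (\<theta> j) = 1"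
  using alpha_pos norm_a by (simp add: \<theta>_def norm_divide)

lemma inj_theta: "inj_on \<theta> J"
  using inj_a alpha_pos by (simp add: inj_on_def \<theta>_def)

definition remainder :: "('s \<Rightarrow> real) \<Rightarrow> nat \<Rightarrow> 's \<Rightarrow> complex" where
  "remainder f n x = complex_of_real ((kernel_op Q ^^ n) f x) - complex_of_real (\<integral>y. f y \<partial>\<mu>)
    - complex_of_real \<alpha> ^ n * (\<Sum>j\<in>J. \<theta> j ^ n * r j f x)"

lemma remainder_bound:
  assumes "f \<in> F"
  obtains g where "g \<in> F" "\<And>x. x \<in> space S \<Longrightarrow> 0 \<le> g x"
    "\<And>n x. x \<in> space S \<Longrightarrow> cmod (remainder f n x) \<le> \<beta> n * \<alpha> ^ n * g x"
proof -
  from gap have "\<forall>f\<in>F. \<exists>g\<in>F. \<forall>n. \<forall>x\<in>space S. cmod (remainder f n x) \<le> \<beta> n * \<alpha> ^ n * g x"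
    unfolding second_spectral_gap_def remainder_def \<theta>_def by (elim conjE)
  with assms obtain g where g: "g \<in> F"
    "\<And>n x. x \<in> space S \<Longrightarrow> cmod (remainder f n x) \<le> \<beta> n * \<alpha> ^ n * g x"
    by blast
  have "0 \<le> g x" if "x \<in> space S" for x
  proof -
    \<comment> \<open>The instance n = 0 of the bound, together with \<open>\<beta> 0 > 0\<close>,
      makes the dominating function non-negative.\<close>
    have "0 \<le> \<beta> 0 * g x" using order_trans[OF norm_ge_zero g(2)[OF that, of 0]] by simp
    then show ?thesis using beta_pos[of 0] by (simp add: zero_le_mult_iff)
  qed
  with g that show ?thesis by blast
qed

lemma remainder_V: "f \<in> F \<Longrightarrow> remainder f n \<in> V"
  unfolding remainder_def[abs_def]
  by (intro V_diff V_of_real F_Q_funpow F_const V_scale V_sum r_V)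

text \<open>
  Applying \<open>Q\<close> to the expansion of \<open>Q\<^sup>n f\<close> and comparing with that of \<open>Q\<^sup>n\<^sup>+\<^sup>1 f\<close> shows that
  \<open>\<Sum>j. \<theta>\<^sub>j\<^sup>n (Q R\<^sub>j f - \<alpha>\<^sub>j R\<^sub>j f)\<close> tends to 0, so each coefficient vanishes.
\<close>

lemma eigenfunction:
  assumes f: "f \<in> F" and j: "j \<in> J" and x: "x \<in> space S"
  shows "kernel_op Q (r j f) x = a j * r j f x"
proof -
  obtain g where g: "g \<in> F" "\<And>x. x \<in> space S \<Longrightarrow> 0 \<le> g x"
    "\<And>n x. x \<in> space S \<Longrightarrow> cmod (remainder f n x) \<le> \<beta> n * \<alpha> ^ n * g x"
    using remainder_bound[OF f] by metis
  let ?c = "\<lambda>j. kernel_op Q (r j f) x - a j * r j f x"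
  have bound: "cmod (\<Sum>j\<in>J. \<theta> j ^ n * ?c j) \<le> \<beta> n * (kernel_op Q g x + g x)" for n
  proof -
    \<comment> \<open>\<open>Q\<close> fixes constants, so the mean survives unchanged and cancels
      against the one in \<open>remainder f (Suc n)\<close>.\<close>
    have Qrem: "kernel_op Q (remainder f n) x
        = complex_of_real ((kernel_op Q ^^ Suc n) f x) - complex_of_real (\<integral>y. f y \<partial>\<mu>)
          - complex_of_real \<alpha> ^ n * (\<Sum>j\<in>J. \<theta> j ^ n * kernel_op Q (r j f) x)"
      unfolding remainder_def[abs_def] using x f
      by (simp add: Q_diff Q_scale Q_sum Q_of_real Q_const V_of_real V_diff V_scale V_sum r_V F_Q_funpow F_const)
    have "(\<Sum>j\<in>J. \<theta> j ^ n * ?c j) = (\<Sum>j\<in>J. \<theta> j ^ n * kernel_op Q (r j f) x)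
        - complex_of_real \<alpha> * (\<Sum>j\<in>J. \<theta> j ^ Suc n * r j f x)"
      unfolding sum_distrib_left sum_subtractf[symmetric]
      by (rule sum.cong) (simp_all add: a_eq right_diff_distrib mult_ac)
    then have "complex_of_real \<alpha> ^ n * (\<Sum>j\<in>J. \<theta> j ^ n * ?c j)
        = remainder f (Suc n) x - kernel_op Q (remainder f n) x"
      unfolding Qrem remainder_def by (simp add: right_diff_distrib)
    then have "\<alpha> ^ n * cmod (\<Sum>j\<in>J. \<theta> j ^ n * ?c j)
        = cmod (remainder f (Suc n) x - kernel_op Q (remainder f n) x)"
      by (simp flip: norm_alpha_power_mult)
    also have "\<dots> \<le> cmod (remainder f (Suc n) x) + cmod (kernel_op Q (remainder f n) x)"
      by (rule norm_triangle_ineq4)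
    also have "cmod (kernel_op Q (remainder f n) x) \<le> kernel_op Q (\<lambda>x. \<beta> n * \<alpha> ^ n * g x) x"
      by (intro Q_norm_le remainder_V f F_scale g x)
    also have "kernel_op Q (\<lambda>x. \<beta> n * \<alpha> ^ n * g x) x = \<alpha> ^ n * (\<beta> n * kernel_op Q g x)"
      by (simp add: Q_scale_real)
    also have "cmod (remainder f (Suc n) x) \<le> \<alpha> ^ n * (\<beta> n * g x)"
    proof -
      \<comment> \<open>Monotonicity of \<beta> puts both remainders on the same scale
        \<open>\<beta> n * \<alpha> ^ n\<close>, so that dividing by \<open>\<alpha> ^ n\<close>
        leaves a null sequence.\<close>
      have "\<beta> (Suc n) * \<alpha> ^ Suc n \<le> \<beta> n * \<alpha> ^ n"
        using decseqD[OF decseq_beta, of n "Suc n"] alpha_pos alpha_less_1 beta_pos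
        by (intro mult_mono power_decreasing) (auto intro: less_imp_le)
      from mult_right_mono[OF this g(2)[OF x]] g(3)[OF x, of "Suc n"] show ?thesis
        by (simp add: algebra_simps)
    qed
    finally have "\<alpha> ^ n * cmod (\<Sum>j\<in>J. \<theta> j ^ n * ?c j) \<le> \<alpha> ^ n * (\<beta> n * (kernel_op Q g x + g x))"
      by (simp add: algebra_simps)
    then show ?thesis using alpha_pos by simp
  qed
  have "(\<lambda>n. \<beta> n * (kernel_op Q g x + g x)) \<longlonglongrightarrow> 0"
    using tendsto_mult_right[OF beta_tendsto] by simp
  from unimodular_coeff_zero[OF finite_J inj_theta norm_theta bound this j] have "?c j = 0" .
  then show ?thesis by simp
qed

text \<open>Each term of the expansion of \<open>(kernel_op Q ^^ n) f\<close> is dominated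
  independently of n, since \<open>\<theta> j\<close> has modulus one and \<alpha> and
  \<open>\<beta> n\<close> are at most 1; the dominating function is integrable under the initial
  law. This yields the order \<open>2 ^ m\<close> of generation sums.\<close>

lemma bounded_iterated_means:
  assumes f: "f \<in> F" and space: "space \<nu> = space S"
  obtains C where "\<And>n. (\<integral>x. (kernel_op Q ^^ n) f x \<partial>\<nu>) \<le> C"
proof -
  obtain g where g: "g \<in> F" "\<And>x. x \<in> space S \<Longrightarrow> 0 \<le> g x"
    "\<And>n x. x \<in> space S \<Longrightarrow> cmod (remainder f n x) \<le> \<beta> n * \<alpha> ^ n * g x"
    using remainder_bound[OF f] by metis
    let ?G = "\<lambda>x. \<bar>\<integral>y. f y \<partial>\<mu>\<bar> + (\<Sum>j\<in>J. cmod (r j f x)) + g x"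
    have "(\<integral>x. (kernel_op Q ^^ n) f x \<partial>\<nu>) \<le> (\<integral>x. ?G x \<partial>\<nu>)" for n
    proof (rule integral_mono)
      show "integrable \<nu> ((kernel_op Q ^^ n) f)" by (intro F_integrable_initial F_Q_funpow f)
      show "integrable \<nu> ?G"
        by (intro Bochner_Integration.integrable_add Bochner_Integration.integrable_sum integrable_norm
            V_integrable_initial r_V f F_integrable_initial F_const g)
      fix x assume "x \<in> space \<nu>"
      then have x: "x \<in> space S" using space by simp
      have "(kernel_op Q ^^ n) f x \<le> cmod (complex_of_real ((kernel_op Q ^^ n) f x))" by simp
      also have "complex_of_real ((kernel_op Q ^^ n) f x) = remainder f n x
          + complex_of_real (\<integral>y. f y \<partial>\<mu>) + complex_of_real \<alpha> ^ n * (\<Sum>j\<in>J. \<theta> j ^ n * r j f x)"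
        by (simp add: remainder_def)
      also have "cmod \<dots> \<le> cmod (remainder f n x) + \<bar>\<integral>y. f y \<partial>\<mu>\<bar>
          + cmod (complex_of_real \<alpha> ^ n * (\<Sum>j\<in>J. \<theta> j ^ n * r j f x))"
        by (intro order_trans[OF norm_triangle_ineq] add_mono order_refl) simp
      also have "cmod (complex_of_real \<alpha> ^ n * (\<Sum>j\<in>J. \<theta> j ^ n * r j f x)) \<le> 1 * (\<Sum>j\<in>J. cmod (r j f x))"
        unfolding norm_mult using alpha_pos alpha_less_1
        by (intro mult_mono sum_norm_le) (auto simp: norm_mult norm_power norm_theta power_le_one)
      also have "cmod (remainder f n x) \<le> 1 * g x"
      proof (rule order_trans[OF g(3)[OF x]])
        have "\<beta> n * \<alpha> ^ n \<le> 1 * 1" using alpha_pos alpha_less_1 beta_le_1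
          by (intro mult_mono power_le_one) (auto intro: less_imp_le)
        then show "\<beta> n * \<alpha> ^ n * g x \<le> 1 * g x"
          using g(2)[OF x] by (intro mult_right_mono) auto
      qed
      finally show "(kernel_op Q ^^ n) f x \<le> ?G x" by simp
    qed
    then show ?thesis by (rule that)
qed

lemma Q_funpow_eigen_sum:
  assumes f: "f \<in> F" and x: "x \<in> space S"
  shows "(kernel_op Q ^^ n) (\<lambda>x. \<Sum>j\<in>J. r j f x) x = (\<Sum>j\<in>J. a j ^ n * r j f x)"
  using x
proof (induction n arbitrary: x)
  case (Suc n)
  have "eq_on_space S ((kernel_op Q ^^ n) (\<lambda>x. \<Sum>j\<in>J. r j f x)) (\<lambda>x. \<Sum>j\<in>J. a j ^ n * r j f x)"
    using Suc.IH by (simp add: eq_on_space_def)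
  from kernel_op_induced_cong[OF this, of P] show ?case
    using Suc.prems f by (simp add: Q_sum Q_scale V_scale r_V eigenfunction mult_ac)
qed simp

context
  fixes h :: "nat \<Rightarrow> 's \<Rightarrow> real" and g :: "'s \<Rightarrow> real"
  assumes usb: "uniform_spectral_bounds S Q F \<mu> \<alpha> J R \<beta> h g"
begin

lemma usb_F: "h l \<in> F" "g \<in> F"
  and usb_bound: "x \<in> space S \<Longrightarrow> \<bar>(kernel_op Q ^^ n) (h l) x\<bar> \<le> g x"
  and usb_mean: "x \<in> space S \<Longrightarrow> \<bar>(kernel_op Q ^^ n) (mean_centered \<mu> (h l)) x\<bar> \<le> \<alpha> ^ n * g x"
  and usb_spectral: "x \<in> space S \<Longrightarrow> cmod ((kernel_op Q ^^ n) (spectrally_centered \<mu> J R (h l)) x) \<le> \<beta> n * \<alpha> ^ n * g x"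
  using usb unfolding uniform_spectral_bounds_def by blast+

lemma usb_nonneg: "x \<in> space S \<Longrightarrow> 0 \<le> g x"
  using order_trans[OF abs_ge_zero usb_bound] .

lemma mean_centered_F: "mean_centered \<mu> (h l) \<in> F"
  unfolding mean_centered_def[abs_def] by (intro F_diff usb_F F_const)

lemma spectrally_centered_V: "spectrally_centered \<mu> J R (h l) \<in> V"
  unfolding spectrally_centered_def[abs_def] by (intro V_diff V_of_real mean_centered_F V_sum r_V usb_F)

text \<open>The difference between the iterates of the mean-centred and the spectrally centred
  function is exactly \<open>\<alpha> ^ n\<close> times the phase sum of the
  \<open>r j (h l)\<close>. Each iterate is at most \<open>\<alpha> ^ n * g x\<close>, because
  \<open>\<beta> n \<le> 1\<close>; so the phase sums stay below \<open>2 * g x\<close> for all n,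
  and averaging isolates one j.\<close>

lemma eigenprojection_bound:
  assumes j: "j \<in> J" and x: "x \<in> space S"
  shows "cmod (r j (h l) x) \<le> 2 * g x"
proof (rule unimodular_coeff_bound[OF finite_J inj_theta norm_theta _ j])
  fix n
  have "complex_of_real ((kernel_op Q ^^ n) (mean_centered \<mu> (h l)) x) - (\<Sum>j\<in>J. a j ^ n * r j (h l) x)
      = (kernel_op Q ^^ n) (spectrally_centered \<mu> J R (h l)) x"
    unfolding spectrally_centered_def[abs_def]
    by (simp add: Q_funpow_diff V_of_real mean_centered_F V_sum r_V usb_F x Q_funpow_of_real Q_funpow_eigen_sum)
  then have "complex_of_real \<alpha> ^ n * (\<Sum>j\<in>J. \<theta> j ^ n * r j (h l) x)
      = complex_of_real ((kernel_op Q ^^ n) (mean_centered \<mu> (h l)) x)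
        - (kernel_op Q ^^ n) (spectrally_centered \<mu> J R (h l)) x"
    by (simp add: a_eq power_mult_distrib sum_distrib_left algebra_simps)
  then have "\<alpha> ^ n * cmod (\<Sum>j\<in>J. \<theta> j ^ n * r j (h l) x)
      = cmod (complex_of_real ((kernel_op Q ^^ n) (mean_centered \<mu> (h l)) x)
        - (kernel_op Q ^^ n) (spectrally_centered \<mu> J R (h l)) x)"
    by (simp flip: norm_alpha_power_mult)
  also have "\<dots> \<le> \<bar>(kernel_op Q ^^ n) (mean_centered \<mu> (h l)) x\<bar>
      + cmod ((kernel_op Q ^^ n) (spectrally_centered \<mu> J R (h l)) x)"
    using norm_triangle_ineq4 by (metis norm_of_real)
  also have "\<dots> \<le> \<alpha> ^ n * g x + \<beta> n * \<alpha> ^ n * g x"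
    by (intro add_mono usb_mean usb_spectral x)
  also have "\<dots> \<le> \<alpha> ^ n * (2 * g x)"
    using mult_right_mono[OF beta_le_1[of n], of "\<alpha> ^ n * g x"] alpha_pos usb_nonneg[OF x] by simp
  finally show "cmod (\<Sum>j\<in>J. \<theta> j ^ n * r j (h l) x) \<le> 2 * g x"
    using alpha_pos by simp
qed

end

end

section \<open>Sums over a generation\<close>

locale bmc_function_class = bmc M S P \<nu> X + function_class S P \<nu> F
  for M :: "'w measure" and S :: "'s measure" and P \<nu> X F
begin

lemma space_initial: "space \<nu> = space S"
  using arg_cong[OF distr_root, of space] by simp

lemma nn_integral_root:
  assumes \<psi>: "\<psi> \<in> F" and nonneg: "\<And>x. x \<in> space S \<Longrightarrow> 0 \<le> \<psi> x"
  shows "(\<integral>\<^sup>+\<omega>. ennreal (\<psi> (X [] \<omega>)) \<partial>M) = ennreal (\<integral>x. \<psi> x \<partial>\<nu>)"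
proof -
  note F_measurable[OF \<psi>, measurable]
  have "(\<integral>\<^sup>+\<omega>. ennreal (\<psi> (X [] \<omega>)) \<partial>M) = (\<integral>\<^sup>+x. ennreal (\<psi> x) \<partial>distr M S (X []))"
    by (subst nn_integral_distr) auto
  also have "\<dots> = ennreal (\<integral>x. \<psi> x \<partial>\<nu>)"
    unfolding distr_root using nonneg
    by (intro nn_integral_eq_integral F_integrable_initial \<psi> AE_I2) (simp add: space_initial)
  finally show ?thesis .
qed

text \<open>One-sided many-to-one formula. Grouping the vertices by parent replaces \<psi> by its
  sum over two children, whose image under \<open>triple_op P\<close> is
  \<open>2 * kernel_op Q \<psi>\<close>; the induction therefore changes the function while it
  climbs to the root.\<close>

lemma sum_nn_integral_generation_le:
  assumes "\<psi> \<in> F" and "\<And>x. x \<in> space S \<Longrightarrow> 0 \<le> \<psi> x"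
  shows "(\<Sum>u\<in>gen m. \<integral>\<^sup>+\<omega>. ennreal (\<psi> (X u \<omega>)) \<partial>M) \<le> ennreal (2 ^ m * (\<integral>x. (kernel_op Q ^^ m) \<psi> x \<partial>\<nu>))"
  using assms
proof (induction m arbitrary: \<psi>)
  case 0
  then show ?case by (simp add: gen_def nn_integral_root)
next
  case (Suc m)
  note \<psi> = Suc.prems(1) and nonneg = Suc.prems(2)
  note F_measurable[OF \<psi>, measurable] F_measurable[OF F_Q[OF \<psi>], measurable]
  let ?f = "\<lambda>(x, y, z). \<psi> y + \<psi> z"
  have Qnn: "0 \<le> kernel_op Q \<psi> x" if "x \<in> space S" for x
    using Q_funpow_nonneg[OF \<psi> nonneg that, of 1] by simp
  have "(\<Sum>u\<in>gen (Suc m). \<integral>\<^sup>+\<omega>. ennreal (\<psi> (X u \<omega>)) \<partial>M)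
    = (\<Sum>u\<in>gen m. \<integral>\<^sup>+\<omega>. ennreal (?f (triangle X u \<omega>)) \<partial>M)"
    unfolding sum_gen_Suc
  proof (rule sum.cong[OF refl])
    fix u
    have "(\<integral>\<^sup>+\<omega>. ennreal (?f (triangle X u \<omega>)) \<partial>M)
        = (\<integral>\<^sup>+\<omega>. ennreal (\<psi> (X (u @ [False]) \<omega>)) + ennreal (\<psi> (X (u @ [True]) \<omega>)) \<partial>M)"
      using nonneg by (intro nn_integral_cong) (simp add: triangle_def X_space)
    then show "(\<integral>\<^sup>+\<omega>. ennreal (\<psi> (X (u @ [False]) \<omega>)) \<partial>M) + (\<integral>\<^sup>+\<omega>. ennreal (\<psi> (X (u @ [True]) \<omega>)) \<partial>M)
        = (\<integral>\<^sup>+\<omega>. ennreal (?f (triangle X u \<omega>)) \<partial>M)"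
      by (simp add: nn_integral_add)
  qed
  also have "\<dots> \<le> (\<Sum>u\<in>gen m. \<integral>\<^sup>+\<omega>. ennreal (triple_op P ?f (X u \<omega>)) \<partial>M)"
    using nonneg triple_op_children_sum(1)[OF \<psi>]
    by (intro sum_mono nn_integral_triangle_le) (auto simp: space_pair_measure)
  also have "\<dots> = (\<Sum>u\<in>gen m. \<integral>\<^sup>+\<omega>. 2 * ennreal (kernel_op Q \<psi> (X u \<omega>)) \<partial>M)"
    by (intro sum.cong refl nn_integral_cong)
      (simp add: triple_op_children_sum(2)[OF \<psi>] X_space Qnn ennreal_mult')
  also have "\<dots> = 2 * (\<Sum>u\<in>gen m. \<integral>\<^sup>+\<omega>. ennreal (kernel_op Q \<psi> (X u \<omega>)) \<partial>M)"
    by (simp add: nn_integral_cmult sum_distrib_left)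
  also have "\<dots> \<le> 2 * ennreal (2 ^ m * (\<integral>x. (kernel_op Q ^^ m) (kernel_op Q \<psi>) x \<partial>\<nu>))"
    by (intro mult_left_mono Suc.IH F_Q \<psi> Qnn) auto
  also have "\<dots> = ennreal (2 ^ Suc m * (\<integral>x. (kernel_op Q ^^ Suc m) \<psi> x \<partial>\<nu>))"
    by (simp add: ennreal_mult' funpow_swap1 mult.assoc)
  finally show ?case .
qed

definition gensum :: "nat \<Rightarrow> ('s \<Rightarrow> complex) \<Rightarrow> 'w \<Rightarrow> complex" where
  "gensum m \<phi> \<omega> = (\<Sum>u\<in>gen m. \<phi> (X u \<omega>))"

lemma measurable_gensum: "\<phi> \<in> V \<Longrightarrow> gensum m \<phi> \<in> borel_measurable M"
  unfolding gensum_def[abs_def] by (intro borel_measurable_sum measurable_compose[OF measurable_X V_measurable])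

lemma gensum_0: "gensum 0 \<phi> \<omega> = \<phi> (X [] \<omega>)"
  by (simp add: gensum_def gen_def)

text \<open>This is \<open>second_moment_le\<close> for the sum of \<psi> over the two children,
  whose conditional mean given the parent is \<open>2 * kernel_op Q \<psi>\<close>.\<close>

lemma second_moment_increment_real:
  assumes \<psi>: "\<psi> \<in> F" and g: "g \<in> F" and le: "\<And>x. x \<in> space S \<Longrightarrow> \<bar>\<psi> x\<bar> \<le> c * g x"
    and K: "(\<Sum>u\<in>gen m. \<integral>\<^sup>+\<omega>. ennreal (kernel_op Q (\<lambda>x. (g x)\<^sup>2) (X u \<omega>)) \<partial>M) \<le> ennreal (2 ^ m * K)"
  shows "(\<integral>\<^sup>+\<omega>. ennreal (((\<Sum>u\<in>gen (Suc m). \<psi> (X u \<omega>)) - 2 * (\<Sum>u\<in>gen m. kernel_op Q \<psi> (X u \<omega>)))\<^sup>2) \<partial>M)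
    \<le> ennreal (4 * c\<^sup>2 * (2 ^ m * K))"
proof -
  note F_measurable[OF \<psi>, measurable]
  let ?f = "\<lambda>(x, y, z). \<psi> y + \<psi> z"
  \<comment> \<open>From (p + q)^2 \<le> 2 p^2 + 2 q^2, the squared sum over children is at most
    \<open>?cg y + ?cg z\<close>, and \<open>triple_op P\<close> maps that to \<open>4 * c^2\<close>
    times \<open>kernel_op Q ?g2\<close>.\<close>
  let ?g2 = "\<lambda>x. (g x)\<^sup>2" and ?cg = "\<lambda>x. 2 * c\<^sup>2 * (g x)\<^sup>2"
  have cg: "?cg \<in> F" and g2: "?g2 \<in> F" by (intro F_scale F_square g)+
  note F_measurable[OF F_Q[OF g2], measurable]
  have le2: "(\<psi> x)\<^sup>2 \<le> c\<^sup>2 * (g x)\<^sup>2" if "x \<in> space S" for x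
    using power_mono[OF le[OF that] abs_ge_zero, of 2] by (simp add: power_mult_distrib)
  have "(\<integral>\<^sup>+\<omega>. ennreal (((\<Sum>u\<in>gen (Suc m). \<psi> (X u \<omega>)) - 2 * (\<Sum>u\<in>gen m. kernel_op Q \<psi> (X u \<omega>)))\<^sup>2) \<partial>M)
      = (\<integral>\<^sup>+\<omega>. ennreal ((\<Sum>u\<in>gen m. ?f (triangle X u \<omega>) - triple_op P ?f (X u \<omega>))\<^sup>2) \<partial>M)"
    by (intro nn_integral_cong)
      (simp add: sum_gen_Suc triangle_def triple_op_children_sum(2)[OF \<psi>] X_space sum_subtractf sum_distrib_left)
  also have "\<dots> \<le> (\<Sum>u\<in>gen m. \<integral>\<^sup>+\<omega>. ennreal (triple_op P (\<lambda>t. (?f t)\<^sup>2) (X u \<omega>)) \<partial>M)"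
    using triple_op_children_sum(1)[OF \<psi>] integrable_children_sum_square[OF \<psi>]
    by (intro second_moment_le) auto
  also have "\<dots> \<le> (\<Sum>u\<in>gen m. \<integral>\<^sup>+\<omega>. ennreal (4 * c\<^sup>2) * ennreal (kernel_op Q ?g2 (X u \<omega>)) \<partial>M)"
  proof (intro sum_mono nn_integral_mono)
    fix u \<omega> assume "\<omega> \<in> space M"
    then have x: "X u \<omega> \<in> space S" by (rule X_space)
    have "triple_op P (\<lambda>t. (?f t)\<^sup>2) (X u \<omega>) \<le> triple_op P (\<lambda>(x, y, z). ?cg y + ?cg z) (X u \<omega>)"
    proof (rule triple_op_mono)
      fix y z assume "y \<in> space S" "z \<in> space S"
      from le2[OF this(1)] le2[OF this(2)] sum_squares_ge_zero[of "\<psi> y - \<psi> z" 0]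
      show "(case (X u \<omega>, y, z) of (x, y, z) \<Rightarrow> \<psi> y + \<psi> z)\<^sup>2 \<le> (case (X u \<omega>, y, z) of (x, y, z) \<Rightarrow> ?cg y + ?cg z)"
        by (simp add: power2_eq_square algebra_simps)
    qed (use integrable_children_sum_square[OF \<psi> x] triple_op_children_sum(1)[OF cg x] x in auto)
    also have "\<dots> = 4 * c\<^sup>2 * kernel_op Q ?g2 (X u \<omega>)"
      by (simp add: triple_op_children_sum(2)[OF cg x] Q_scale_real)
    finally show "ennreal (triple_op P (\<lambda>t. (?f t)\<^sup>2) (X u \<omega>)) \<le> ennreal (4 * c\<^sup>2) * ennreal (kernel_op Q ?g2 (X u \<omega>))"
      by (simp add: ennreal_mult'[symmetric] ennreal_leI)
  qed
  also have "\<dots> = ennreal (4 * c\<^sup>2) * (\<Sum>u\<in>gen m. \<integral>\<^sup>+\<omega>. ennreal (kernel_op Q ?g2 (X u \<omega>)) \<partial>M)"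
    by (simp add: nn_integral_cmult sum_distrib_left)
  also have "\<dots> \<le> ennreal (4 * c\<^sup>2) * ennreal (2 ^ m * K)"
    by (intro mult_left_mono K) simp
  also have "\<dots> = ennreal (4 * c\<^sup>2 * (2 ^ m * K))"
    by (rule ennreal_mult'[symmetric]) simp
  finally show ?thesis .
qed

context
  fixes g :: "'s \<Rightarrow> real" and K :: real
  assumes g: "g \<in> F" and g_nonneg: "\<And>x. x \<in> space S \<Longrightarrow> 0 \<le> g x" and K: "0 < K"
    and growth: "\<And>m. (\<Sum>u\<in>gen m. \<integral>\<^sup>+\<omega>. ennreal (kernel_op Q (\<lambda>x. (g x)\<^sup>2) (X u \<omega>)) \<partial>M) \<le> ennreal (2 ^ m * K)"
begin

text \<open>The real and the imaginary part each contribute the real bound with constant 4, hence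
  the 8.\<close>

lemma second_moment_increment:
  assumes \<phi>: "\<phi> \<in> V" and le: "\<And>x. x \<in> space S \<Longrightarrow> cmod (\<phi> x) \<le> c * g x"
  shows "(\<integral>\<^sup>+\<omega>. ennreal ((cmod (gensum (Suc m) \<phi> \<omega> - 2 * gensum m (kernel_op Q \<phi>) \<omega>))\<^sup>2) \<partial>M)
    \<le> ennreal (8 * c\<^sup>2 * K * 2 ^ m)"
proof -
  let ?D = "\<lambda>\<psi> \<omega>. (\<Sum>u\<in>gen (Suc m). \<psi> (X u \<omega>)) - 2 * (\<Sum>u\<in>gen m. kernel_op Q \<psi> (X u \<omega>))"
  let ?r = "\<lambda>x. Re (\<phi> x)" and ?i = "\<lambda>x. Im (\<phi> x)"
  have ri: "?r \<in> F" "?i \<in> F" using \<phi> by (simp_all add: V_iff)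
  note F_measurable[OF ri(1), measurable] F_measurable[OF F_Q[OF ri(1)], measurable]
    F_measurable[OF ri(2), measurable] F_measurable[OF F_Q[OF ri(2)], measurable]
  have "(\<integral>\<^sup>+\<omega>. ennreal ((cmod (gensum (Suc m) \<phi> \<omega> - 2 * gensum m (kernel_op Q \<phi>) \<omega>))\<^sup>2) \<partial>M)
      = (\<integral>\<^sup>+\<omega>. ennreal ((?D ?r \<omega>)\<^sup>2) + ennreal ((?D ?i \<omega>)\<^sup>2) \<partial>M)"
    by (intro nn_integral_cong)
      (simp add: gensum_def cmod_power2 Re_sum Im_sum Re_Q[OF \<phi>] Im_Q[OF \<phi>] X_space)
  also have "\<dots> = (\<integral>\<^sup>+\<omega>. ennreal ((?D ?r \<omega>)\<^sup>2) \<partial>M) + (\<integral>\<^sup>+\<omega>. ennreal ((?D ?i \<omega>)\<^sup>2) \<partial>M)"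
    by (intro nn_integral_add) measurable
  also have "\<dots> \<le> ennreal (4 * c\<^sup>2 * (2 ^ m * K)) + ennreal (4 * c\<^sup>2 * (2 ^ m * K))"
    by (intro add_mono second_moment_increment_real[OF _ g _ growth] ri
        order_trans[OF abs_Re_le_cmod le] order_trans[OF abs_Im_le_cmod le])
  also have "\<dots> = ennreal (8 * c\<^sup>2 * K * 2 ^ m)"
    using K by (subst ennreal_plus[symmetric]) (auto simp: mult_ac)
  finally show ?thesis .
qed

lemma first_moment_increment:
  assumes \<phi>: "\<phi> \<in> V" and le: "\<And>x. x \<in> space S \<Longrightarrow> cmod (\<phi> x) \<le> c * g x" and c: "0 < c"
  shows "(\<integral>\<^sup>+\<omega>. ennreal (cmod (gensum (Suc m) \<phi> \<omega> - 2 * gensum m (kernel_op Q \<phi>) \<omega>)) \<partial>M)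
    \<le> ennreal (c * sqrt (8 * K) * sqrt 2 ^ m)"
proof (rule nn_integral_norm_le_of_square)
  note measurable_gensum[OF \<phi>, measurable] measurable_gensum[OF V_Q[OF \<phi>], measurable]
  show "(\<lambda>\<omega>. gensum (Suc m) \<phi> \<omega> - 2 * gensum m (kernel_op Q \<phi>) \<omega>) \<in> borel_measurable M"
    by measurable
  have "(c * sqrt (8 * K) * sqrt 2 ^ m)\<^sup>2 = 8 * c\<^sup>2 * K * 2 ^ m"
    using K by (simp add: power_mult_distrib power_mult[symmetric] mult.commute[of m])
      (simp add: power_mult)
  then show "(\<integral>\<^sup>+\<omega>. ennreal ((cmod (gensum (Suc m) \<phi> \<omega> - 2 * gensum m (kernel_op Q \<phi>) \<omega>))\<^sup>2) \<partial>M)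
    \<le> ennreal ((c * sqrt (8 * K) * sqrt 2 ^ m)\<^sup>2)"
    using second_moment_increment[OF \<phi> le] by simp
qed (use c K in simp)

text \<open>Iterates \<open>gensum (m + 1) \<phi> \<approx> 2 gensum m (Q \<phi>)\<close>; the errors are orthogonal sums over a generation, hence of order \<open>2\<^sup>m\<^sup>/\<^sup>2\<close>.\<close>

lemma first_moment_gensum:
  assumes "\<phi> \<in> V" and "\<And>k x. x \<in> space S \<Longrightarrow> cmod ((kernel_op Q ^^ k) \<phi> x) \<le> b k * g x" and "\<And>k. 0 < b k"
  shows "(\<integral>\<^sup>+\<omega>. ennreal (cmod (gensum m \<phi> \<omega>)) \<partial>M)
    \<le> ennreal (2 ^ m * b m * (\<integral>x. g x \<partial>\<nu>) + (\<Sum>i<m. 2 ^ i * sqrt 2 ^ (m - Suc i) * b i * sqrt (8 * K)))"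
  using assms
proof (induction m arbitrary: \<phi> b)
  case 0
  have "(\<integral>\<^sup>+\<omega>. ennreal (cmod (gensum 0 \<phi> \<omega>)) \<partial>M) \<le> (\<integral>\<^sup>+\<omega>. ennreal (b 0 * g (X [] \<omega>)) \<partial>M)"
    using "0.prems"(2)[OF X_space, of _ 0] by (intro nn_integral_mono ennreal_leI) (simp add: gensum_0)
  also have "\<dots> = ennreal (\<integral>x. b 0 * g x \<partial>\<nu>)"
    using "0.prems"(3)[of 0] g_nonneg by (intro nn_integral_root F_scale g) (simp add: less_imp_le)
  finally show ?case by simp
next
  case (Suc m)
  note \<phi> = Suc.prems(1) and bound = Suc.prems(2) and b = Suc.prems(3)
  \<comment> \<open>Summand i is the fluctuation of the i-th iterate of \<phi> between the
    generations \<open>m - Suc i\<close> and \<open>m - i\<close>, of order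
    \<open>sqrt 2 ^ (m - Suc i)\<close>; the factor \<open>2 ^ i\<close> comes from the i doublings
    already made.\<close>
  let ?B = "\<lambda>b m. \<Sum>i<m. 2 ^ i * sqrt 2 ^ (m - Suc i) * b i * sqrt (8 * K)"
  let ?G = "\<integral>x. g x \<partial>\<nu>"
  note measurable_gensum[OF \<phi>, measurable] measurable_gensum[OF V_Q[OF \<phi>], measurable]
  have G: "0 \<le> ?G" using g_nonneg by (intro integral_nonneg_AE AE_I2) (simp add: space_initial)
  have B: "0 \<le> ?B b' m" if "\<And>k. 0 < b' k" for b' m
    using that K by (intro sum_nonneg mult_nonneg_nonneg) (auto intro: less_imp_le)
  have combine: "ennreal p + 2 * ennreal q = ennreal (p + 2 * q)" if "0 \<le> p" "0 \<le> q" for p q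
    using that by (simp add: ennreal_mult')
  have "(\<integral>\<^sup>+\<omega>. ennreal (cmod (gensum (Suc m) \<phi> \<omega>)) \<partial>M)
    \<le> (\<integral>\<^sup>+\<omega>. ennreal (cmod (gensum (Suc m) \<phi> \<omega> - 2 * gensum m (kernel_op Q \<phi>) \<omega>))
        + 2 * ennreal (cmod (gensum m (kernel_op Q \<phi>) \<omega>)) \<partial>M)"
  proof (rule nn_integral_mono)
    fix \<omega>
    have "cmod (gensum (Suc m) \<phi> \<omega>) \<le> cmod (gensum (Suc m) \<phi> \<omega> - 2 * gensum m (kernel_op Q \<phi>) \<omega>)
        + 2 * cmod (gensum m (kernel_op Q \<phi>) \<omega>)"
      using norm_triangle_sub[of "gensum (Suc m) \<phi> \<omega>" "2 * gensum m (kernel_op Q \<phi>) \<omega>"] by (simp add: norm_mult)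
    then have "ennreal (cmod (gensum (Suc m) \<phi> \<omega>)) \<le> ennreal (cmod (gensum (Suc m) \<phi> \<omega> - 2 * gensum m (kernel_op Q \<phi>) \<omega>)
        + 2 * cmod (gensum m (kernel_op Q \<phi>) \<omega>))" by (rule ennreal_leI)
    then show "ennreal (cmod (gensum (Suc m) \<phi> \<omega>)) \<le> ennreal (cmod (gensum (Suc m) \<phi> \<omega> - 2 * gensum m (kernel_op Q \<phi>) \<omega>))
        + 2 * ennreal (cmod (gensum m (kernel_op Q \<phi>) \<omega>))"
      by (simp add: ennreal_mult')
  qed
  also have "\<dots> = (\<integral>\<^sup>+\<omega>. ennreal (cmod (gensum (Suc m) \<phi> \<omega> - 2 * gensum m (kernel_op Q \<phi>) \<omega>)) \<partial>M)
      + 2 * (\<integral>\<^sup>+\<omega>. ennreal (cmod (gensum m (kernel_op Q \<phi>) \<omega>)) \<partial>M)"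
    by (simp add: nn_integral_add nn_integral_cmult)
  \<comment> \<open>The iterates of \<open>kernel_op Q \<phi>\<close> obey the shifted bounds
    \<open>b (Suc k)\<close>, which is why \<open>b\<close> varies in the induction. The new error
    is the term i = 0 of the longer sum, and the factor 2 raises \<open>2 ^ i\<close> in the
    others.\<close>
  also have "\<dots> \<le> ennreal (b 0 * sqrt (8 * K) * sqrt 2 ^ m)
      + 2 * ennreal (2 ^ m * b (Suc m) * ?G + ?B (\<lambda>k. b (Suc k)) m)"
    using bound[of _ 0] b bound[of _ "Suc k" for k]
    by (intro add_mono mult_left_mono first_moment_increment \<phi> Suc.IH V_Q) (auto simp: funpow_swap1)
  also have "\<dots> = ennreal (b 0 * sqrt (8 * K) * sqrt 2 ^ m + 2 * (2 ^ m * b (Suc m) * ?G + ?B (\<lambda>k. b (Suc k)) m))"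
    using b[of 0] b[of "Suc m"] B[of "\<lambda>k. b (Suc k)" m] b G K
    by (intro combine add_nonneg_nonneg mult_nonneg_nonneg) (auto intro: less_imp_le)
  also have "b 0 * sqrt (8 * K) * sqrt 2 ^ m + 2 * (2 ^ m * b (Suc m) * ?G + ?B (\<lambda>k. b (Suc k)) m)
      = 2 ^ Suc m * b (Suc m) * ?G + ?B b (Suc m)"
    by (subst sum.lessThan_Suc_shift) (simp add: sum_distrib_left algebra_simps)
  finally show ?case .
qed

end

end

section \<open>The eigenfunction martingales\<close>

locale spectral_bmc = bmc_function_class M S P \<nu> X F + spectral_class S P \<nu> F \<mu> \<alpha> J a R \<beta>
  for M :: "'w measure" and S :: "'s measure" and P \<nu> X F
    and \<mu> :: "'s measure" and \<alpha> :: real and J :: "'j set" and a R \<beta> +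
  assumes alpha_large: "1 / sqrt 2 < \<alpha>"
begin

text \<open>The growth rate \<open>sqrt 2\<close> of fluctuations over a generation divided by the
  rate \<open>2 * \<alpha>\<close> of the normalisation.\<close>

definition s :: real where "s = 1 / (sqrt 2 * \<alpha>)"

lemma s_pos: "0 < s" and s_less_1: "s < 1"
  using alpha_pos alpha_large by (simp_all add: s_def field_simps)

lemma s_power2: "s\<^sup>2 = 1 / (2 * \<alpha>\<^sup>2)"
  by (simp add: s_def power_divide power_mult_distrib)

lemma s_eq: "s = sqrt 2 / (2 * \<alpha>)"
  using alpha_pos by (simp add: s_def field_simps)

lemma sqrt_s: "0 < sqrt s" "sqrt s < 1" "(sqrt s)\<^sup>2 = s"
  using s_pos s_less_1 by auto

text \<open>The convergence criterion is applied with t = \<open>sqrt s\<close>: its rate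
  \<open>t ^ (4 * n)\<close> then matches the decay \<open>1 / (2 * \<alpha>^2) ^ n\<close> of the
  squared martingale increments.\<close>

lemma sqrt_s_power: "sqrt s ^ (4 * n) = (s ^ n)\<^sup>2"
proof -
  have "sqrt s ^ (4 * n) = ((sqrt s)\<^sup>2) ^ (n * 2)" by (simp flip: power_mult)
  also have "\<dots> = (s ^ n)\<^sup>2" by (simp only: sqrt_s(3) power_mult)
  finally show ?thesis .
qed

lemma generation_growth:
  assumes \<psi>: "\<psi> \<in> F" and nonneg: "\<And>x. x \<in> space S \<Longrightarrow> 0 \<le> \<psi> x"
  obtains K where "0 < K" "\<And>m. (\<Sum>u\<in>gen m. \<integral>\<^sup>+\<omega>. ennreal (\<psi> (X u \<omega>)) \<partial>M) \<le> ennreal (2 ^ m * K)"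
proof -
  obtain C where C: "\<And>n. (\<integral>x. (kernel_op Q ^^ n) \<psi> x \<partial>\<nu>) \<le> C"
    using bounded_iterated_means[OF \<psi> space_initial] by metis
  show ?thesis
  \<comment> \<open>The maximum with 1 makes the constant strictly positive, as later divisions by
    it require.\<close>
  proof (rule that[of "max C 1"])
    fix m
    show "(\<Sum>u\<in>gen m. \<integral>\<^sup>+\<omega>. ennreal (\<psi> (X u \<omega>)) \<partial>M) \<le> ennreal (2 ^ m * max C 1)"
      by (rule order_trans[OF sum_nn_integral_generation_le[OF \<psi> nonneg]])
        (auto intro!: ennreal_leI mult_left_mono order_trans[OF C])
  qed simp
qed

lemma eigen_martingale_eq: "eigen_martingale X (a j) (R j) f n \<omega> = gensum n (r j f) \<omega> / (2 * a j) ^ n"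
  by (simp add: eigen_martingale_def gensum_def power_int_minus power_int_of_nat divide_inverse mult.commute)

abbreviation Z :: "'j \<Rightarrow> ('s \<Rightarrow> real) \<Rightarrow> nat \<Rightarrow> 'w \<Rightarrow> complex" where
  "Z j f \<equiv> eigen_martingale X (a j) (R j) f"

abbreviation Minf :: "'j \<Rightarrow> ('s \<Rightarrow> real) \<Rightarrow> 'w \<Rightarrow> complex" where
  "Minf j f \<equiv> eigen_martingale_limit M X (a j) (R j) f"

context
  fixes g :: "'s \<Rightarrow> real" and K :: real and f :: "'s \<Rightarrow> real" and j :: 'j
  assumes g: "g \<in> F" and g_nonneg: "\<And>x. x \<in> space S \<Longrightarrow> 0 \<le> g x" and K: "0 < K"
    and growth: "\<And>m. (\<Sum>u\<in>gen m. \<integral>\<^sup>+\<omega>. ennreal (kernel_op Q (\<lambda>x. (g x)\<^sup>2) (X u \<omega>)) \<partial>M) \<le> ennreal (2 ^ m * K)"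
    and f: "f \<in> F" and j: "j \<in> J" and r_le: "\<And>x. x \<in> space S \<Longrightarrow> cmod (r j f x) \<le> 2 * g x"
begin

lemma measurable_Z: "Z j f n \<in> borel_measurable M"
  unfolding eigen_martingale_eq[abs_def] using measurable_gensum[OF r_V[OF j f]] by measurable

text \<open>By the eigenfunction property an increment is a one-step fluctuation divided by
  \<open>(2 * a j) ^ Suc n\<close>. The fluctuation bound with c = 2 gives
  \<open>32 * K * 2 ^ n\<close>; dividing by \<open>(4 * \<alpha>^2) ^ Suc n\<close> leaves
  \<open>32 * K * (s^2) ^ n\<close> and a surplus factor below 1.\<close>

lemma martingale_increment:
  "(\<integral>\<^sup>+\<omega>. ennreal ((cmod (Z j f (Suc n) \<omega> - Z j f n \<omega>))\<^sup>2) \<partial>M) \<le> ennreal (32 * K * sqrt s ^ (4 * n))"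
proof -
  let ?d = "\<lambda>\<omega>. gensum (Suc n) (r j f) \<omega> - 2 * gensum n (kernel_op Q (r j f)) \<omega>"
  note measurable_gensum[OF r_V[OF j f], measurable] measurable_gensum[OF V_Q[OF r_V[OF j f]], measurable]
  have "((2 * \<alpha>) ^ Suc n)\<^sup>2 = ((2 * \<alpha>)\<^sup>2) ^ Suc n"
    by (simp only: power_mult[symmetric] mult.commute)
  also have "(2 * \<alpha>)\<^sup>2 = 4 * \<alpha>\<^sup>2" by (simp add: power_mult_distrib)
  finally have square: "((2 * \<alpha>) ^ Suc n)\<^sup>2 = (4 * \<alpha>\<^sup>2) ^ Suc n" .
  have arith: "1 / x ^ Suc n * (8 * 2\<^sup>2 * K * 2 ^ n) = 32 * K * (2 / x) ^ n / x" for x :: real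
    by (simp add: power_divide)
  have a0: "a j \<noteq> 0" using norm_a[OF j] alpha_pos by auto
  have increment: "Z j f (Suc n) \<omega> - Z j f n \<omega> = ?d \<omega> / (2 * a j) ^ Suc n" if "\<omega> \<in> space M" for \<omega>
  proof -
    have "gensum n (kernel_op Q (r j f)) \<omega> = a j * gensum n (r j f) \<omega>"
      using eigenfunction[OF f j X_space[OF that]] by (simp add: gensum_def sum_distrib_left)
    then show ?thesis using a0 unfolding eigen_martingale_eq by (simp add: field_simps)
  qed
  have scaled: "(cmod (Z j f (Suc n) \<omega> - Z j f n \<omega>))\<^sup>2 = 1 / (4 * \<alpha>\<^sup>2) ^ Suc n * (cmod (?d \<omega>))\<^sup>2" if "\<omega> \<in> space M" for \<omega>
    unfolding increment[OF that] norm_divide norm_power norm_mult norm_a[OF j] norm_numeral power_divide square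
    by (simp only: times_divide_eq_left mult_1)
  have "(\<integral>\<^sup>+\<omega>. ennreal ((cmod (Z j f (Suc n) \<omega> - Z j f n \<omega>))\<^sup>2) \<partial>M)
      = (\<integral>\<^sup>+\<omega>. ennreal (1 / (4 * \<alpha>\<^sup>2) ^ Suc n) * ennreal ((cmod (?d \<omega>))\<^sup>2) \<partial>M)"
    by (intro nn_integral_cong) (simp only: scaled, rule ennreal_mult', simp)
  also have "\<dots> = ennreal (1 / (4 * \<alpha>\<^sup>2) ^ Suc n) * (\<integral>\<^sup>+\<omega>. ennreal ((cmod (?d \<omega>))\<^sup>2) \<partial>M)"
    by (rule nn_integral_cmult) measurable
  also have "\<dots> \<le> ennreal (1 / (4 * \<alpha>\<^sup>2) ^ Suc n) * ennreal (8 * 2\<^sup>2 * K * 2 ^ n)"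
    by (intro mult_left_mono second_moment_increment[OF g g_nonneg K growth r_V[OF j f] r_le] zero_le)
  also have "\<dots> = ennreal (1 / (4 * \<alpha>\<^sup>2) ^ Suc n * (8 * 2\<^sup>2 * K * 2 ^ n))"
    by (rule ennreal_mult'[symmetric]) simp
  also have "1 / (4 * \<alpha>\<^sup>2) ^ Suc n * (8 * 2\<^sup>2 * K * 2 ^ n) = 32 * K * (2 / (4 * \<alpha>\<^sup>2)) ^ n / (4 * \<alpha>\<^sup>2)"
    by (rule arith)
  also have "2 / (4 * \<alpha>\<^sup>2) = s\<^sup>2" by (simp add: s_power2)
  also have "32 * K * s\<^sup>2 ^ n / (4 * \<alpha>\<^sup>2) \<le> 32 * K * s\<^sup>2 ^ n"
  proof -
    have "1 / (2 * \<alpha>\<^sup>2) < 1" using s_pos s_less_1 by (simp flip: s_power2 add: power_less_one_iff)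
    then have "1 \<le> 4 * \<alpha>\<^sup>2" using alpha_pos by (simp add: field_simps)
    then have "32 * K * s\<^sup>2 ^ n / (4 * \<alpha>\<^sup>2) \<le> 32 * K * s\<^sup>2 ^ n / 1"
      using K by (intro divide_left_mono) auto
    then show ?thesis by (simp only: div_by_1)
  qed
  also have "s\<^sup>2 ^ n = sqrt s ^ (4 * n)"
    unfolding sqrt_s_power by (simp add: power_mult[symmetric] mult.commute)
  finally show ?thesis by (simp add: ennreal_leI)
qed

lemma Z_0_bound: "\<omega> \<in> space M \<Longrightarrow> cmod (Z j f 0 \<omega>) \<le> 2 * g (X [] \<omega>)"
  by (simp add: eigen_martingale_eq gensum_0 r_le X_space)

lemma L2_distance:
  assumes "AE \<omega> in M. (\<lambda>n. Z j f n \<omega>) \<longlonglongrightarrow> Y \<omega>"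
  shows "(\<integral>\<^sup>+\<omega>. ennreal ((cmod (Z j f n \<omega> - Y \<omega>))\<^sup>2) \<partial>M) \<le> ennreal (32 * K * sqrt s ^ (4 * n) / (1 - s)\<^sup>2)"
  using geometric_increments_L2_bound[OF measurable_Z sqrt_s(1,2) _ martingale_increment assms, of n] K
  unfolding sqrt_s(3) by simp

text \<open>The version picked by \<open>SOME\<close> is usable only once a witness exists. The
  pointwise \<open>lim\<close> is one: it is measurable, and its arbitrary values at points of
  divergence affect a null set.\<close>

lemma eigen_martingale_limit:
  "as_L2_limit M (Z j f) (eigen_martingale_limit M X (a j) (R j) f)"
proof -
  note measurable_Z [measurable]
  have conv: "AE \<omega> in M. convergent (\<lambda>n. Z j f n \<omega>)"
    using geometric_increments_AE_convergent[OF measurable_Z sqrt_s(1,2) _ martingale_increment] K by simp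
  define Y where "Y \<omega> = lim (\<lambda>n. Z j f n \<omega>)" for \<omega>
  have lim: "AE \<omega> in M. (\<lambda>n. Z j f n \<omega>) \<longlonglongrightarrow> Y \<omega>"
    using conv by eventually_elim (simp add: Y_def convergent_LIMSEQ_iff)
  have Y [measurable]: "Y \<in> borel_measurable M"
    unfolding Y_def[abs_def] by (rule borel_measurable_lim_metric) measurable
  note F_measurable[OF F_square[OF g], measurable]
  have "as_L2_limit M (Z j f) Y"
    unfolding as_L2_limit_def
  proof (intro conjI Y lim)
    have "(\<lambda>n. ennreal (32 * K * (sqrt s ^ 4) ^ n / (1 - s)\<^sup>2)) \<longlonglongrightarrow> ennreal (32 * K * 0 / (1 - s)\<^sup>2)"
      using sqrt_s s_less_1
      by (intro tendsto_ennrealI tendsto_intros LIMSEQ_realpow_zero) (auto simp: power_less_one_iff)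
    then have up: "(\<lambda>n. ennreal (32 * K * (sqrt s ^ 4) ^ n / (1 - s)\<^sup>2)) \<longlonglongrightarrow> 0"
      by simp
    show "(\<lambda>n. \<integral>\<^sup>+\<omega>. ennreal ((cmod (Z j f n \<omega> - Y \<omega>))\<^sup>2) \<partial>M) \<longlonglongrightarrow> 0"
      by (rule tendsto_sandwich[OF _ _ tendsto_const up])
        (use L2_distance[OF lim] in \<open>auto simp: power_mult\<close>)
    \<comment> \<open>Square integrability is obtained by comparison with the initial value,
      dominated by \<open>2 * g\<close> at the root; the square of \<open>g\<close> lies in
      \<open>F\<close> and so is integrable under the initial law.\<close>
    have "(\<integral>\<^sup>+\<omega>. ennreal ((cmod (Y \<omega>))\<^sup>2) \<partial>M)
        \<le> (\<integral>\<^sup>+\<omega>. 2 * ennreal ((cmod (Z j f 0 \<omega> - Y \<omega>))\<^sup>2) + 8 * ennreal ((g (X [] \<omega>))\<^sup>2) \<partial>M)"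
    proof (rule nn_integral_mono)
      fix \<omega> assume \<omega>: "\<omega> \<in> space M"
      have "cmod (Y \<omega>) \<le> cmod (Z j f 0 \<omega> - Y \<omega>) + 2 * g (X [] \<omega>)"
        using Z_0_bound[OF \<omega>] norm_triangle_sub[of "Y \<omega>" "Z j f 0 \<omega>"] by (simp add: norm_minus_commute)
      then have "(cmod (Y \<omega>))\<^sup>2 \<le> (cmod (Z j f 0 \<omega> - Y \<omega>) + 2 * g (X [] \<omega>))\<^sup>2"
        by (rule power_mono) simp
      also have "\<dots> \<le> 2 * (cmod (Z j f 0 \<omega> - Y \<omega>))\<^sup>2 + 8 * (g (X [] \<omega>))\<^sup>2"
        using sum_squares_ge_zero[of "cmod (Z j f 0 \<omega> - Y \<omega>) - 2 * g (X [] \<omega>)" 0]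
        by (simp add: power2_eq_square algebra_simps)
      finally have "ennreal ((cmod (Y \<omega>))\<^sup>2) \<le> ennreal (2 * (cmod (Z j f 0 \<omega> - Y \<omega>))\<^sup>2 + 8 * (g (X [] \<omega>))\<^sup>2)"
        by (rule ennreal_leI)
      then show "ennreal ((cmod (Y \<omega>))\<^sup>2) \<le> 2 * ennreal ((cmod (Z j f 0 \<omega> - Y \<omega>))\<^sup>2) + 8 * ennreal ((g (X [] \<omega>))\<^sup>2)"
        by (simp add: ennreal_mult')
    qed
    also have "\<dots> = 2 * (\<integral>\<^sup>+\<omega>. ennreal ((cmod (Z j f 0 \<omega> - Y \<omega>))\<^sup>2) \<partial>M) + 8 * (\<integral>\<^sup>+\<omega>. ennreal ((g (X [] \<omega>))\<^sup>2) \<partial>M)"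
      by (simp add: nn_integral_add nn_integral_cmult)
    also have "\<dots> \<le> 2 * ennreal (32 * K / (1 - s)\<^sup>2) + 8 * ennreal (\<integral>x. (g x)\<^sup>2 \<partial>\<nu>)"
      using L2_distance[OF lim, of 0] nn_integral_root[OF F_square[OF g]] by (intro add_mono mult_left_mono) auto
    also have "\<dots> < \<infinity>" by (simp add: ennreal_mult_less_top)
    finally show "integrable M (\<lambda>\<omega>. (cmod (Y \<omega>))\<^sup>2)"
      by (intro integrableI_nonneg) auto
  qed
  then show ?thesis unfolding eigen_martingale_limit_def
    by (rule someI[where P = "as_L2_limit M (Z j f)"])
qed

lemma measurable_Minf: "Minf j f \<in> borel_measurable M"
  and AE_Minf: "AE \<omega> in M. (\<lambda>n. Z j f n \<omega>) \<longlonglongrightarrow> Minf j f \<omega>"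
  using eigen_martingale_limit by (simp_all add: as_L2_limit_def)

lemma L1_distance:
  "(\<integral>\<^sup>+\<omega>. ennreal (cmod (Z j f n \<omega> - Minf j f \<omega>)) \<partial>M) \<le> ennreal (sqrt (32 * K) / (1 - s) * s ^ n)"
proof (rule nn_integral_norm_le_of_square)
  have "32 * K * sqrt s ^ (4 * n) / (1 - s)\<^sup>2 = (sqrt (32 * K) / (1 - s) * s ^ n)\<^sup>2"
    using K by (simp add: power_mult_distrib power_divide sqrt_s_power)
  then show "(\<integral>\<^sup>+\<omega>. ennreal ((cmod (Z j f n \<omega> - Minf j f \<omega>))\<^sup>2) \<partial>M) \<le> ennreal ((sqrt (32 * K) / (1 - s) * s ^ n)\<^sup>2)"
    using L2_distance[OF AE_Minf, of n] by simp
  show "(\<lambda>\<omega>. Z j f n \<omega> - Minf j f \<omega>) \<in> borel_measurable M"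
    by (intro borel_measurable_diff measurable_Z measurable_Minf)
  show "0 < sqrt (32 * K) / (1 - s) * s ^ n" using K s_pos s_less_1 by simp
qed

text \<open>Comparison with the initial value gives a constant depending on \<open>g\<close> and
  \<open>K\<close> but not on \<open>f\<close> or \<open>j\<close>, as the tail of the limit series
  requires.\<close>

lemma L1_Minf:
  "(\<integral>\<^sup>+\<omega>. ennreal (cmod (Minf j f \<omega>)) \<partial>M) \<le> ennreal (sqrt (32 * K) / (1 - s) + 2 * (\<integral>x. g x \<partial>\<nu>))"
proof -
  note measurable_Z [measurable] measurable_Minf [measurable]
  note F_measurable[OF g, measurable]
  have G: "0 \<le> (\<integral>x. g x \<partial>\<nu>)" using g_nonneg by (intro integral_nonneg_AE AE_I2) (simp add: space_initial)
  have "(\<integral>\<^sup>+\<omega>. ennreal (cmod (Minf j f \<omega>)) \<partial>M)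
      \<le> (\<integral>\<^sup>+\<omega>. ennreal (cmod (Z j f 0 \<omega> - Minf j f \<omega>)) + 2 * ennreal (g (X [] \<omega>)) \<partial>M)"
  proof (rule nn_integral_mono)
    fix \<omega> assume \<omega>: "\<omega> \<in> space M"
    have "cmod (Minf j f \<omega>) \<le> cmod (Z j f 0 \<omega> - Minf j f \<omega>) + 2 * g (X [] \<omega>)"
      using Z_0_bound[OF \<omega>] norm_triangle_sub[of "Minf j f \<omega>" "Z j f 0 \<omega>"] by (simp add: norm_minus_commute)
    then have "ennreal (cmod (Minf j f \<omega>)) \<le> ennreal (cmod (Z j f 0 \<omega> - Minf j f \<omega>) + 2 * g (X [] \<omega>))"
      by (rule ennreal_leI)
    then show "ennreal (cmod (Minf j f \<omega>)) \<le> ennreal (cmod (Z j f 0 \<omega> - Minf j f \<omega>)) + 2 * ennreal (g (X [] \<omega>))"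
      using g_nonneg[OF X_space[OF \<omega>]] by (simp add: ennreal_mult')
  qed
  also have "\<dots> = (\<integral>\<^sup>+\<omega>. ennreal (cmod (Z j f 0 \<omega> - Minf j f \<omega>)) \<partial>M) + 2 * (\<integral>\<^sup>+\<omega>. ennreal (g (X [] \<omega>)) \<partial>M)"
    by (simp add: nn_integral_add nn_integral_cmult)
  also have "\<dots> \<le> ennreal (sqrt (32 * K) / (1 - s)) + 2 * ennreal (\<integral>x. g x \<partial>\<nu>)"
    using L1_distance[of 0] nn_integral_root[OF g g_nonneg] by (intro add_mono mult_left_mono) auto
  also have "\<dots> = ennreal (sqrt (32 * K) / (1 - s) + 2 * (\<integral>x. g x \<partial>\<nu>))"
    using G K s_less_1 by (simp add: ennreal_mult')
  finally show ?thesis .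
qed

end

end

section \<open>Approximation of the root sum\<close>

context spectral_bmc
begin

text \<open>After division by \<open>(2 * \<alpha>) ^ m\<close>, summand i becomes
  \<open>\<beta> i * s ^ (m - i)\<close> times \<open>B / sqrt 2\<close>, and the leading term is
  \<open>G\<close> times the k = 0 term of the convolution.\<close>

lemma convolution_bound:
  assumes G: "0 \<le> G" and B: "0 \<le> B"
  shows "2 ^ m * (\<beta> m * \<alpha> ^ m) * G + (\<Sum>i<m. 2 ^ i * sqrt 2 ^ (m - Suc i) * (\<beta> i * \<alpha> ^ i) * B)
    \<le> (2 * \<alpha>) ^ m * ((G + B) * (\<Sum>k\<le>m. s ^ k * \<beta> (m - k)))"
proof -
  let ?C = "\<Sum>k\<le>m. s ^ k * \<beta> (m - k)"
  have pos: "0 \<le> s ^ k * \<beta> i" for k i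
    using s_pos beta_pos by (intro mult_nonneg_nonneg) (auto intro: less_imp_le)
  have rev: "?C = (\<Sum>i\<le>m. s ^ (m - i) * \<beta> i)"
    unfolding atMost_atLeast0 by (subst sum.atLeastAtMost_rev) (auto intro!: sum.cong)
  have "\<beta> m = s ^ 0 * \<beta> (m - 0)" by simp
  also have "\<dots> \<le> ?C" by (intro member_le_sum[of _ _ "\<lambda>k. s ^ k * \<beta> (m - k)"] pos) auto
  finally have "(2 * \<alpha>) ^ m * (G * \<beta> m) \<le> (2 * \<alpha>) ^ m * (G * ?C)"
    using G alpha_pos by (intro mult_left_mono) auto
  moreover have "(\<Sum>i<m. 2 ^ i * sqrt 2 ^ (m - Suc i) * (\<beta> i * \<alpha> ^ i) * B) \<le> (2 * \<alpha>) ^ m * (B * ?C)"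
  proof -
    have "2 ^ i * sqrt 2 ^ (m - Suc i) * (\<beta> i * \<alpha> ^ i) * B \<le> (2 * \<alpha>) ^ m * (B * (s ^ (m - i) * \<beta> i))"
      if "i < m" for i
    proof -
      have split: "(2 * \<alpha>) ^ m = (2 * \<alpha>) ^ i * (2 * \<alpha>) ^ (m - i)"
        using that power_add[of "2 * \<alpha>" i "m - i"] by simp
      have cancel: "(2 * \<alpha>) ^ (m - i) * s ^ (m - i) = sqrt 2 ^ (m - i)"
        unfolding power_mult_distrib[symmetric] using alpha_pos by (simp add: s_eq)
      have "(2 * \<alpha>) ^ m * (B * (s ^ (m - i) * \<beta> i)) = (2 * \<alpha>) ^ i * (B * \<beta> i) * ((2 * \<alpha>) ^ (m - i) * s ^ (m - i))"
        unfolding split by (simp only: mult_ac)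
      also have "\<dots> = (2 * \<alpha>) ^ i * (B * \<beta> i) * sqrt 2 ^ (m - i)"
        unfolding cancel ..
      finally have rhs: "(2 * \<alpha>) ^ m * (B * (s ^ (m - i) * \<beta> i)) = (2 * \<alpha>) ^ i * (B * \<beta> i) * sqrt 2 ^ (m - i)" .
      have "2 ^ i * sqrt 2 ^ (m - Suc i) * (\<beta> i * \<alpha> ^ i) * B = (2 * \<alpha>) ^ i * (B * \<beta> i) * sqrt 2 ^ (m - Suc i)"
        by (simp only: power_mult_distrib mult_ac)
      \<comment> \<open>Raising the exponent by one gives away the factor \<open>1 / sqrt 2\<close>,
        so that the powers of \<open>s\<close> match exactly.\<close>
      also have "\<dots> \<le> (2 * \<alpha>) ^ i * (B * \<beta> i) * sqrt 2 ^ (m - i)"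
        using alpha_pos B beta_pos[of i] by (intro mult_left_mono power_increasing) auto
      finally show ?thesis unfolding rhs .
    qed
    then have "(\<Sum>i<m. 2 ^ i * sqrt 2 ^ (m - Suc i) * (\<beta> i * \<alpha> ^ i) * B)
        \<le> (\<Sum>i<m. (2 * \<alpha>) ^ m * (B * (s ^ (m - i) * \<beta> i)))"
      by (intro sum_mono) auto
    also have "\<dots> \<le> (\<Sum>i\<le>m. (2 * \<alpha>) ^ m * (B * (s ^ (m - i) * \<beta> i)))"
      using alpha_pos B less_imp_le[OF beta_pos] by (intro sum_mono2) auto
    also have "\<dots> = (2 * \<alpha>) ^ m * (B * ?C)"
      by (simp add: rev sum_distrib_left)
    finally show ?thesis .
  qed
  ultimately show ?thesis by (simp add: algebra_simps power_mult_distrib)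
qed

context
  fixes f :: "nat \<Rightarrow> 's \<times> 's \<times> 's \<Rightarrow> real" and g :: "'s \<Rightarrow> real"
  assumes f [measurable]: "\<And>l. f l \<in> borel_measurable T"
    and wd: "\<And>l. triple_op_well_defined S P (f l)"
    and wd2: "\<And>l. triple_op_well_defined S P (\<lambda>t. (f l t)\<^sup>2)"
    and usb: "uniform_spectral_bounds S Q F \<mu> \<alpha> J R \<beta> (\<lambda>l. triple_op P (f l)) g"
    and usb2: "uniform_spectral_bounds S Q F \<mu> \<alpha> J R \<beta> (\<lambda>l. triple_op P (\<lambda>t. (f l t)\<^sup>2)) g"
begin

abbreviation h where "h l \<equiv> triple_op P (f l)"

lemma g_in_F: "g \<in> F" and g_nonneg: "x \<in> space S \<Longrightarrow> 0 \<le> g x" and h_in_F: "h l \<in> F"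
  using usb_F[OF usb] usb_nonneg[OF usb] by auto

lemma mean_g_nonneg: "0 \<le> (\<integral>x. g x \<partial>\<nu>)"
  using g_nonneg by (intro integral_nonneg_AE AE_I2) (simp add: space_initial)

text \<open>Uniformity in l comes from the instance n = 0 of the bounds for the conditional second
  moments: they lie below \<open>g\<close>, whose generation sums have mean of order
  \<open>2 ^ m\<close>.\<close>

lemma compensated_sum_L1:
  obtains c where "0 < c" "\<And>m l. (\<integral>\<^sup>+\<omega>. ennreal (norm (\<Sum>u\<in>gen m. f l (triangle X u \<omega>) - h l (X u \<omega>))) \<partial>M)
    \<le> ennreal (sqrt 2 ^ m * c)"
proof -
  obtain K where K: "0 < K" "\<And>m. (\<Sum>u\<in>gen m. \<integral>\<^sup>+\<omega>. ennreal (g (X u \<omega>)) \<partial>M) \<le> ennreal (2 ^ m * K)"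
    by (rule generation_growth[OF g_in_F g_nonneg]) (assumption, rule that)
  show ?thesis
  proof (rule that[of "sqrt K"])
    fix m l
    show "(\<integral>\<^sup>+\<omega>. ennreal (norm (\<Sum>u\<in>gen m. f l (triangle X u \<omega>) - h l (X u \<omega>))) \<partial>M)
      \<le> ennreal (sqrt 2 ^ m * sqrt K)"
    proof (rule nn_integral_norm_le_of_square)
      have "(\<integral>\<^sup>+\<omega>. ennreal ((\<Sum>u\<in>gen m. f l (triangle X u \<omega>) - h l (X u \<omega>))\<^sup>2) \<partial>M)
          \<le> (\<Sum>u\<in>gen m. \<integral>\<^sup>+\<omega>. ennreal (triple_op P (\<lambda>t. (f l t)\<^sup>2) (X u \<omega>)) \<partial>M)"
        using wd[of l] wd2[of l] by (intro second_moment_le f) (auto simp: triple_op_well_defined_def)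
      also have "\<dots> \<le> (\<Sum>u\<in>gen m. \<integral>\<^sup>+\<omega>. ennreal (g (X u \<omega>)) \<partial>M)"
      proof (intro sum_mono nn_integral_mono ennreal_leI)
        fix u \<omega> assume "\<omega> \<in> space M"
        from usb_bound[OF usb2 X_space[OF this], of 0 l u]
        show "triple_op P (\<lambda>t. (f l t)\<^sup>2) (X u \<omega>) \<le> g (X u \<omega>)" by simp
      qed
      also have "\<dots> \<le> ennreal (2 ^ m * K)" by (rule K)
      also have "2 ^ m * K = (sqrt 2 ^ m * sqrt K)\<^sup>2"
        using K by (simp add: power_mult_distrib power_mult[symmetric] mult.commute[of m]) (simp add: power_mult)
      finally show "(\<integral>\<^sup>+\<omega>. ennreal ((norm (\<Sum>u\<in>gen m. f l (triangle X u \<omega>) - h l (X u \<omega>)))\<^sup>2) \<partial>M)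
          \<le> ennreal ((sqrt 2 ^ m * sqrt K)\<^sup>2)" by simp
    qed (use K in simp_all)
  qed (use K in simp)
qed

text \<open>Since \<open>2 * a j\<close> equals \<open>2 * \<alpha>\<close> times
  \<open>\<theta> j\<close>, the rotated martingale \<open>\<theta> j ^ m * Z j (h l) m\<close> is
  the eigenfunction sum over \<open>(2 * \<alpha>) ^ m\<close>. These sums restore exactly what
  spectral centring subtracts, so the identity has no error term.\<close>

lemma generation_decomposition:
  assumes \<omega>: "\<omega> \<in> space M"
  shows "complex_of_real (tree_sum X (gen m) (triple_centered P \<mu> (f l)) \<omega>) / complex_of_real (2 * \<alpha>) ^ m
      - (\<Sum>j\<in>J. \<theta> j ^ m * Minf j (h l) \<omega>)
    = 1 / complex_of_real (2 * \<alpha>) ^ m * complex_of_real (\<Sum>u\<in>gen m. f l (triangle X u \<omega>) - h l (X u \<omega>))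
      + (1 / complex_of_real (2 * \<alpha>) ^ m * gensum m (spectrally_centered \<mu> J R (h l)) \<omega>
      + (\<Sum>j\<in>J. \<theta> j ^ m * (Z j (h l) m \<omega> - Minf j (h l) \<omega>)))"
proof -
  let ?q = "complex_of_real (2 * \<alpha>) ^ m"
  have cancel: "x * (y / (z * x)) = y / z" if "x \<noteq> 0" for x y z :: complex
    using that by simp
  have collect: "(x + (y + z)) / w - v = 1 / w * x + (1 / w * y + (z / w - v))" for x y z w v :: complex
    by (simp add: add_divide_distrib)
  have "\<theta> j ^ m * Z j (h l) m \<omega> = gensum m (r j (h l)) \<omega> / ?q" if j: "j \<in> J" for j
  proof -
    have nonzero: "\<theta> j ^ m \<noteq> 0" using norm_theta[OF j] by auto
    have "2 * a j = complex_of_real (2 * \<alpha>) * \<theta> j" by (simp add: a_eq)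
    then show ?thesis
      by (simp only: eigen_martingale_eq power_mult_distrib cancel[OF nonzero])
  qed
  then have martingales: "(\<Sum>j\<in>J. \<theta> j ^ m * Z j (h l) m \<omega>)
      = (\<Sum>j\<in>J. gensum m (r j (h l)) \<omega>) / ?q"
    by (simp add: sum_divide_distrib)
  have "complex_of_real (tree_sum X (gen m) (triple_centered P \<mu> (f l)) \<omega>)
    = complex_of_real (\<Sum>u\<in>gen m. f l (triangle X u \<omega>) - h l (X u \<omega>))
      + complex_of_real (\<Sum>u\<in>gen m. mean_centered \<mu> (h l) (X u \<omega>))"
    unfolding of_real_add[symmetric] sum.distrib[symmetric]
    by (simp add: tree_sum_def triple_centered_def mean_centered_def)
  moreover have "gensum m (spectrally_centered \<mu> J R (h l)) \<omega>
      = complex_of_real (\<Sum>u\<in>gen m. mean_centered \<mu> (h l) (X u \<omega>)) - (\<Sum>j\<in>J. gensum m (r j (h l)) \<omega>)"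
    unfolding gensum_def spectrally_centered_def sum_subtractf by (subst (2) sum.swap) simp
  ultimately have total: "complex_of_real (tree_sum X (gen m) (triple_centered P \<mu> (f l)) \<omega>)
    = complex_of_real (\<Sum>u\<in>gen m. f l (triangle X u \<omega>) - h l (X u \<omega>))
      + (gensum m (spectrally_centered \<mu> J R (h l)) \<omega> + (\<Sum>j\<in>J. gensum m (r j (h l)) \<omega>))"
    by (simp only: diff_add_cancel)
  show ?thesis
    unfolding total right_diff_distrib sum_subtractf martingales by (rule collect)
qed

lemma compensated_measurable:
  "(\<lambda>\<omega>. complex_of_real (\<Sum>u\<in>gen m. f l (triangle X u \<omega>) - h l (X u \<omega>))) \<in> borel_measurable M"
proof -
  have "(\<lambda>\<omega>. h l (X u \<omega>)) \<in> borel_measurable M" for u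
    by (rule measurable_compose[OF measurable_X F_measurable[OF h_in_F]])
  moreover have "(\<lambda>\<omega>. f l (triangle X u \<omega>)) \<in> borel_measurable M" for u
    by (rule measurable_compose[OF measurable_triangle f])
  ultimately show ?thesis
    by (intro measurable_compose[OF _ borel_measurable_of_real] borel_measurable_sum borel_measurable_diff)
qed

text \<open>The error sequence does not depend on l because every estimate passes through
  \<open>g\<close> and constants derived from it.\<close>

lemma generation_limit:
  obtains e C where "\<And>m. 0 \<le> e m" "e \<longlonglongrightarrow> 0" "0 \<le> C"
    "\<And>m l. (\<integral>\<^sup>+\<omega>. ennreal (cmod (complex_of_real (tree_sum X (gen m) (triple_centered P \<mu> (f l)) \<omega>) / complex_of_real (2 * \<alpha>) ^ m
      - (\<Sum>j\<in>J. \<theta> j ^ m * Minf j (h l) \<omega>))) \<partial>M) \<le> ennreal (e m)"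
    "\<And>j l. j \<in> J \<Longrightarrow> (\<integral>\<^sup>+\<omega>. ennreal (cmod (Minf j (h l) \<omega>)) \<partial>M) \<le> ennreal C"
    "\<And>j l. j \<in> J \<Longrightarrow> Minf j (h l) \<in> borel_measurable M"
proof -
  have Qg2: "kernel_op Q (\<lambda>x. (g x)\<^sup>2) \<in> F" by (intro F_Q F_square g_in_F)
  have Qg2_nonneg: "0 \<le> kernel_op Q (\<lambda>x. (g x)\<^sup>2) x" if "x \<in> space S" for x
    using Q_funpow_nonneg[OF F_square[OF g_in_F] zero_le_power2 that, of 1] by simp
  obtain K where K: "0 < K" and growth: "\<And>m. (\<Sum>u\<in>gen m. \<integral>\<^sup>+\<omega>. ennreal (kernel_op Q (\<lambda>x. (g x)\<^sup>2) (X u \<omega>)) \<partial>M) \<le> ennreal (2 ^ m * K)"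
    by (rule generation_growth[OF Qg2 Qg2_nonneg]) (assumption, rule that)
  obtain c where c: "0 < c" and A: "\<And>m l. (\<integral>\<^sup>+\<omega>. ennreal (norm (\<Sum>u\<in>gen m. f l (triangle X u \<omega>) - h l (X u \<omega>))) \<partial>M)
    \<le> ennreal (sqrt 2 ^ m * c)"
    by (rule compensated_sum_L1) (rule that)
  let ?G = "\<integral>x. g x \<partial>\<nu>" and ?B = "sqrt (8 * K)" and ?D = "sqrt (32 * K) / (1 - s)"
  let ?C = "\<lambda>m. \<Sum>k\<le>m. s ^ k * \<beta> (m - k)"
  \<comment> \<open>In order: the fluctuations inside triangles, the spectrally centred sum, and the
    distances of the \<open>card J\<close> martingales to their limits.\<close>
  let ?e = "\<lambda>m. c * s ^ m + ((?G + ?B) * ?C m + real (card J) * (?D * s ^ m))"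
  have C_nonneg: "0 \<le> ?C m" for m
    using s_pos beta_pos by (intro sum_nonneg mult_nonneg_nonneg) (auto intro: less_imp_le)
  have D: "0 \<le> ?D" using K s_less_1 by simp
  have B: "0 \<le> ?B" using K by simp
  have q: "0 < (2 * \<alpha>) ^ m" "cmod (1 / complex_of_real (2 * \<alpha>) ^ m) = 1 / (2 * \<alpha>) ^ m" for m
    using alpha_pos by (simp_all add: norm_divide norm_power norm_mult)
  show ?thesis
  proof (rule that[of ?e "?D + 2 * ?G"])
    show "0 \<le> ?e m" for m
      using c s_pos mean_g_nonneg B C_nonneg D by (intro add_nonneg_nonneg mult_nonneg_nonneg) auto
    have s0: "(\<lambda>m. s ^ m) \<longlonglongrightarrow> 0" using s_pos s_less_1 by (intro LIMSEQ_realpow_zero) auto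
    have "?e \<longlonglongrightarrow> c * 0 + ((?G + ?B) * 0 + real (card J) * (?D * 0))"
      using s_pos s_less_1
      by (intro tendsto_add tendsto_mult_left s0 geometric_convolution_tendsto_zero beta_tendsto) auto
    then show "?e \<longlonglongrightarrow> 0" by simp
    show "0 \<le> ?D + 2 * ?G" using D mean_g_nonneg by simp
    show "(\<integral>\<^sup>+\<omega>. ennreal (cmod (Minf j (h l) \<omega>)) \<partial>M) \<le> ennreal (?D + 2 * ?G)" if "j \<in> J" for j l
      by (rule L1_Minf[OF g_in_F g_nonneg K growth h_in_F that eigenprojection_bound[OF usb that]])
    show Minf_meas: "Minf j (h l) \<in> borel_measurable M" if "j \<in> J" for j l
      by (rule measurable_Minf[OF g_in_F g_nonneg K growth h_in_F that eigenprojection_bound[OF usb that]])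
    fix m l
    have gensum_meas: "gensum m (spectrally_centered \<mu> J R (h l)) \<in> borel_measurable M"
      by (rule measurable_gensum[OF spectrally_centered_V[OF usb]])
    have scaled: "(\<lambda>\<omega>. 1 / complex_of_real (2 * \<alpha>) ^ m * \<phi> \<omega>) \<in> borel_measurable M"
      if "\<phi> \<in> borel_measurable M" for \<phi> :: "'w \<Rightarrow> complex"
      by (rule borel_measurable_times[OF borel_measurable_const that])
    have Z_meas: "Z j (h l) m \<in> borel_measurable M" if "j \<in> J" for j
      by (rule measurable_Z[OF g_in_F g_nonneg K growth h_in_F that eigenprojection_bound[OF usb that]])
    have "0 \<le> 1 / (2 * \<alpha>) ^ m * (sqrt 2 ^ m * c)"
      using c by (intro mult_nonneg_nonneg divide_nonneg_nonneg less_imp_le[OF q(1)]) auto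
    moreover have "0 \<le> 1 / (2 * \<alpha>) ^ m * ((2 * \<alpha>) ^ m * ((?G + ?B) * ?C m))"
      by (intro mult_nonneg_nonneg divide_nonneg_nonneg less_imp_le[OF q(1)] add_nonneg_nonneg
          mean_g_nonneg B C_nonneg zero_le_one)
    moreover have "0 \<le> (\<Sum>j\<in>J. 1 * (?D * s ^ m))"
      unfolding mult_1 by (intro sum_nonneg mult_nonneg_nonneg D zero_le_power less_imp_le[OF s_pos])
    ultimately have nonneg: "0 \<le> 1 / (2 * \<alpha>) ^ m * (sqrt 2 ^ m * c)"
      "0 \<le> 1 / (2 * \<alpha>) ^ m * ((2 * \<alpha>) ^ m * ((?G + ?B) * ?C m))" "0 \<le> (\<Sum>j\<in>J. 1 * (?D * s ^ m))" .
    have "(\<integral>\<^sup>+\<omega>. ennreal (cmod (complex_of_real (tree_sum X (gen m) (triple_centered P \<mu> (f l)) \<omega>) / complex_of_real (2 * \<alpha>) ^ m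
        - (\<Sum>j\<in>J. \<theta> j ^ m * Minf j (h l) \<omega>))) \<partial>M)
      = (\<integral>\<^sup>+\<omega>. ennreal (cmod (1 / complex_of_real (2 * \<alpha>) ^ m * complex_of_real (\<Sum>u\<in>gen m. f l (triangle X u \<omega>) - h l (X u \<omega>))
      + (1 / complex_of_real (2 * \<alpha>) ^ m * gensum m (spectrally_centered \<mu> J R (h l)) \<omega>
      + (\<Sum>j\<in>J. \<theta> j ^ m * (Z j (h l) m \<omega> - Minf j (h l) \<omega>))))) \<partial>M)"
      by (intro nn_integral_cong) (simp only: generation_decomposition)
    also have "\<dots> \<le> ennreal (1 / (2 * \<alpha>) ^ m * (sqrt 2 ^ m * c) + (1 / (2 * \<alpha>) ^ m * ((2 * \<alpha>) ^ m * ((?G + ?B) * ?C m))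
        + (\<Sum>j\<in>J. 1 * (?D * s ^ m))))"
    proof (intro nn_integral_norm_add_le)
      show "(\<integral>\<^sup>+\<omega>. ennreal (cmod (1 / complex_of_real (2 * \<alpha>) ^ m * complex_of_real (\<Sum>u\<in>gen m. f l (triangle X u \<omega>) - h l (X u \<omega>)))) \<partial>M)
        \<le> ennreal (1 / (2 * \<alpha>) ^ m * (sqrt 2 ^ m * c))"
        unfolding q(2)[symmetric]
      proof (intro nn_integral_norm_scale_le)
        show "(\<integral>\<^sup>+\<omega>. ennreal (cmod (complex_of_real (\<Sum>u\<in>gen m. f l (triangle X u \<omega>) - h l (X u \<omega>)))) \<partial>M)
          \<le> ennreal (sqrt 2 ^ m * c)"
          using A[of l m] by (simp only: norm_of_real real_norm_def)
      qed (rule compensated_measurable)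
      show "(\<integral>\<^sup>+\<omega>. ennreal (cmod (1 / complex_of_real (2 * \<alpha>) ^ m * gensum m (spectrally_centered \<mu> J R (h l)) \<omega>)) \<partial>M)
        \<le> ennreal (1 / (2 * \<alpha>) ^ m * ((2 * \<alpha>) ^ m * ((?G + ?B) * ?C m)))"
        unfolding q(2)[symmetric]
      proof (intro nn_integral_norm_scale_le)
        have "(\<integral>\<^sup>+\<omega>. ennreal (cmod (gensum m (spectrally_centered \<mu> J R (h l)) \<omega>)) \<partial>M)
          \<le> ennreal (2 ^ m * (\<beta> m * \<alpha> ^ m) * ?G + (\<Sum>i<m. 2 ^ i * sqrt 2 ^ (m - Suc i) * (\<beta> i * \<alpha> ^ i) * ?B))"
          using usb_spectral[OF usb] alpha_pos beta_pos
          by (intro first_moment_gensum[OF g_in_F g_nonneg K growth spectrally_centered_V[OF usb]]) auto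
        also have "\<dots> \<le> ennreal ((2 * \<alpha>) ^ m * ((?G + ?B) * ?C m))"
          by (intro ennreal_leI convolution_bound mean_g_nonneg B)
        finally show "(\<integral>\<^sup>+\<omega>. ennreal (cmod (gensum m (spectrally_centered \<mu> J R (h l)) \<omega>)) \<partial>M)
          \<le> ennreal ((2 * \<alpha>) ^ m * ((?G + ?B) * ?C m))" .
      qed (rule gensum_meas)
      show "(\<integral>\<^sup>+\<omega>. ennreal (cmod (\<Sum>j\<in>J. \<theta> j ^ m * (Z j (h l) m \<omega> - Minf j (h l) \<omega>))) \<partial>M)
        \<le> ennreal (\<Sum>j\<in>J. 1 * (?D * s ^ m))"
      proof (intro nn_integral_norm_sum_le finite_J)
        fix j assume j: "j \<in> J"
        show "(\<lambda>\<omega>. \<theta> j ^ m * (Z j (h l) m \<omega> - Minf j (h l) \<omega>)) \<in> borel_measurable M"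
          by (rule borel_measurable_times[OF borel_measurable_const borel_measurable_diff[OF Z_meas[OF j] Minf_meas[OF j]]])
        have n1: "1 = cmod (\<theta> j ^ m)" using norm_theta[OF j] by (simp add: norm_power)
        show "(\<integral>\<^sup>+\<omega>. ennreal (cmod (\<theta> j ^ m * (Z j (h l) m \<omega> - Minf j (h l) \<omega>))) \<partial>M)
          \<le> ennreal (1 * (?D * s ^ m))"
          by (subst n1, rule nn_integral_norm_scale_le)
            (rule borel_measurable_diff[OF Z_meas[OF j] Minf_meas[OF j]], rule L1_distance[OF g_in_F g_nonneg K growth h_in_F j eigenprojection_bound[OF usb j]])
        show "0 \<le> 1 * (?D * s ^ m)" using mult_nonneg_nonneg[OF D, of "s ^ m"] s_pos by simp
      qed
      show sum_meas: "(\<lambda>\<omega>. \<Sum>j\<in>J. \<theta> j ^ m * (Z j (h l) m \<omega> - Minf j (h l) \<omega>)) \<in> borel_measurable M"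
        using Z_meas Minf_meas by (intro borel_measurable_sum borel_measurable_times borel_measurable_diff) auto
      show "(\<lambda>\<omega>. 1 / complex_of_real (2 * \<alpha>) ^ m * gensum m (spectrally_centered \<mu> J R (h l)) \<omega>
        + (\<Sum>j\<in>J. \<theta> j ^ m * (Z j (h l) m \<omega> - Minf j (h l) \<omega>))) \<in> borel_measurable M"
        by (rule borel_measurable_add[OF scaled[OF gensum_meas] sum_meas])
      show "(\<lambda>\<omega>. 1 / complex_of_real (2 * \<alpha>) ^ m * complex_of_real (\<Sum>u\<in>gen m. f l (triangle X u \<omega>) - h l (X u \<omega>)))
        \<in> borel_measurable M" by (rule scaled[OF compensated_measurable])
      show "(\<lambda>\<omega>. 1 / complex_of_real (2 * \<alpha>) ^ m * gensum m (spectrally_centered \<mu> J R (h l)) \<omega>) \<in> borel_measurable M"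
        by (rule scaled[OF gensum_meas])
    qed (intro add_nonneg_nonneg nonneg)+
    also have "1 / (2 * \<alpha>) ^ m * (sqrt 2 ^ m * c) + (1 / (2 * \<alpha>) ^ m * ((2 * \<alpha>) ^ m * ((?G + ?B) * ?C m))
        + (\<Sum>j\<in>J. 1 * (?D * s ^ m))) = ?e m"
      using alpha_pos by (simp add: s_eq power_divide)
    finally show "(\<integral>\<^sup>+\<omega>. ennreal (cmod (complex_of_real (tree_sum X (gen m) (triple_centered P \<mu> (f l)) \<omega>) / complex_of_real (2 * \<alpha>) ^ m
        - (\<Sum>j\<in>J. \<theta> j ^ m * Minf j (h l) \<omega>))) \<partial>M) \<le> ennreal (?e m)" .
  qed
qed

text \<open>The two square roots combine because \<open>2 * \<alpha>^2 * 2\<close> is the square of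
  \<open>2 * \<alpha>\<close>.\<close>

lemma normalisation: "(2 * \<alpha>\<^sup>2) powr (- real n / 2) * real (card (gen n)) powr (- 1 / 2) = 1 / (2 * \<alpha>) ^ n"
proof -
  have "real (card (gen n)) = 2 powr real n"
    by (simp add: card_gen powr_realpow)
  then have "real (card (gen n)) powr (- 1 / 2) = 2 powr (- real n / 2)"
    by (simp add: powr_powr)
  then have "(2 * \<alpha>\<^sup>2) powr (- real n / 2) * real (card (gen n)) powr (- 1 / 2) = (2 * \<alpha>\<^sup>2 * 2) powr (- real n / 2)"
    by (simp only: powr_mult)
  also have "2 * \<alpha>\<^sup>2 * 2 = (2 * \<alpha>) powr 2"
    using alpha_pos by (simp add: power_mult_distrib)
  also have "((2 * \<alpha>) powr 2) powr (- real n / 2) = (2 * \<alpha>) powr (- real n)"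
    by (simp add: powr_powr)
  also have "\<dots> = 1 / (2 * \<alpha>) ^ n"
    using alpha_pos by (simp add: powr_minus powr_realpow divide_inverse)
  finally show ?thesis .
qed

text \<open>Splitting \<open>(2 * \<alpha>) ^ n\<close> into the powers l and n - l pairs the l-th
  summand of \<open>N_root\<close> with the l-th term of the series, at generation n - l. The paired
  terms form a geometric convolution of the errors \<open>e\<close>; the terms l > n have no partner
  and are small by themselves.\<close>

lemma root_sum_limit:
  "tends_to_zero_in_probability M (\<lambda>n \<omega>.
      complex_of_real ((2 * \<alpha>\<^sup>2) powr (- real n / 2) * N_root P \<mu> X f n \<omega>)
      - (\<Sum>l. complex_of_real ((2 * \<alpha>) powi (- int l))
          * (\<Sum>j\<in>J. (a j / complex_of_real \<alpha>) powi (int n - int l) * Minf j (h l) \<omega>)))"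
proof (rule generation_limit)
  fix e :: "nat \<Rightarrow> real" and C :: real
  assume e: "\<And>m. 0 \<le> e m" "e \<longlonglongrightarrow> 0" and C: "0 \<le> C"
    and dist: "\<And>m l. (\<integral>\<^sup>+\<omega>. ennreal (cmod (complex_of_real (tree_sum X (gen m) (triple_centered P \<mu> (f l)) \<omega>) / complex_of_real (2 * \<alpha>) ^ m
      - (\<Sum>j\<in>J. \<theta> j ^ m * Minf j (h l) \<omega>))) \<partial>M) \<le> ennreal (e m)"
    and limit: "\<And>j l. j \<in> J \<Longrightarrow> (\<integral>\<^sup>+\<omega>. ennreal (cmod (Minf j (h l) \<omega>)) \<partial>M) \<le> ennreal C"
    and Minf_meas: "\<And>j l. j \<in> J \<Longrightarrow> Minf j (h l) \<in> borel_measurable M"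
  define q where "q = 1 / (2 * \<alpha>)"
  have "s < 1" by (rule s_less_1)
  then have "1 < sqrt 2 * \<alpha>" using alpha_pos by (simp add: s_def)
  also have "sqrt 2 * \<alpha> \<le> 2 * \<alpha>" using alpha_pos sqrt2_less_2 by (intro mult_right_mono) auto
  finally have q: "0 < q" "q < 1" using alpha_pos by (simp_all add: q_def)
  have powi_q: "(2 * \<alpha>) powi (- int l) = q ^ l" for l
    by (simp only: q_def power_int_minus power_int_of_nat power_one_over inverse_eq_divide)
  \<comment> \<open>Integer powers are essential here: for l > n the phase has a negative exponent,
    but still modulus one.\<close>
  define t where "t n l \<omega> = complex_of_real (q ^ l) * (\<Sum>j\<in>J. \<theta> j powi (int n - int l) * Minf j (h l) \<omega>)" for n l \<omega>
  define U where "U m l \<omega> = complex_of_real (tree_sum X (gen m) (triple_centered P \<mu> (f l)) \<omega>) / complex_of_real (2 * \<alpha>) ^ m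
      - (\<Sum>j\<in>J. \<theta> j ^ m * Minf j (h l) \<omega>)" for m l \<omega>
  define D where "D = real (card J) * C"
  have D: "0 \<le> D" using C by (simp add: D_def)
  have phase_sum_meas: "(\<lambda>\<omega>. \<Sum>j\<in>J. c j * Minf j (h l) \<omega>) \<in> borel_measurable M" for c l
    using Minf_meas by (intro borel_measurable_sum borel_measurable_times) auto
  have t_meas [measurable]: "t n l \<in> borel_measurable M" for n l
    unfolding t_def[abs_def] using phase_sum_meas by (intro borel_measurable_times) auto
  have tree_sum_meas [measurable]: "tree_sum X (gen m) (triple_centered P \<mu> (f l)) \<in> borel_measurable M" for m l
    unfolding tree_sum_def[abs_def] triple_centered_def by measurable
  have U_meas [measurable]: "U m l \<in> borel_measurable M" for m l
    unfolding U_def[abs_def] using phase_sum_meas by (intro borel_measurable_diff) auto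
  have t_L1: "(\<integral>\<^sup>+\<omega>. ennreal (cmod (t n l \<omega>)) \<partial>M) \<le> ennreal (q ^ l * D)" for n l
  proof -
    have "(\<integral>\<^sup>+\<omega>. ennreal (cmod (\<Sum>j\<in>J. \<theta> j powi (int n - int l) * Minf j (h l) \<omega>)) \<partial>M) \<le> ennreal (\<Sum>j\<in>J. 1 * C)"
    proof (intro nn_integral_norm_sum_le finite_J)
      fix j assume j: "j \<in> J"
      have n1: "1 = cmod (\<theta> j powi (int n - int l))" using norm_theta[OF j] by (simp add: norm_power_int)
      show "(\<lambda>\<omega>. \<theta> j powi (int n - int l) * Minf j (h l) \<omega>) \<in> borel_measurable M"
        using Minf_meas[OF j] by (intro borel_measurable_times) auto
      show "(\<integral>\<^sup>+\<omega>. ennreal (cmod (\<theta> j powi (int n - int l) * Minf j (h l) \<omega>)) \<partial>M) \<le> ennreal (1 * C)"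
        by (subst n1) (rule nn_integral_norm_scale_le[OF Minf_meas[OF j] limit[OF j]])
    qed (use C in simp)
    from nn_integral_norm_scale_le[OF phase_sum_meas this, of "complex_of_real (q ^ l)"] show ?thesis
      using q by (simp add: t_def D_def norm_power)
  qed
  have main: "AE \<omega> in M. complex_of_real ((2 * \<alpha>\<^sup>2) powr (- real n / 2) * N_root P \<mu> X f n \<omega>) - (\<Sum>l. t n l \<omega>)
      = (\<Sum>l\<le>n. complex_of_real (q ^ l) * U (n - l) l \<omega>) + (- 1) * (\<Sum>i. t n (i + Suc n) \<omega>)" for n
  proof -
    \<comment> \<open>Splitting the infinite sum at n is legitimate only where it converges, so the
      identity holds almost everywhere.\<close>
    have "summable (\<lambda>l. q ^ l * D)" using q by (intro summable_mult2 summable_geometric) auto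
    then have "AE \<omega> in M. summable (\<lambda>l. norm (t n l \<omega>))"
      using q D by (intro AE_summable_norm[OF t_meas t_L1]) auto
    then show ?thesis
    proof eventually_elim
      case (elim \<omega>)
      have tree: "complex_of_real ((2 * \<alpha>\<^sup>2) powr (- real n / 2) * N_root P \<mu> X f n \<omega>)
          = (\<Sum>l\<le>n. complex_of_real (q ^ l)
              * (complex_of_real (tree_sum X (gen (n - l)) (triple_centered P \<mu> (f l)) \<omega>) / complex_of_real (2 * \<alpha>) ^ (n - l)))"
      proof -
        have "(2 * \<alpha>\<^sup>2) powr (- real n / 2) * N_root P \<mu> X f n \<omega>
            = 1 / (2 * \<alpha>) ^ n * (\<Sum>l\<le>n. tree_sum X (gen (n - l)) (triple_centered P \<mu> (f l)) \<omega>)"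
          unfolding N_root_def mult.assoc[symmetric] normalisation ..
        also have "\<dots> = (\<Sum>l\<le>n. q ^ l * (tree_sum X (gen (n - l)) (triple_centered P \<mu> (f l)) \<omega> / (2 * \<alpha>) ^ (n - l)))"
          unfolding sum_distrib_left
        proof (rule sum.cong[OF refl])
          fix l assume "l \<in> {..n}"
          then have split: "(2 * \<alpha>) ^ n = (2 * \<alpha>) ^ l * (2 * \<alpha>) ^ (n - l)"
            using power_add[of "2 * \<alpha>" l "n - l"] by simp
          have arith: "1 / (x * y) * z = 1 / x * (z / y)" for x y z :: real by simp
          show "1 / (2 * \<alpha>) ^ n * tree_sum X (gen (n - l)) (triple_centered P \<mu> (f l)) \<omega>
              = q ^ l * (tree_sum X (gen (n - l)) (triple_centered P \<mu> (f l)) \<omega> / (2 * \<alpha>) ^ (n - l))"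
            unfolding q_def power_one_over split by (rule arith)
        qed
        finally show ?thesis by simp
      qed
      have "(\<Sum>l. t n l \<omega>) = (\<Sum>i. t n (i + Suc n) \<omega>) + (\<Sum>l<Suc n. t n l \<omega>)"
        by (rule suminf_split_initial_segment[OF summable_norm_cancel[OF elim]])
      also have "(\<Sum>l<Suc n. t n l \<omega>) = (\<Sum>l\<le>n. complex_of_real (q ^ l) * (\<Sum>j\<in>J. \<theta> j ^ (n - l) * Minf j (h l) \<omega>))"
        unfolding lessThan_Suc_atMost t_def
        by (intro sum.cong refl) (auto simp: of_nat_diff[symmetric] power_int_of_nat simp del: of_nat_diff)
      finally show ?case
        unfolding tree U_def right_diff_distrib sum_subtractf by simp
    qed
  qed
  \<comment> \<open>The first sum bounds the paired terms l \<le> n; the second bounds the unpaired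
    tail and equals \<open>q ^ Suc n * (D / (1 - q))\<close>.\<close>
  let ?w = "\<lambda>n. (\<Sum>l\<le>n. q ^ l * e (n - l)) + (\<Sum>i. q ^ (i + Suc n) * D)"
  show ?thesis
    unfolding \<theta>_def[symmetric] powi_q t_def[symmetric]
  proof (rule tends_to_zero_in_probabilityI[where w = ?w])
    show "prob_space M" by (rule prob_space_axioms)
    show "(\<lambda>\<omega>. complex_of_real ((2 * \<alpha>\<^sup>2) powr (- real n / 2) * N_root P \<mu> X f n \<omega>) - (\<Sum>l. t n l \<omega>)) \<in> borel_measurable M" for n
      unfolding N_root_def by measurable
    have tail_summable: "summable (\<lambda>i. q ^ (i + Suc n) * D)" for n
      using q by (intro summable_mult2 summable_ignore_initial_segment summable_geometric) auto
    have tail_nonneg: "0 \<le> (\<Sum>i. q ^ (i + Suc n) * D)" for n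
      using q D by (intro suminf_nonneg tail_summable) auto
    have head_nonneg: "0 \<le> (\<Sum>l\<le>n. q ^ l * e (n - l))" for n
      using q e by (intro sum_nonneg mult_nonneg_nonneg) auto
    show "0 \<le> ?w n" for n using tail_nonneg head_nonneg by (intro add_nonneg_nonneg)
    show "(\<integral>\<^sup>+\<omega>. ennreal (cmod (complex_of_real ((2 * \<alpha>\<^sup>2) powr (- real n / 2) * N_root P \<mu> X f n \<omega>) - (\<Sum>l. t n l \<omega>))) \<partial>M)
      \<le> ennreal (?w n)" for n
    proof -
      have "(\<integral>\<^sup>+\<omega>. ennreal (cmod (complex_of_real ((2 * \<alpha>\<^sup>2) powr (- real n / 2) * N_root P \<mu> X f n \<omega>) - (\<Sum>l. t n l \<omega>))) \<partial>M)
        = (\<integral>\<^sup>+\<omega>. ennreal (cmod ((\<Sum>l\<le>n. complex_of_real (q ^ l) * U (n - l) l \<omega>) + (- 1) * (\<Sum>i. t n (i + Suc n) \<omega>))) \<partial>M)"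
        by (rule nn_integral_cong_AE) (use main[of n] in eventually_elim, simp only:)
      also have "\<dots> \<le> ennreal (?w n)"
      proof (intro nn_integral_norm_add_le)
        show "(\<integral>\<^sup>+\<omega>. ennreal (cmod (\<Sum>l\<le>n. complex_of_real (q ^ l) * U (n - l) l \<omega>)) \<partial>M) \<le> ennreal (\<Sum>l\<le>n. q ^ l * e (n - l))"
        proof (intro nn_integral_norm_sum_le)
          fix l
          have "cmod (complex_of_real (q ^ l)) = q ^ l" using q by (simp add: norm_power)
          then show "(\<integral>\<^sup>+\<omega>. ennreal (cmod (complex_of_real (q ^ l) * U (n - l) l \<omega>)) \<partial>M) \<le> ennreal (q ^ l * e (n - l))"
            using nn_integral_norm_scale_le[OF U_meas dist[folded U_def], of "complex_of_real (q ^ l)" "n - l" l] by simp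
        qed (use q e in auto)
        have "(\<integral>\<^sup>+\<omega>. ennreal (cmod (\<Sum>i. t n (i + Suc n) \<omega>)) \<partial>M) \<le> ennreal (\<Sum>i. q ^ (i + Suc n) * D)"
          using q D by (intro nn_integral_norm_suminf_le t_L1 t_meas tail_summable) auto
        then show "(\<integral>\<^sup>+\<omega>. ennreal (cmod ((- 1) * (\<Sum>i. t n (i + Suc n) \<omega>))) \<partial>M) \<le> ennreal (\<Sum>i. q ^ (i + Suc n) * D)"
          by (simp only: norm_mult norm_minus_cancel norm_one mult_1)
      qed (use tail_nonneg head_nonneg in \<open>auto intro!: borel_measurable_suminf\<close>)
      finally show ?thesis .
    qed
    have "(\<lambda>n. (\<Sum>i. q ^ (i + Suc n) * D)) = (\<lambda>n. q ^ Suc n * (D * (1 / (1 - q))))"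
    proof
      fix n
      have "(\<Sum>i. q ^ (i + Suc n) * D) = (\<Sum>i. q ^ Suc n * D * q ^ i)"
        by (intro arg_cong[where f = suminf] ext) (simp add: power_add mult_ac)
      also have "\<dots> = q ^ Suc n * D * (\<Sum>i. q ^ i)"
        using q by (intro suminf_mult summable_geometric) auto
      finally show "(\<Sum>i. q ^ (i + Suc n) * D) = q ^ Suc n * (D * (1 / (1 - q)))"
        using q by (simp add: suminf_geometric)
    qed
    moreover have "(\<lambda>n. q ^ Suc n * (D * (1 / (1 - q)))) \<longlonglongrightarrow> 0 * (D * (1 / (1 - q)))"
      using q by (intro tendsto_mult_right LIMSEQ_Suc LIMSEQ_realpow_zero) auto
    ultimately have "(\<lambda>n. (\<Sum>i. q ^ (i + Suc n) * D)) \<longlonglongrightarrow> 0" by simp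
    from tendsto_add[OF geometric_convolution_tendsto_zero[OF _ q(2) e(2)] this] q
    show "?w \<longlonglongrightarrow> 0" by simp
  qed
qed

end

end

theorem theorem4p3:
  fixes M :: "'w measure" and S \<nu> \<mu> :: "'s measure"
    and P :: "'s \<Rightarrow> ('s \<times> 's) measure"
    and X :: "bool list \<Rightarrow> 'w \<Rightarrow> 's"
    and F :: "('s \<Rightarrow> real) set"
    and \<alpha> :: real and J :: "'j set" and a :: "'j \<Rightarrow> complex"
    and R :: "'j \<Rightarrow> ('s \<Rightarrow> complex) \<Rightarrow> 's \<Rightarrow> complex"
    and \<beta> :: "nat \<Rightarrow> real"
    and f :: "nat \<Rightarrow> 's \<times> 's \<times> 's \<Rightarrow> real"
    and g :: "'s \<Rightarrow> real"
  assumes "prob_space M"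
    and "P \<in> S \<rightarrow>\<^sub>M prob_algebra (S \<Otimes>\<^sub>M S)"
    and "bifurcating_markov_chain M S \<nu> P X"
    and "structural_assumption S \<nu> P F"
    and "second_spectral_gap S (induced_kernel S P) F \<mu> \<alpha> J a R \<beta>"
    and "1 / sqrt 2 < \<alpha>" and "\<alpha> < 1"
    and "\<And>l. f l \<in> borel_measurable (S \<Otimes>\<^sub>M S \<Otimes>\<^sub>M S)"
    and "\<And>l. triple_op_well_defined S P (f l)"
    and "\<And>l. triple_op_well_defined S P (\<lambda>t. (f l t)\<^sup>2)"
    and "uniform_spectral_bounds S (induced_kernel S P) F \<mu> \<alpha> J R \<beta>
           (\<lambda>l. triple_op P (f l)) g"
    and "uniform_spectral_bounds S (induced_kernel S P) F \<mu> \<alpha> J R \<beta>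
           (\<lambda>l. triple_op P (\<lambda>t. (f l t)\<^sup>2)) g"
  shows "tends_to_zero_in_probability M (\<lambda>n \<omega>.
      complex_of_real ((2 * \<alpha>\<^sup>2) powr (- real n / 2) * N_root P \<mu> X f n \<omega>)
      - (\<Sum>l. complex_of_real ((2 * \<alpha>) powi (- int l))
          * (\<Sum>j\<in>J. (a j / complex_of_real \<alpha>) powi (int n - int l)
              * eigen_martingale_limit M X (a j) (R j) (triple_op P (f l)) \<omega>)))"
proof -
  interpret prob_space M by fact
  interpret spectral_bmc M S P \<nu> X F \<mu> \<alpha> J a R \<beta>
    using assms(2-6) by unfold_locales
  show ?thesis
    by (rule root_sum_limit[OF assms(8-12)])
qed

end
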